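(* Consider a magnetically controlled nonholonomic system with state space $\mathcal{D}'$, controlled vector fields $X_{\mathcal{B}}$ on $\mathcal{D}'$ (parametrized by $B\in\mathcal{U}$) and running cost $\ell:\mathcal{D}'\times\mathcal{U}\to\mathbb{R}$, and let $H_{opt}:T^*\mathcal{D}'\to\mathbb{R}$ be its optimal control Hamiltonian. Let $Y$ be the Hamiltonian vector field on $T^*\mathcal{D}'$ defined by $i_Y\Omega=dH_{opt}$, where $\Omega$ is the canonical symplectic form on $T^*\mathcal{D}'$. Then the extended optimal control Hamiltonian flow, i.e. the flow of $Y$, has at least two constants of motion; that is, there exist $E_1,E_2:T^*\mathcal{D}'\to\mathbb{R}$ such that $\mathcal{L}_YE_i=0$ for $i\in\{1,2\}$, where $\mathcal{L}$ denotes the Lie derivative.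
   Context: All objects (including $H_{opt}$ and the optimal control) are smooth, and repeated indices are summed. A magnetically controlled nonholonomic system is one of the following two kinds. (A) General case. $Q$ is an $n$-dimensional manifold, $\pi_Q:T^*Q\to Q$ is the cotangent projection, $H:T^*Q\to\mathbb{R}$ is a natural Hamiltonian (kinetic energy of a Riemannian metric plus potential energy), and $\mathcal{D}\subset TQ$ is a nonintegrable distribution given by $k<n$ linear constraints, with local 1-forms $\eta_1,\dots,\eta_k$ spanning its annihilator. The state space is $\mathcal{D}'=(\mathbb{F}H)^{-1}(\mathcal{D})\subset T^*Q$, where $\mathbb{F}H(q,p)=(q,\partial H/\partial p)$. For a closed 2-form $\mathcal{B}\in\Omega^2(Q)$, $X_{\mathcal{B}}$ is the vector field on $\mathcal{D}'$ determined by $i_{X_{\mathcal{B}}}\omega_{\mathcal{B}}=dH+\lambda^i\pi_Q^*\eta_i$, $\omega_{\mathcal{B}}=\omega+\pi_Q^*\mathcal{B}$, $\omega=dq^i\wedge dp_i$, with the multipliers $\lambda^i$ chosen so that $X_{\mathcal{B}}$ is tangent to $\mathcal{D}'$. (B) Reduced left-invariant case. $Q=G$ is a Lie group with Lie algebra $\mathfrak{g}$, and $H:T^*G\to\mathbb{R}$, $\mathcal{D}\subset TG$ and the closed 2-form $\mathcal{B}\in\Omega^2(G)$ are left-invariant. With $h=H|_{\mathfrak{g}^*}$ and $\eta_i\in\mathfrak{g}^*$ a basis of the annihilator of $\mathcal{D}_e\subset\mathfrak{g}$ ($e$ being the identity of $G$), the state space is $\mathcal{D}'=\{\mu\in\mathfrak{g}^*: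 dh(\mu)\in\mathcal{D}_e\}$, and $X_{\mathcal{B}}$ is given by $\dot\mu=\mathrm{ad}^*_{dh}\mu+\mathcal{B}_e(dh,\cdot)+\lambda^i\eta_i$ with the multipliers $\lambda^i$ chosen to enforce the constraints (so that $X_{\mathcal{B}}$ is tangent to $\mathcal{D}'$). The control is the magnetic 2-form: $B$ denotes the matrix entries of $\mathcal{B}$, regarded as an element of the space of admissible controls $\mathcal{U}$, with $B\in\mathbb{R}^N$ for some $N$. The optimal control problem is to minimize $J(B)=\int_0^T\ell(x,B)\,dt$ over controls with fixed endpoints $x(0),x(T)$, subject to $\dot x=X_{\mathcal{B}}(x)$, $x\in\mathcal{D}'$. Let $(x,y)$ be the induced coordinates on $T^*\mathcal{D}'$ ($x$ on $\mathcal{D}'$, $y$ the conjugate momenta), so that $\Omega=dx\wedge dy$. The extended Hamiltonian is $\tilde H:\mathcal{U}\times T^*\mathcal{D}'\to\mathbb{R}$, $\tilde H(B,x,y)=\ell(x,B)+\langle y,X_{\mathcal{B}}(x)\rangle$. It is assumed that for each $(x,y)$ the equation $\partial\tilde H/\partial B=0$ has a unique solution $B_{opt}(x,y)$ and that this completely determines the optimal control (the minimizer of $\tilde H$ over $B$). The optimal control Hamiltonian is $H_{opt}(x,y)=\min_B\tilde H(B,x,y)$. *)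

theory Defs
  imports "HOL-Analysis.Analysis" "HOL-Algebra.Group"
begin

subsection \<open>Smooth maps between open subsets of Euclidean spaces\<close>

text \<open>Only used for open sets; \<open>C_on k\<close> is \<open>C\<^sup>k\<close>.\<close>

primrec C_on :: "nat \<Rightarrow> 'a::euclidean_space set \<Rightarrow> ('a \<Rightarrow> 'b::real_normed_vector) \<Rightarrow> bool" where
  "C_on 0 S f \<longleftrightarrow> continuous_on S f"
| "C_on (Suc k) S f \<longleftrightarrow>
     (\<forall>x\<in>S. f differentiable (at x)) \<and> (\<forall>v. C_on k S (\<lambda>x. frechet_derivative f (at x) v))"

definition smooth_on :: "'a::euclidean_space set \<Rightarrow> ('a \<Rightarrow> 'b::real_normed_vector) \<Rightarrow> bool" where
  "smooth_on S f \<longleftrightarrow> (\<forall>k. C_on k S f)"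


subsection \<open>Smooth manifolds given by atlases\<close>

text \<open>
  A chart is a domain together with a coordinate map; outside its domain the coordinate map is
  irrelevant. The manifold is the union of the chart domains and carries the topology induced by
  the atlas, so that no topology on the point type is needed.
\<close>

type_synonym ('m, 'e) chart = "'m set \<times> ('m \<Rightarrow> 'e)"
type_synonym ('m, 'e) atlas = "('m, 'e) chart set"

definition points :: "('m, 'e) atlas \<Rightarrow> 'm set" where
  "points A = (\<Union>c\<in>A. fst c)"

definition cinv :: "('m, 'e) chart \<Rightarrow> 'e \<Rightarrow> 'm" where
  "cinv c = inv_into (fst c) (snd c)"

definition mopen :: "('m, 'e::euclidean_space) atlas \<Rightarrow> 'm set \<Rightarrow> bool" where
  "mopen A W \<longleftrightarrow> W \<subseteq> points A \<and> (\<forall>c\<in>A. open (snd c ` (fst c \<inter> W)))"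

definition smooth_manifold :: "('m, 'e::euclidean_space) atlas \<Rightarrow> bool" where
  "smooth_manifold A \<longleftrightarrow>
     (\<forall>c\<in>A. inj_on (snd c) (fst c) \<and> open (snd c ` fst c)) \<and>
     (\<forall>c\<in>A. \<forall>d\<in>A. open (snd c ` (fst c \<inter> fst d)) \<and>
                    smooth_on (snd c ` (fst c \<inter> fst d)) (snd d \<circ> cinv c)) \<and>
     (\<forall>x\<in>points A. \<forall>y\<in>points A. x \<noteq> y \<longrightarrow>
        (\<exists>V W. mopen A V \<and> mopen A W \<and> x \<in> V \<and> y \<in> W \<and> V \<inter> W = {})) \<and>
     (\<exists>C\<subseteq>A. countable C \<and> points C = points A)"

definition smooth_fun_on ::
    "('m, 'e::euclidean_space) atlas \<Rightarrow> 'm set \<Rightarrow> ('m \<Rightarrow> 'b::real_normed_vector) \<Rightarrow> bool" where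
  "smooth_fun_on A W f \<longleftrightarrow> (\<forall>c\<in>A. smooth_on (snd c ` (fst c \<inter> W)) (f \<circ> cinv c))"

definition smooth_fun :: "('m, 'e::euclidean_space) atlas \<Rightarrow> ('m \<Rightarrow> 'b::real_normed_vector) \<Rightarrow> bool" where
  "smooth_fun A f \<longleftrightarrow> smooth_fun_on A (points A) f"

definition smooth_map ::
    "('m, 'e::euclidean_space) atlas \<Rightarrow> ('n, 'f::euclidean_space) atlas \<Rightarrow> ('m \<Rightarrow> 'n) \<Rightarrow> bool" where
  "smooth_map A A' F \<longleftrightarrow> F ` points A \<subseteq> points A' \<and>
     (\<forall>c\<in>A. \<forall>d\<in>A'. open (snd c ` (fst c \<inter> F -` fst d)) \<and>
                    smooth_on (snd c ` (fst c \<inter> F -` fst d)) (snd d \<circ> F \<circ> cinv c))"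

definition prod_atlas :: "('m, 'e) atlas \<Rightarrow> ('n, 'f) atlas \<Rightarrow> ('m \<times> 'n, 'e \<times> 'f) atlas" where
  "prod_atlas A A' = {(fst c \<times> fst d, map_prod (snd c) (snd d)) | c d. c \<in> A \<and> d \<in> A'}"


subsection \<open>Tangent and cotangent vectors\<close>

text \<open>
  A tangent vector at \<open>x\<close> is its family of components in the charts around \<open>x\<close>, subject to the
  usual transformation law (and \<open>0\<close> at all other charts). A covector is a linear functional on the
  tangent space, set to \<open>0\<close> outside of it.
\<close>

type_synonym ('m, 'e) tvec = "('m, 'e) chart \<Rightarrow> 'e"
type_synonym ('m, 'e) covec = "('m, 'e) tvec \<Rightarrow> real"

definition chart_at :: "('m, 'e) atlas \<Rightarrow> 'm \<Rightarrow> ('m, 'e) chart" where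
  "chart_at A x = (SOME c. c \<in> A \<and> x \<in> fst c)"

definition tangent_space :: "('m, 'e::euclidean_space) atlas \<Rightarrow> 'm \<Rightarrow> ('m, 'e) tvec set" where
  "tangent_space A x = {v.
     (\<forall>c\<in>A. \<forall>d\<in>A. x \<in> fst c \<and> x \<in> fst d \<longrightarrow>
        v d = frechet_derivative (snd d \<circ> cinv c) (at (snd c x)) (v c)) \<and>
     (\<forall>c. \<not> (c \<in> A \<and> x \<in> fst c) \<longrightarrow> v c = 0)}"

definition coord_vec :: "('m, 'e::euclidean_space) atlas \<Rightarrow> ('m, 'e) chart \<Rightarrow> 'm \<Rightarrow> 'e \<Rightarrow> ('m, 'e) tvec" where
  "coord_vec A c x a =
     (\<lambda>d. if d \<in> A \<and> x \<in> fst d then frechet_derivative (snd d \<circ> cinv c) (at (snd c x)) a else 0)"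

definition covector_restrict :: "('m, 'e::euclidean_space) atlas \<Rightarrow> 'm \<Rightarrow> ('m, 'e) covec \<Rightarrow> ('m, 'e) covec" where
  "covector_restrict A x \<alpha> = (\<lambda>v. if v \<in> tangent_space A x then \<alpha> v else 0)"

definition cotangent_space :: "('m, 'e::euclidean_space) atlas \<Rightarrow> 'm \<Rightarrow> ('m, 'e) covec set" where
  "cotangent_space A x = {\<alpha>.
     (\<forall>v\<in>tangent_space A x. \<forall>w\<in>tangent_space A x. \<forall>a b.
        \<alpha> (\<lambda>c. a *\<^sub>R v c + b *\<^sub>R w c) = a * \<alpha> v + b * \<alpha> w) \<and>
     (\<forall>v. v \<notin> tangent_space A x \<longrightarrow> \<alpha> v = 0)}"

definition tangent_map ::
    "('m, 'e::euclidean_space) atlas \<Rightarrow> ('n, 'f::euclidean_space) atlas \<Rightarrow> ('m \<Rightarrow> 'n) \<Rightarrow>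
     'm \<Rightarrow> ('m, 'e) tvec \<Rightarrow> ('n, 'f) tvec" where
  "tangent_map A A' F x v = (\<lambda>d. if d \<in> A' \<and> F x \<in> fst d
     then (let c = chart_at A x in frechet_derivative (snd d \<circ> F \<circ> cinv c) (at (snd c x)) (v c))
     else 0)"

definition differential ::
    "('m, 'e::euclidean_space) atlas \<Rightarrow> ('m \<Rightarrow> real) \<Rightarrow> 'm \<Rightarrow> ('m, 'e) covec" where
  "differential A f x = covector_restrict A x
     (\<lambda>v. let c = chart_at A x in frechet_derivative (f \<circ> cinv c) (at (snd c x)) (v c))"

definition vector_field :: "('m, 'e::euclidean_space) atlas \<Rightarrow> ('m \<Rightarrow> ('m, 'e) tvec) \<Rightarrow> bool" where
  "vector_field A X \<longleftrightarrow> (\<forall>x\<in>points A. X x \<in> tangent_space A x) \<and>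
     (\<forall>c\<in>A. smooth_on (snd c ` fst c) (\<lambda>u. X (cinv c u) c))"

definition one_form_on ::
    "('m, 'e::euclidean_space) atlas \<Rightarrow> 'm set \<Rightarrow> ('m \<Rightarrow> ('m, 'e) covec) \<Rightarrow> bool" where
  "one_form_on A W \<eta> \<longleftrightarrow> (\<forall>x\<in>W. \<eta> x \<in> cotangent_space A x) \<and>
     (\<forall>c\<in>A. \<forall>a. smooth_on (snd c ` (fst c \<inter> W)) (\<lambda>u. \<eta> (cinv c u) (coord_vec A c (cinv c u) a)))"

type_synonym ('m, 'e) tensor2 = "'m \<Rightarrow> ('m, 'e) tvec \<Rightarrow> ('m, 'e) tvec \<Rightarrow> real"

definition components ::
    "('m, 'e::euclidean_space) atlas \<Rightarrow> ('m, 'e) tensor2 \<Rightarrow> ('m, 'e) chart \<Rightarrow> 'e \<Rightarrow> 'e \<Rightarrow> 'e \<Rightarrow> real" where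
  "components A g c a b u = g (cinv c u) (coord_vec A c (cinv c u) a) (coord_vec A c (cinv c u) b)"

definition smooth_tensor2 :: "('m, 'e::euclidean_space) atlas \<Rightarrow> ('m, 'e) tensor2 \<Rightarrow> bool" where
  "smooth_tensor2 A g \<longleftrightarrow>
     (\<forall>x\<in>points A. \<forall>v\<in>tangent_space A x.
        covector_restrict A x (g x v) \<in> cotangent_space A x \<and>
        covector_restrict A x (\<lambda>w. g x w v) \<in> cotangent_space A x) \<and>
     (\<forall>c\<in>A. \<forall>a b. smooth_on (snd c ` fst c) (components A g c a b))"

definition riemannian_metric :: "('m, 'e::euclidean_space) atlas \<Rightarrow> ('m, 'e) tensor2 \<Rightarrow> bool" where
  "riemannian_metric A g \<longleftrightarrow> smooth_tensor2 A g \<and>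
     (\<forall>x\<in>points A. \<forall>v\<in>tangent_space A x.
        (\<forall>w\<in>tangent_space A x. g x v w = g x w v) \<and> (v \<noteq> (\<lambda>_. 0) \<longrightarrow> g x v v > 0))"

text \<open>Closedness is the vanishing of the exterior derivative on coordinate vector fields.\<close>

definition closed_two_form :: "('m, 'e::euclidean_space) atlas \<Rightarrow> ('m, 'e) tensor2 \<Rightarrow> bool" where
  "closed_two_form A \<beta> \<longleftrightarrow> smooth_tensor2 A \<beta> \<and>
     (\<forall>x\<in>points A. \<forall>v\<in>tangent_space A x. \<forall>w\<in>tangent_space A x. \<beta> x v w = - \<beta> x w v) \<and>
     (\<forall>c\<in>A. \<forall>u\<in>snd c ` fst c. \<forall>a b e.
        frechet_derivative (components A \<beta> c b e) (at u) a +
        frechet_derivative (components A \<beta> c e a) (at u) b +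
        frechet_derivative (components A \<beta> c a b) (at u) e = 0)"

text \<open>
  \<open>embedded_submanifold A S\<close>: the inclusion of \<open>S\<close> into \<open>A\<close> is a smooth immersion and a
  homeomorphism onto its image. The smooth structure of \<open>S\<close> is determined by its set of points.
\<close>

definition embedded_submanifold ::
    "('m, 'e::euclidean_space) atlas \<Rightarrow> ('m, 'd::euclidean_space) atlas \<Rightarrow> bool" where
  "embedded_submanifold A S \<longleftrightarrow> smooth_manifold S \<and> smooth_map S A (\<lambda>x. x) \<and>
     (\<forall>x\<in>points S. inj_on (tangent_map S A (\<lambda>x. x) x) (tangent_space S x)) \<and>
     (\<forall>V\<subseteq>points S. mopen S V \<longleftrightarrow> (\<exists>W. mopen A W \<and> V = points S \<inter> W))"


subsection \<open>The cotangent bundle\<close>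

type_synonym ('m, 'e) cotangent = "'m \<times> ('m, 'e) covec"

definition cotangent_chart ::
    "('m, 'e::euclidean_space) atlas \<Rightarrow> ('m, 'e) chart \<Rightarrow> (('m, 'e) cotangent, 'e \<times> 'e) chart" where
  "cotangent_chart A c =
     ({(x, \<alpha>). x \<in> fst c \<and> \<alpha> \<in> cotangent_space A x},
      \<lambda>(x, \<alpha>). (snd c x, \<Sum>b\<in>Basis. \<alpha> (coord_vec A c x b) *\<^sub>R b))"

definition cotangent_atlas ::
    "('m, 'e::euclidean_space) atlas \<Rightarrow> (('m, 'e) cotangent, 'e \<times> 'e) atlas" where
  "cotangent_atlas A = cotangent_chart A ` A"

text \<open>\<open>dq \<and> dp\<close> in the induced coordinates \<open>(q, p)\<close>.\<close>

definition canonical_form ::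
    "('m, 'e::euclidean_space) atlas \<Rightarrow> (('m, 'e) cotangent, 'e \<times> 'e) tensor2" where
  "canonical_form A z V W = (let c = cotangent_chart A (chart_at A (fst z)) in
     fst (V c) \<bullet> snd (W c) - fst (W c) \<bullet> snd (V c))"

text \<open>The fibre derivative \<open>\<partial>H/\<partial>p\<close>, a tangent vector at the base point.\<close>

definition fiber_deriv ::
    "('m, 'e::euclidean_space) atlas \<Rightarrow> (('m, 'e) cotangent \<Rightarrow> real) \<Rightarrow> ('m, 'e) cotangent \<Rightarrow> ('m, 'e) tvec" where
  "fiber_deriv A H z = (\<lambda>c. if c \<in> A \<and> fst z \<in> fst c
     then (let C = cotangent_chart A c in
        \<Sum>b\<in>Basis. frechet_derivative (H \<circ> cinv C) (at (snd C z)) (0, b) *\<^sub>R b)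
     else 0)"

text \<open>The tangent vector at \<open>t = 0\<close> of \<open>t \<mapsto> z + t \<nu>\<close> in the fibre of \<open>z\<close>.\<close>

definition vertical_lift ::
    "('m, 'e::euclidean_space) atlas \<Rightarrow> ('m, 'e) cotangent \<Rightarrow> ('m, 'e) covec \<Rightarrow>
     (('m, 'e) cotangent, 'e \<times> 'e) tvec" where
  "vertical_lift A z \<nu> = (\<lambda>C. if C \<in> cotangent_atlas A \<and> z \<in> fst C
     then vector_derivative (\<lambda>t. snd C (fst z, \<lambda>v. snd z v + t * \<nu> v)) (at 0) else 0)"

definition natural_hamiltonian ::
    "('m, 'e::euclidean_space) atlas \<Rightarrow> (('m, 'e) cotangent \<Rightarrow> real) \<Rightarrow> bool" where
  "natural_hamiltonian A H \<longleftrightarrow> smooth_fun (cotangent_atlas A) H \<and>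
     (\<exists>g V. riemannian_metric A g \<and> smooth_fun A V \<and>
        (\<forall>x\<in>points A. \<forall>v\<in>tangent_space A x.
           H (x, covector_restrict A x (g x v)) = g x v v / 2 + V x))"


subsection \<open>Constraint distributions\<close>

definition annihilator_basis ::
    "('m, 'e::euclidean_space) atlas \<Rightarrow> nat \<Rightarrow> ('m \<Rightarrow> ('m, 'e) tvec set) \<Rightarrow> 'm \<Rightarrow> (nat \<Rightarrow> ('m, 'e) covec) \<Rightarrow> bool" where
  "annihilator_basis A k D x \<eta> \<longleftrightarrow>
     (\<forall>i<k. \<eta> i \<in> cotangent_space A x) \<and>
     (\<forall>a. (\<forall>v\<in>tangent_space A x. (\<Sum>i<k. a i * \<eta> i v) = 0) \<longrightarrow> (\<forall>i<k. a i = 0)) \<and>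
     D x = {v \<in> tangent_space A x. \<forall>i<k. \<eta> i v = 0}"

definition annihilator_frame ::
    "('m, 'e::euclidean_space) atlas \<Rightarrow> nat \<Rightarrow> ('m \<Rightarrow> ('m, 'e) tvec set) \<Rightarrow> 'm set \<Rightarrow>
     (nat \<Rightarrow> 'm \<Rightarrow> ('m, 'e) covec) \<Rightarrow> bool" where
  "annihilator_frame A k D W \<eta> \<longleftrightarrow> mopen A W \<and> (\<forall>i<k. one_form_on A W (\<eta> i)) \<and>
     (\<forall>x\<in>W. annihilator_basis A k D x (\<lambda>i. \<eta> i x))"

definition distribution ::
    "('m, 'e::euclidean_space) atlas \<Rightarrow> nat \<Rightarrow> ('m \<Rightarrow> ('m, 'e) tvec set) \<Rightarrow> bool" where
  "distribution A k D \<longleftrightarrow> (\<forall>x\<in>points A. \<exists>W \<eta>. x \<in> W \<and> annihilator_frame A k D W \<eta>)"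

text \<open>
  Integrable (holonomic): locally the constraints are \<open>df\<^sub>1 = \<dots> = df\<^sub>k = 0\<close> for independent
  functions, whose joint level sets are then the integral manifolds.
\<close>

definition integrable_distribution ::
    "('m, 'e::euclidean_space) atlas \<Rightarrow> nat \<Rightarrow> ('m \<Rightarrow> ('m, 'e) tvec set) \<Rightarrow> bool" where
  "integrable_distribution A k D \<longleftrightarrow> (\<forall>x\<in>points A. \<exists>W f. x \<in> W \<and>
     (\<forall>i<k. smooth_fun_on A W (f i)) \<and>
     annihilator_frame A k D W (\<lambda>i. differential A (f i)))"

text \<open>The set \<open>(FH)\<inverse>(D)\<close>.\<close>

definition constraint_space ::
    "('m, 'e::euclidean_space) atlas \<Rightarrow> (('m, 'e) cotangent \<Rightarrow> real) \<Rightarrow> ('m \<Rightarrow> ('m, 'e) tvec set) \<Rightarrow>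
     ('m, 'e) cotangent set" where
  "constraint_space A H D = {z \<in> points (cotangent_atlas A). fiber_deriv A H z \<in> D (fst z)}"

definition nonholonomic_system ::
    "('m, 'e::euclidean_space) atlas \<Rightarrow> (('m, 'e) cotangent \<Rightarrow> real) \<Rightarrow> nat \<Rightarrow> ('m \<Rightarrow> ('m, 'e) tvec set) \<Rightarrow> bool" where
  "nonholonomic_system A H k D \<longleftrightarrow> smooth_manifold A \<and> natural_hamiltonian A H \<and>
     k < DIM('e) \<and> distribution A k D \<and> \<not> integrable_distribution A k D"


subsection \<open>Magnetically controlled systems\<close>

text \<open>
  The control parameter \<open>B\<close> ranges over an open subset \<open>U\<close> of a Euclidean space; \<open>\<beta> B\<close> is the
  magnetic 2-form with control parameter \<open>B\<close>.
\<close>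

definition control_forms ::
    "('m, 'e::euclidean_space) atlas \<Rightarrow> 'b::euclidean_space set \<Rightarrow> ('b \<Rightarrow> ('m, 'e) tensor2) \<Rightarrow> bool" where
  "control_forms A U \<beta> \<longleftrightarrow> open U \<and> U \<noteq> {} \<and> (\<forall>B\<in>U. closed_two_form A (\<beta> B)) \<and>
     (\<forall>c\<in>A. \<forall>a b. smooth_on ((snd c ` fst c) \<times> U) (\<lambda>(u, B). components A (\<beta> B) c a b u))"

definition controlled_vector_fields ::
    "('s, 'd::euclidean_space) atlas \<Rightarrow> 'b::euclidean_space set \<Rightarrow> ('b \<Rightarrow> 's \<Rightarrow> ('s, 'd) tvec) \<Rightarrow> bool" where
  "controlled_vector_fields S U X \<longleftrightarrow> (\<forall>B\<in>U. vector_field S (X B)) \<and>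
     (\<forall>c\<in>S. smooth_on ((snd c ` fst c) \<times> U) (\<lambda>(u, B). X B (cinv c u) c))"

text \<open>
  \<open>S\<close> is the state manifold, embedded in the cotangent bundle, and \<open>X B\<close> is a vector field on \<open>S\<close>
  (this is the tangency that fixes the multipliers), pushed forward along the inclusion by \<open>incl\<close>.
\<close>

abbreviation incl ::
    "('m, 'e::euclidean_space) atlas \<Rightarrow> (('m, 'e) cotangent, 'd::euclidean_space) atlas \<Rightarrow>
     ('m, 'e) cotangent \<Rightarrow> (('m, 'e) cotangent, 'd) tvec \<Rightarrow> (('m, 'e) cotangent, 'e \<times> 'e) tvec" where
  "incl A S \<equiv> tangent_map S (cotangent_atlas A) (\<lambda>z. z)"

abbreviation proj ::
    "('m, 'e::euclidean_space) atlas \<Rightarrow> ('m, 'e) cotangent \<Rightarrow>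
     (('m, 'e) cotangent, 'e \<times> 'e) tvec \<Rightarrow> ('m, 'e) tvec" where
  "proj A \<equiv> tangent_map (cotangent_atlas A) A fst"

definition magnetic_nonholonomic_general ::
    "('m, 'e::euclidean_space) atlas \<Rightarrow> (('m, 'e) cotangent \<Rightarrow> real) \<Rightarrow> nat \<Rightarrow> ('m \<Rightarrow> ('m, 'e) tvec set) \<Rightarrow>
     'b::euclidean_space set \<Rightarrow> ('b \<Rightarrow> ('m, 'e) tensor2) \<Rightarrow>
     (('m, 'e) cotangent, 'd::euclidean_space) atlas \<Rightarrow>
     ('b \<Rightarrow> ('m, 'e) cotangent \<Rightarrow> (('m, 'e) cotangent, 'd) tvec) \<Rightarrow> bool" where
  "magnetic_nonholonomic_general A H k D U \<beta> S X \<longleftrightarrow>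
     nonholonomic_system A H k D \<and> control_forms A U \<beta> \<and>
     embedded_submanifold (cotangent_atlas A) S \<and> points S = constraint_space A H D \<and>
     controlled_vector_fields S U X \<and>
     (\<forall>B\<in>U. \<forall>z\<in>points S. \<forall>W \<eta>. annihilator_frame A k D W \<eta> \<and> fst z \<in> W \<longrightarrow>
        (\<exists>m :: nat \<Rightarrow> real. \<forall>w\<in>tangent_space (cotangent_atlas A) z.
           canonical_form A z (incl A S z (X B z)) w +
             \<beta> B (fst z) (proj A z (incl A S z (X B z))) (proj A z w) =
           differential (cotangent_atlas A) H z w + (\<Sum>i<k. m i * \<eta> i (fst z) (proj A z w))))"


subsection \<open>Left-invariant systems on Lie groups\<close>

definition lie_group :: "'m monoid \<Rightarrow> ('m, 'e::euclidean_space) atlas \<Rightarrow> bool" where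
  "lie_group G A \<longleftrightarrow> group G \<and> smooth_manifold A \<and> points A = carrier G \<and>
     smooth_map (prod_atlas A A) A (\<lambda>(x, y). x \<otimes>\<^bsub>G\<^esub> y) \<and> smooth_map A A (m_inv G)"

abbreviation left_translate ::
    "'m monoid \<Rightarrow> ('m, 'e::euclidean_space) atlas \<Rightarrow> 'm \<Rightarrow> 'm \<Rightarrow> ('m, 'e) tvec \<Rightarrow> ('m, 'e) tvec" where
  "left_translate G A g \<equiv> tangent_map A A (\<lambda>x. g \<otimes>\<^bsub>G\<^esub> x)"

definition left_invariant_hamiltonian ::
    "'m monoid \<Rightarrow> ('m, 'e::euclidean_space) atlas \<Rightarrow> (('m, 'e) cotangent \<Rightarrow> real) \<Rightarrow> bool" where
  "left_invariant_hamiltonian G A H \<longleftrightarrow>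
     (\<forall>g\<in>carrier G. \<forall>x\<in>carrier G. \<forall>\<alpha>\<in>cotangent_space A (g \<otimes>\<^bsub>G\<^esub> x).
        H (x, covector_restrict A x (\<lambda>v. \<alpha> (left_translate G A g x v))) = H (g \<otimes>\<^bsub>G\<^esub> x, \<alpha>))"

definition left_invariant_distribution ::
    "'m monoid \<Rightarrow> ('m, 'e::euclidean_space) atlas \<Rightarrow> ('m \<Rightarrow> ('m, 'e) tvec set) \<Rightarrow> bool" where
  "left_invariant_distribution G A D \<longleftrightarrow>
     (\<forall>g\<in>carrier G. \<forall>x\<in>carrier G. left_translate G A g x ` D x = D (g \<otimes>\<^bsub>G\<^esub> x))"

definition left_invariant_form ::
    "'m monoid \<Rightarrow> ('m, 'e::euclidean_space) atlas \<Rightarrow> ('m, 'e) tensor2 \<Rightarrow> bool" where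
  "left_invariant_form G A \<beta> \<longleftrightarrow>
     (\<forall>g\<in>carrier G. \<forall>x\<in>carrier G. \<forall>v\<in>tangent_space A x. \<forall>w\<in>tangent_space A x.
        \<beta> (g \<otimes>\<^bsub>G\<^esub> x) (left_translate G A g x v) (left_translate G A g x w) = \<beta> x v w)"

definition vector_field_bracket ::
    "('m, 'e::euclidean_space) atlas \<Rightarrow> ('m \<Rightarrow> ('m, 'e) tvec) \<Rightarrow> ('m \<Rightarrow> ('m, 'e) tvec) \<Rightarrow>
     'm \<Rightarrow> ('m, 'e) tvec" where
  "vector_field_bracket A X Y x = (\<lambda>c. if c \<in> A \<and> x \<in> fst c
     then frechet_derivative (\<lambda>u. Y (cinv c u) c) (at (snd c x)) (X x c) -
          frechet_derivative (\<lambda>u. X (cinv c u) c) (at (snd c x)) (Y x c)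
     else 0)"

text \<open>The bracket on the Lie algebra, the tangent space at the identity.\<close>

definition lie_bracket ::
    "'m monoid \<Rightarrow> ('m, 'e::euclidean_space) atlas \<Rightarrow> ('m, 'e) tvec \<Rightarrow> ('m, 'e) tvec \<Rightarrow> ('m, 'e) tvec" where
  "lie_bracket G A \<xi> \<zeta> = vector_field_bracket A
     (\<lambda>g. left_translate G A g \<one>\<^bsub>G\<^esub> \<xi>) (\<lambda>g. left_translate G A g \<one>\<^bsub>G\<^esub> \<zeta>) \<one>\<^bsub>G\<^esub>"

definition ad_star ::
    "'m monoid \<Rightarrow> ('m, 'e::euclidean_space) atlas \<Rightarrow> ('m, 'e) tvec \<Rightarrow> ('m, 'e) covec \<Rightarrow> ('m, 'e) covec" where
  "ad_star G A \<xi> \<mu> = covector_restrict A \<one>\<^bsub>G\<^esub> (\<lambda>\<zeta>. \<mu> (lie_bracket G A \<xi> \<zeta>))"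

text \<open>
  The dual of the Lie algebra is the fibre of the cotangent bundle over the identity, so a point
  \<open>\<mu>\<close> of it appears as the pair \<open>(\<one>, \<mu>)\<close>. Since \<open>h = H(\<one>, \<cdot>)\<close>, the element \<open>dh(\<mu>)\<close> of the Lie algebra
  is the fibre derivative of \<open>H\<close> at \<open>(\<one>, \<mu>)\<close>, and a velocity \<open>d\<mu>/dt\<close> is a vertical vector there.
\<close>

definition magnetic_nonholonomic_reduced ::
    "'m monoid \<Rightarrow> ('m, 'e::euclidean_space) atlas \<Rightarrow> (('m, 'e) cotangent \<Rightarrow> real) \<Rightarrow> nat \<Rightarrow>
     ('m \<Rightarrow> ('m, 'e) tvec set) \<Rightarrow> 'b::euclidean_space set \<Rightarrow> ('b \<Rightarrow> ('m, 'e) tensor2) \<Rightarrow>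
     (('m, 'e) cotangent, 'd::euclidean_space) atlas \<Rightarrow>
     ('b \<Rightarrow> ('m, 'e) cotangent \<Rightarrow> (('m, 'e) cotangent, 'd) tvec) \<Rightarrow> bool" where
  "magnetic_nonholonomic_reduced G A H k D U \<beta> S X \<longleftrightarrow>
     lie_group G A \<and> nonholonomic_system A H k D \<and> control_forms A U \<beta> \<and>
     left_invariant_hamiltonian G A H \<and> left_invariant_distribution G A D \<and>
     (\<forall>B\<in>U. left_invariant_form G A (\<beta> B)) \<and>
     embedded_submanifold (cotangent_atlas A) S \<and>
     points S = {(x, \<mu>). x = \<one>\<^bsub>G\<^esub> \<and> \<mu> \<in> cotangent_space A x \<and> fiber_deriv A H (x, \<mu>) \<in> D x} \<and>
     controlled_vector_fields S U X \<and>
     (\<forall>B\<in>U. \<forall>\<mu>. (\<one>\<^bsub>G\<^esub>, \<mu>) \<in> points S \<longrightarrow>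
        (\<forall>\<eta>. annihilator_basis A k D \<one>\<^bsub>G\<^esub> \<eta> \<longrightarrow>
          (\<exists>m :: nat \<Rightarrow> real. let z = (\<one>\<^bsub>G\<^esub>, \<mu>); dh = fiber_deriv A H z in
             incl A S z (X B z) = vertical_lift A z (\<lambda>v. ad_star G A dh \<mu> v +
               covector_restrict A \<one>\<^bsub>G\<^esub> (\<beta> B \<one>\<^bsub>G\<^esub> dh) v + (\<Sum>i<k. m i * \<eta> i v)))))"


subsection \<open>Optimal control\<close>

text \<open>Points of the cotangent bundle of the state manifold are pairs \<open>(x, y)\<close>.\<close>

definition extended_hamiltonian ::
    "('s \<Rightarrow> 'b \<Rightarrow> real) \<Rightarrow> ('b \<Rightarrow> 's \<Rightarrow> ('s, 'd) tvec) \<Rightarrow> 'b \<Rightarrow> ('s, 'd) cotangent \<Rightarrow> real" where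
  "extended_hamiltonian \<l> X B = (\<lambda>(x, y). \<l> x B + y (X B x))"

definition optimal_hamiltonian ::
    "'b set \<Rightarrow> ('s \<Rightarrow> 'b \<Rightarrow> real) \<Rightarrow> ('b \<Rightarrow> 's \<Rightarrow> ('s, 'd) tvec) \<Rightarrow> ('s, 'd) cotangent \<Rightarrow> real" where
  "optimal_hamiltonian U \<l> X z = (LEAST r. r \<in> (\<lambda>B. extended_hamiltonian \<l> X B z) ` U)"

definition smooth_cost ::
    "('s, 'd::euclidean_space) atlas \<Rightarrow> 'b::euclidean_space set \<Rightarrow> ('s \<Rightarrow> 'b \<Rightarrow> real) \<Rightarrow> bool" where
  "smooth_cost S U \<l> \<longleftrightarrow>
     (\<forall>c\<in>S. smooth_on ((snd c ` fst c) \<times> U) (\<lambda>(u, B). \<l> (cinv c u) B))"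

definition critical_control ::
    "'b::euclidean_space set \<Rightarrow> ('s \<Rightarrow> 'b \<Rightarrow> real) \<Rightarrow> ('b \<Rightarrow> 's \<Rightarrow> ('s, 'd) tvec) \<Rightarrow>
     ('s, 'd) cotangent \<Rightarrow> 'b \<Rightarrow> bool" where
  "critical_control U \<l> X z B \<longleftrightarrow> B \<in> U \<and>
     ((\<lambda>B. extended_hamiltonian \<l> X B z) has_derivative (\<lambda>_. 0)) (at B)"

definition optimal_control ::
    "('s, 'd::euclidean_space) atlas \<Rightarrow> 'b::euclidean_space set \<Rightarrow> ('s \<Rightarrow> 'b \<Rightarrow> real) \<Rightarrow>
     ('b \<Rightarrow> 's \<Rightarrow> ('s, 'd) tvec) \<Rightarrow> (('s, 'd) cotangent \<Rightarrow> 'b) \<Rightarrow> bool" where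
  "optimal_control S U \<l> X Bopt \<longleftrightarrow>
     (\<forall>z\<in>points (cotangent_atlas S).
        critical_control U \<l> X z (Bopt z) \<and>
        (\<forall>B. critical_control U \<l> X z B \<longrightarrow> B = Bopt z) \<and>
        (\<forall>B\<in>U. extended_hamiltonian \<l> X (Bopt z) z \<le> extended_hamiltonian \<l> X B z)) \<and>
     smooth_fun (cotangent_atlas S) Bopt"

definition hamiltonian_vector_field ::
    "('s, 'd::euclidean_space) atlas \<Rightarrow> (('s, 'd) cotangent \<Rightarrow> real) \<Rightarrow>
     (('s, 'd) cotangent \<Rightarrow> (('s, 'd) cotangent, 'd \<times> 'd) tvec) \<Rightarrow> bool" where
  "hamiltonian_vector_field S F Y \<longleftrightarrow> vector_field (cotangent_atlas S) Y \<and>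
     (\<forall>z\<in>points (cotangent_atlas S). \<forall>w\<in>tangent_space (cotangent_atlas S) z.
        canonical_form S z (Y z) w = differential (cotangent_atlas S) F z w)"


subsection \<open>Constants of motion\<close>

definition lie_derivative ::
    "('m, 'e::euclidean_space) atlas \<Rightarrow> ('m \<Rightarrow> ('m, 'e) tvec) \<Rightarrow> ('m \<Rightarrow> real) \<Rightarrow> 'm \<Rightarrow> real" where
  "lie_derivative A Y E x = differential A E x (Y x)"

definition constant_of_motion ::
    "('m, 'e::euclidean_space) atlas \<Rightarrow> ('m \<Rightarrow> ('m, 'e) tvec) \<Rightarrow> ('m \<Rightarrow> real) \<Rightarrow> bool" where
  "constant_of_motion A Y E \<longleftrightarrow> smooth_fun A E \<and> (\<forall>x\<in>points A. lie_derivative A Y E x = 0)"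

definition functionally_independent_at ::
    "('m, 'e::euclidean_space) atlas \<Rightarrow> ('m \<Rightarrow> real) \<Rightarrow> ('m \<Rightarrow> real) \<Rightarrow> 'm \<Rightarrow> bool" where
  "functionally_independent_at A E\<^sub>1 E\<^sub>2 x \<longleftrightarrow>
     (\<forall>a b. (\<forall>w\<in>tangent_space A x. a * differential A E\<^sub>1 x w + b * differential A E\<^sub>2 x w = 0) \<longrightarrow>
        a = 0 \<and> b = 0)"

text \<open>No nontrivial linear combination is constant; in particular both functions are nonconstant.\<close>

definition independent_modulo_constants ::
    "('m, 'e) atlas \<Rightarrow> ('m \<Rightarrow> real) \<Rightarrow> ('m \<Rightarrow> real) \<Rightarrow> bool" where
  "independent_modulo_constants A E\<^sub>1 E\<^sub>2 \<longleftrightarrow>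
     (\<forall>a b. (\<exists>r. \<forall>x\<in>points A. a * E\<^sub>1 x + b * E\<^sub>2 x = r) \<longrightarrow> a = 0 \<and> b = 0)"

end

theory Submission
  imports Defs
begin

text \<open>
  The two constants of motion are the optimal control Hamiltonian and the mechanical energy \<open>H\<close>,
  pulled back to the cotangent bundle of the state space. The former is conserved by its own flow.
  For the latter, note that the optimal control Hamiltonian is a minimum over \<open>B\<close> of functions
  that are affine in the covector \<open>y\<close> with slope \<open>X B x\<close>. By the envelope theorem its fibre
  derivative is the slope at the minimizer (\<open>envelope\<close>), so the flow projects to the controlled
  motion of the state under the optimal control (\<open>flow_projection\<close>). Along every controlled
  motion the energy is conserved, whatever the control is: the magnetic force \<open>\<beta>(v, \<cdot>)\<close> and the
  reaction forces annihilate the velocity \<open>v\<close>, the former because \<open>\<beta>\<close> alternates and the latter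
  because \<open>v\<close> satisfies the constraints.

  The energy depends on the state only, whereas the optimal control Hamiltonian has a nonzero
  fibre derivative wherever the optimally controlled velocity \<open>X\<close> of the state is nonzero. There the two
  are independent as soon as \<open>H\<close> is not critical on the state space. At a critical state,
  differentiating \<open>H\<close> along the ray through the momentum, which stays in the state space, gives
  \<open>g(v, v) = 0\<close>, so the state is at rest (\<open>critical_state_at_rest\<close>). What then remains of \<open>X\<close> is a
  reaction force, which annihilates \<open>D\<close>; but tangency to the state space says that it corresponds
  under the metric to a vector of \<open>D\<close>, so it vanishes (\<open>vertical_reaction_vanishes\<close>).

  It may happen, for reduced systems, that the optimal control stops the state everywhere. Then the
  optimal control Hamiltonian is constant along the fibres, its flow is vertical, and every function of
  the state is conserved. In this case \<open>H\<close> and \<open>H\<^sup>2\<close> are taken; they are independent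
  modulo constants since \<open>H\<close> has at least three values on a ray of momenta (\<open>three_energies\<close>).

  Two points need more than computation in charts. The state space is an abstract embedded
  submanifold, so the tangent vectors used above are produced from curves: a differentiable curve
  that runs in the submanifold has its velocity in the image of the tangent space
  (\<open>curve_velocity\<close>). For reduced systems, \<open>\<mu>([v, v]) = 0\<close> can be read off in coordinates only if the
  bracket takes values in tangent vectors and is linear (\<open>bracket_in\<close>), which is where the symmetry
  of second derivatives enters.
\<close>

section \<open>Calculus of smooth maps\<close>


lemma frechet_derivative_worksI:
  "f differentiable (at x) \<Longrightarrow> (f has_derivative frechet_derivative f (at x)) (at x)"
  by (simp add: frechet_derivative_works)

lemma frechet_derivative_basis_expand:
  fixes f :: "'a::euclidean_space \<Rightarrow> 'b::real_normed_vector"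
  assumes "f differentiable (at x)"
  shows "frechet_derivative f (at x) v =
    (\<Sum>b\<in>Basis. (v \<bullet> b) *\<^sub>R frechet_derivative f (at x) b)"
proof -
  interpret linear "frechet_derivative f (at x)"
    using assms by (rule linear_frechet_derivative)
  have "frechet_derivative f (at x) (\<Sum>b\<in>Basis. (v \<bullet> b) *\<^sub>R b) =
      (\<Sum>b\<in>Basis. (v \<bullet> b) *\<^sub>R frechet_derivative f (at x) b)"
    by (simp add: sum scaleR)
  then show ?thesis
    by (simp add: euclidean_representation)
qed

lemma frechet_derivative_chain:
  assumes "f differentiable (at x)" "g differentiable (at (f x))"
  shows "frechet_derivative (g \<circ> f) (at x) v =
    frechet_derivative g (at (f x)) (frechet_derivative f (at x) v)"
  by (simp add: frechet_derivative_compose[OF assms])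

lemma C_on_cong:
  assumes "open S" "\<And>x. x \<in> S \<Longrightarrow> f x = g x" "C_on k S f"
  shows "C_on k S g"
  using assms(2,3)
proof (induction k arbitrary: f g)
  case 0
  then show ?case
    by (simp cong: continuous_on_cong)
next
  case (Suc k)
  have d: "f differentiable (at x)" if "x \<in> S" for x
    using Suc.prems(2) that by simp
  have dg: "g differentiable (at x)" if "x \<in> S" for x
  proof -
    have "(f has_derivative frechet_derivative f (at x)) (at x)"
      using d[OF that] by (simp add: frechet_derivative_worksI)
    then have "(g has_derivative frechet_derivative f (at x)) (at x)"
      using assms(1) that Suc.prems(1) by (rule has_derivative_transform_within_open)
    then show ?thesis
      by (rule differentiableI)
  qed
  have "frechet_derivative f (at x) = frechet_derivative g (at x)" if "x \<in> S" for x
    using d[OF that] assms(1) that Suc.prems(1) by (rule frechet_derivative_transform_within_open)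
  then have "C_on k S (\<lambda>x. frechet_derivative g (at x) v)" for v
    using Suc.IH[of "\<lambda>x. frechet_derivative f (at x) v" "\<lambda>x. frechet_derivative g (at x) v"]
      Suc.prems(2) by simp
  then show ?case
    using dg by simp
qed

lemma C_on_SucD: "C_on (Suc k) S f \<Longrightarrow> C_on k S f"
proof (induction k arbitrary: f)
  case 0
  then show ?case
    by (auto intro!: continuous_at_imp_continuous_on differentiable_imp_continuous_within)
qed auto

lemma C_on_subset: "C_on k T f \<Longrightarrow> S \<subseteq> T \<Longrightarrow> C_on k S f"
  by (induction k arbitrary: f) (auto intro: continuous_on_subset)

text \<open>
  Regularity on a manifold is checked in whichever chart is convenient near a given point, which this
  lemma permits.
\<close>

lemma C_on_local:
  assumes "\<And>x. x \<in> S \<Longrightarrow> \<exists>T. open T \<and> x \<in> T \<and> C_on k T f"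
  shows "C_on k S f"
  using assms
proof (induction k arbitrary: f)
  case 0
  have "isCont f x" if "x \<in> S" for x
    using 0[OF that] continuous_on_eq_continuous_at by auto
  then show ?case
    by (simp add: continuous_at_imp_continuous_on)
next
  case (Suc k)
  have "C_on k S (\<lambda>x. frechet_derivative f (at x) v)" for v
    using Suc.prems by (intro Suc.IH) force
  moreover have "f differentiable (at x)" if "x \<in> S" for x
    using Suc.prems[OF that] by auto
  ultimately show ?case
    by simp
qed

lemma C_on_const: "C_on k S (\<lambda>x. c)"
  by (induction k arbitrary: c) (auto simp: frechet_derivative_const)

lemma C_on_bounded_linear:
  assumes "bounded_linear L"
  shows "C_on k S L"
proof (cases k)
  case 0
  then show ?thesis
    using assms by (simp add: linear_continuous_on)
next
  case (Suc j)
  have "(L has_derivative L) (at x)" for x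
    using assms by (rule bounded_linear_imp_has_derivative)
  then have "L differentiable (at x)" "frechet_derivative L (at x) = L" for x
    by (auto intro: differentiableI frechet_derivative_at[symmetric])
  then show ?thesis
    using Suc by (simp add: C_on_const)
qed

lemma C_on_add:
  assumes "open S" "C_on k S f" "C_on k S g"
  shows "C_on k S (\<lambda>x. f x + g x)"
  using assms(2,3)
proof (induction k arbitrary: f g)
  case 0
  then show ?case
    by (auto intro: continuous_intros)
next
  case (Suc k)
  have "C_on k S (\<lambda>x. frechet_derivative (\<lambda>x. f x + g x) (at x) v)" for v
  proof (rule C_on_cong[OF assms(1)])
    show "C_on k S (\<lambda>x. frechet_derivative f (at x) v + frechet_derivative g (at x) v)"
      using Suc by simp
    show "frechet_derivative f (at x) v + frechet_derivative g (at x) v =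
        frechet_derivative (\<lambda>x. f x + g x) (at x) v" if "x \<in> S" for x
    proof -
      have "((\<lambda>x. f x + g x) has_derivative
          (\<lambda>v. frechet_derivative f (at x) v + frechet_derivative g (at x) v)) (at x)"
        using Suc.prems that by (intro has_derivative_add frechet_derivative_worksI) auto
      then show ?thesis
        by (metis frechet_derivative_at)
    qed
  qed
  then show ?case
    using Suc.prems by (auto intro: differentiable_add)
qed

lemma C_on_sum:
  assumes "open S" "\<And>i. i \<in> I \<Longrightarrow> C_on k S (f i)"
  shows "C_on k S (\<lambda>x. \<Sum>i\<in>I. f i x)"
  using assms(2)
  by (induction I rule: infinite_finite_induct) (auto intro: C_on_const C_on_add[OF assms(1)])

lemma C_on_bilinear:
  assumes "bounded_bilinear prd" "open S" "C_on k S f" "C_on k S g"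
  shows "C_on k S (\<lambda>x. prd (f x) (g x))"
  using assms(3,4)
proof (induction k arbitrary: f g)
  case 0
  then show ?case
    using bounded_bilinear.continuous_on[OF assms(1)] by auto
next
  case (Suc k)
  have deriv: "((\<lambda>x. prd (f x) (g x)) has_derivative
      (\<lambda>v. prd (f x) (frechet_derivative g (at x) v) + prd (frechet_derivative f (at x) v) (g x))) (at x)"
    if "x \<in> S" for x
    using Suc.prems that
    by (intro bounded_bilinear.FDERIV[OF assms(1)] frechet_derivative_worksI) auto
  have "C_on k S (\<lambda>x. frechet_derivative (\<lambda>x. prd (f x) (g x)) (at x) v)" for v
  proof (rule C_on_cong[OF assms(2)])
    have "C_on k S f" "C_on k S g"
      using Suc.prems by (blast intro: C_on_SucD)+
    then show "C_on k S (\<lambda>x. prd (f x) (frechet_derivative g (at x) v)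
        + prd (frechet_derivative f (at x) v) (g x))"
      using Suc.prems by (intro C_on_add[OF assms(2)] Suc.IH) simp_all
    show "prd (f x) (frechet_derivative g (at x) v) + prd (frechet_derivative f (at x) v) (g x) =
        frechet_derivative (\<lambda>x. prd (f x) (g x)) (at x) v" if "x \<in> S" for x
      using frechet_derivative_at[OF deriv[OF that]] by metis
  qed
  then show ?case
    using deriv by (auto intro: differentiableI)
qed

lemma C_on_linear_comp:
  assumes L: "bounded_linear L" and "open S" "C_on k S f"
  shows "C_on k S (\<lambda>x. L (f x))"
  using assms(3)
proof (induction k arbitrary: f)
  case 0
  then show ?case
    using bounded_linear.continuous_on[OF L] by auto
next
  case (Suc k)
  have deriv: "((\<lambda>x. L (f x)) has_derivative (\<lambda>v. L (frechet_derivative f (at x) v))) (at x)"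
    if "x \<in> S" for x
    using Suc.prems that
    by (intro bounded_linear.has_derivative[OF L] frechet_derivative_worksI) auto
  have "C_on k S (\<lambda>x. frechet_derivative (\<lambda>x. L (f x)) (at x) v)" for v
  proof (rule C_on_cong[OF assms(2)])
    show "C_on k S (\<lambda>x. L (frechet_derivative f (at x) v))"
      using Suc by simp
    show "L (frechet_derivative f (at x) v) = frechet_derivative (\<lambda>x. L (f x)) (at x) v"
      if "x \<in> S" for x
      using frechet_derivative_at[OF deriv[OF that]] by metis
  qed
  then show ?case
    using deriv by (auto intro: differentiableI)
qed

text \<open>
  The derivative of the composition in direction \<open>v\<close> is expanded in the basis,
  \<open>\<Sum>b. (Df(x) v \<bullet> b) Dg(f x) b\<close>, because the induction hypothesis speaks about derivatives of \<open>g\<close> in a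
  fixed direction only.
\<close>

lemma C_on_compose:
  fixes f :: "'a::euclidean_space \<Rightarrow> 'b::euclidean_space"
    and g :: "'b \<Rightarrow> 'c::real_normed_vector"
  assumes "open S" "C_on k S f" "C_on k T g" "f ` S \<subseteq> T"
  shows "C_on k S (\<lambda>x. g (f x))"
  using assms(2,3)
proof (induction k arbitrary: g)
  case 0
  then show ?case
    using assms(4) by (auto intro: continuous_on_compose2)
next
  case (Suc k)
  have fk: "C_on k S f"
    using Suc.prems(1) by (rule C_on_SucD)
  have df: "f differentiable (at x)" and dg: "g differentiable (at (f x))" if "x \<in> S" for x
    using Suc.prems that assms(4) by auto
  have "C_on k S (\<lambda>x. frechet_derivative (\<lambda>x. g (f x)) (at x) v)" for v
  proof (rule C_on_cong[OF assms(1)])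
    have "C_on k S (\<lambda>x. frechet_derivative g (at (f x)) b)" for b
      using Suc.IH[OF fk, of "\<lambda>y. frechet_derivative g (at y) b"] Suc.prems(2) by simp
    moreover have "C_on k S (\<lambda>x. frechet_derivative f (at x) v \<bullet> b)" for b
      using Suc.prems(1) by (intro C_on_linear_comp[OF bounded_linear_inner_left assms(1)]) simp
    ultimately show "C_on k S (\<lambda>x. \<Sum>b\<in>Basis.
        (frechet_derivative f (at x) v \<bullet> b) *\<^sub>R frechet_derivative g (at (f x)) b)"
      by (intro C_on_sum assms C_on_bilinear[OF bounded_bilinear_scaleR])
    show "(\<Sum>b\<in>Basis. (frechet_derivative f (at x) v \<bullet> b) *\<^sub>R frechet_derivative g (at (f x)) b) =
        frechet_derivative (\<lambda>x. g (f x)) (at x) v" if "x \<in> S" for x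
      using frechet_derivative_chain[OF df[OF that] dg[OF that], of v]
      unfolding frechet_derivative_basis_expand[OF dg[OF that], symmetric] by (simp add: o_def)
  qed
  moreover have "(\<lambda>x. g (f x)) differentiable (at x)" if "x \<in> S" for x
    using differentiable_chain_at[OF df[OF that] dg[OF that]] by (simp add: o_def)
  ultimately show ?case
    by simp
qed

lemma smooth_on_cong:
  "open S \<Longrightarrow> (\<And>x. x \<in> S \<Longrightarrow> f x = g x) \<Longrightarrow> smooth_on S f \<Longrightarrow> smooth_on S g"
  unfolding smooth_on_def by (metis C_on_cong)

lemma smooth_on_subset: "smooth_on T f \<Longrightarrow> S \<subseteq> T \<Longrightarrow> smooth_on S f"
  unfolding smooth_on_def by (auto intro: C_on_subset[of _ T f])

lemma smooth_on_local:
  "(\<And>x. x \<in> S \<Longrightarrow> \<exists>T. open T \<and> x \<in> T \<and> smooth_on T f) \<Longrightarrow> smooth_on S f"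
  unfolding smooth_on_def by (intro allI C_on_local) blast

lemma smooth_on_const: "smooth_on S (\<lambda>x. c)"
  by (simp add: smooth_on_def C_on_const)

lemma smooth_on_bounded_linear: "bounded_linear L \<Longrightarrow> smooth_on S L"
  by (simp add: smooth_on_def C_on_bounded_linear)

lemma smooth_on_id: "smooth_on S (\<lambda>x. x)"
  by (rule smooth_on_bounded_linear[OF bounded_linear_ident])

lemma smooth_on_add:
  "open S \<Longrightarrow> smooth_on S f \<Longrightarrow> smooth_on S g \<Longrightarrow> smooth_on S (\<lambda>x. f x + g x)"
  by (simp add: smooth_on_def C_on_add)

lemma smooth_on_sum:
  "open S \<Longrightarrow> (\<And>i. i \<in> I \<Longrightarrow> smooth_on S (f i)) \<Longrightarrow> smooth_on S (\<lambda>x. \<Sum>i\<in>I. f i x)"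
  by (simp add: smooth_on_def C_on_sum)

lemma smooth_on_bilinear:
  "bounded_bilinear prd \<Longrightarrow> open S \<Longrightarrow> smooth_on S f \<Longrightarrow> smooth_on S g \<Longrightarrow>
     smooth_on S (\<lambda>x. prd (f x) (g x))"
  by (simp add: smooth_on_def C_on_bilinear)

lemmas smooth_on_scaleR = smooth_on_bilinear[OF bounded_bilinear_scaleR]
lemmas smooth_on_inner = smooth_on_bilinear[OF bounded_bilinear_inner]
lemmas smooth_on_mult = smooth_on_bilinear[OF bounded_bilinear_mult]

lemma smooth_on_linear_comp:
  "bounded_linear L \<Longrightarrow> open S \<Longrightarrow> smooth_on S f \<Longrightarrow> smooth_on S (\<lambda>x. L (f x))"
  by (simp add: smooth_on_def C_on_linear_comp)

lemma smooth_on_Pair: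
  assumes "open S" "smooth_on S f" "smooth_on S g"
  shows "smooth_on S (\<lambda>x. (f x, g x))"
proof -
  have "bounded_linear (\<lambda>a. (a, 0))" "bounded_linear (\<lambda>b. (0, b))"
    by (intro bounded_linear_Pair bounded_linear_ident bounded_linear_zero)+
  then have "smooth_on S (\<lambda>x. (f x, 0) + (0, g x))"
    using assms by (intro smooth_on_add smooth_on_linear_comp[where L = "\<lambda>a. (a, 0)"]
        smooth_on_linear_comp[where L = "\<lambda>b. (0, b)"])
  then show ?thesis
    by simp
qed

lemma smooth_on_compose:
  fixes f :: "'a::euclidean_space \<Rightarrow> 'b::euclidean_space"
  assumes "open S" "smooth_on S f" "smooth_on T g" "f ` S \<subseteq> T"
  shows "smooth_on S (\<lambda>x. g (f x))"
  using assms unfolding smooth_on_def by (intro allI C_on_compose[of S _ f T g]) auto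

lemma smooth_on_imp_continuous_on: "smooth_on S f \<Longrightarrow> continuous_on S f"
  unfolding smooth_on_def by (metis C_on.simps(1))

lemma smooth_on_imp_differentiable: "smooth_on S f \<Longrightarrow> x \<in> S \<Longrightarrow> f differentiable (at x)"
  unfolding smooth_on_def by (metis C_on.simps(2))

lemma smooth_on_frechet_derivative:
  "smooth_on S f \<Longrightarrow> smooth_on S (\<lambda>x. frechet_derivative f (at x) v)"
  unfolding smooth_on_def by (metis C_on.simps(2))

lemma smooth_on_frechet_derivative_apply:
  fixes f :: "'b::euclidean_space \<Rightarrow> 'c::real_normed_vector"
    and h :: "'a::euclidean_space \<Rightarrow> 'b"
  assumes "open S" "smooth_on T f" "smooth_on S h" "h ` S \<subseteq> T" "smooth_on S v"
  shows "smooth_on S (\<lambda>x. frechet_derivative f (at (h x)) (v x))"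
proof (rule smooth_on_cong[OF assms(1)])
  show "smooth_on S (\<lambda>x. \<Sum>b\<in>Basis. (v x \<bullet> b) *\<^sub>R frechet_derivative f (at (h x)) b)"
    using smooth_on_compose[OF assms(1,3) smooth_on_frechet_derivative[OF assms(2)] assms(4)]
    by (intro smooth_on_sum smooth_on_scaleR smooth_on_inner smooth_on_const assms)
  show "(\<Sum>b\<in>Basis. (v x \<bullet> b) *\<^sub>R frechet_derivative f (at (h x)) b) =
      frechet_derivative f (at (h x)) (v x)" if "x \<in> S" for x
    using assms(4) that
    by (intro frechet_derivative_basis_expand[symmetric] smooth_on_imp_differentiable[OF assms(2)]) auto
qed

subsection \<open>Second derivatives\<close>

text \<open>
  Both mixed derivatives are limits, as h tends to 0, of the second difference
  \<open>(f (x + h a + h b) - f (x + h a) - f (x + h b) + f x) / h\<^sup>2\<close>: two applications of the mean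
  value theorem, once in either order, express it as a mixed derivative at a nearby point.
\<close>

lemma second_difference_mean_value:
  fixes f :: "'a::euclidean_space \<Rightarrow> real"
  assumes f: "C_on 2 (ball x r) f" and h: "h > 0" "h * (norm a + norm b) < r"
  shows "\<exists>y. dist y x \<le> h * (norm a + norm b) \<and>
    f (x + h *\<^sub>R a + h *\<^sub>R b) - f (x + h *\<^sub>R a) - f (x + h *\<^sub>R b) + f x =
    h * (h * frechet_derivative (\<lambda>u. frechet_derivative f (at u) a) (at y) b)"
proof -
  define Df where "Df = (\<lambda>u. frechet_derivative f (at u) a)"
  have df: "(f has_derivative frechet_derivative f (at u)) (at u)" if "u \<in> ball x r" for u
    using f that by (intro frechet_derivative_worksI) (auto simp: numeral_2_eq_2)
  have dDf: "(Df has_derivative frechet_derivative Df (at u)) (at u)" if "u \<in> ball x r" for u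
    using f that unfolding Df_def by (intro frechet_derivative_worksI) (auto simp: numeral_2_eq_2)
  have near: "dist (x + s *\<^sub>R a + t *\<^sub>R b) x \<le> h * (norm a + norm b)"
    if "0 \<le> s" "s \<le> h" "0 \<le> t" "t \<le> h" for s t
  proof -
    have "norm (s *\<^sub>R a + t *\<^sub>R b) \<le> s * norm a + t * norm b"
      using norm_triangle_ineq[of "s *\<^sub>R a" "t *\<^sub>R b"] that by simp
    also have "\<dots> \<le> h * norm a + h * norm b"
      using that by (intro add_mono mult_right_mono) auto
    finally show ?thesis
      by (simp add: dist_norm algebra_simps)
  qed
  have inb: "x + s *\<^sub>R a + t *\<^sub>R b \<in> ball x r"
    if "0 \<le> s" "s \<le> h" "0 \<le> t" "t \<le> h" for s t
    using near[OF that] h(2) by (simp add: dist_commute)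
  define \<phi> where "\<phi> = (\<lambda>s. f (x + s *\<^sub>R a + h *\<^sub>R b) - f (x + s *\<^sub>R a + 0 *\<^sub>R b))"
  have dline: "((\<lambda>s. f (x + s *\<^sub>R a + t *\<^sub>R b)) has_real_derivative
      Df (x + s *\<^sub>R a + t *\<^sub>R b)) (at s)" if "0 \<le> s" "s \<le> h" "0 \<le> t" "t \<le> h" for s t
  proof -
    have "((\<lambda>s. x + s *\<^sub>R a + t *\<^sub>R b) has_derivative (\<lambda>d. d *\<^sub>R a)) (at s)"
      by (auto intro!: derivative_eq_intros)
    from has_derivative_compose[OF this df[OF inb[OF that]]] show ?thesis
      unfolding has_field_derivative_def Df_def
      by (simp add: linear_cmul[OF linear_frechet_derivative[OF differentiableI[OF df[OF inb[OF that]]]]]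
          mult_commute_abs)
  qed
  have "(\<phi> has_real_derivative Df (x + s *\<^sub>R a + h *\<^sub>R b) - Df (x + s *\<^sub>R a + 0 *\<^sub>R b)) (at s)"
    if "0 \<le> s" "s \<le> h" for s
    unfolding \<phi>_def using that h by (intro DERIV_diff dline) auto
  from MVT2[OF h(1) this] obtain s where s: "0 < s" "s < h"
    and \<phi>: "\<phi> h - \<phi> 0 = (h - 0) * (Df (x + s *\<^sub>R a + h *\<^sub>R b) - Df (x + s *\<^sub>R a + 0 *\<^sub>R b))"
    by blast
  have "((\<lambda>t. Df (x + s *\<^sub>R a + t *\<^sub>R b)) has_real_derivative
      frechet_derivative Df (at (x + s *\<^sub>R a + t *\<^sub>R b)) b) (at t)" if t: "0 \<le> t" "t \<le> h" for t
  proof -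
    have inb': "x + s *\<^sub>R a + t *\<^sub>R b \<in> ball x r"
      using inb[of s t] s t by simp
    have "((\<lambda>t. x + s *\<^sub>R a + t *\<^sub>R b) has_derivative (\<lambda>d. d *\<^sub>R b)) (at t)"
      by (auto intro!: derivative_eq_intros)
    from has_derivative_compose[OF this dDf[OF inb']] show ?thesis
      unfolding has_field_derivative_def
      by (simp add: linear_cmul[OF linear_frechet_derivative[OF differentiableI[OF dDf[OF inb']]]]
          mult_commute_abs)
  qed
  from MVT2[OF h(1) this] obtain t where t: "0 < t" "t < h"
    and D: "Df (x + s *\<^sub>R a + h *\<^sub>R b) - Df (x + s *\<^sub>R a + 0 *\<^sub>R b) =
      (h - 0) * frechet_derivative Df (at (x + s *\<^sub>R a + t *\<^sub>R b)) b"
    by blast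
  show ?thesis
  proof (intro exI conjI)
    show "dist (x + s *\<^sub>R a + t *\<^sub>R b) x \<le> h * (norm a + norm b)"
      using near s t by simp
    show "f (x + h *\<^sub>R a + h *\<^sub>R b) - f (x + h *\<^sub>R a) - f (x + h *\<^sub>R b) + f x =
      h * (h * frechet_derivative (\<lambda>u. frechet_derivative f (at u) a) (at (x + s *\<^sub>R a + t *\<^sub>R b)) b)"
      using \<phi> D by (simp add: \<phi>_def Df_def)
  qed
qed

lemma second_derivative_symmetric_real:
  fixes f :: "'a::euclidean_space \<Rightarrow> real"
  assumes f: "C_on 2 S f" and S: "open S" "x \<in> S"
  shows "frechet_derivative (\<lambda>u. frechet_derivative f (at u) a) (at x) b =
    frechet_derivative (\<lambda>u. frechet_derivative f (at u) b) (at x) a"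
    (is "?A x = ?B x")
proof -
  obtain r where r: "r > 0" "ball x r \<subseteq> S"
    using S by (meson open_contains_ball)
  have fr: "C_on 2 (ball x r) f"
    using f r(2) by (rule C_on_subset)
  have cont: "isCont ?A x" "isCont ?B x"
    using fr r(1) by (auto simp: numeral_2_eq_2 continuous_on_eq_continuous_at)
  have "dist (?A x) (?B x) \<le> e" if "e > 0" for e
  proof -
    obtain d1 where d1: "d1 > 0" "\<And>y. dist y x < d1 \<Longrightarrow> dist (?A y) (?A x) < e/2"
      using cont(1) \<open>e > 0\<close> unfolding continuous_at_eps_delta by (metis half_gt_zero)
    obtain d2 where d2: "d2 > 0" "\<And>y. dist y x < d2 \<Longrightarrow> dist (?B y) (?B x) < e/2"
      using cont(2) \<open>e > 0\<close> unfolding continuous_at_eps_delta by (metis half_gt_zero)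
    \<comment> \<open>Both second differences with step \<open>h\<close> stay within distance \<open>d\<close> of \<open>x\<close>.\<close>
    define d where "d = min r (min d1 d2)"
    define h where "h = d / (2 * (norm a + norm b + 1))"
    have N: "norm a + norm b + 1 > 0"
      by (smt (verit) norm_ge_zero)
    have dpos: "d > 0"
      using r d1 d2 by (simp add: d_def)
    have h: "h > 0"
      using dpos N by (simp add: h_def)
    have "norm a + norm b < 2 * (norm a + norm b + 1)"
      using N by simp
    then have "h * (norm a + norm b) < h * (2 * (norm a + norm b + 1))"
      using h by (rule mult_strict_left_mono)
    also have "\<dots> = d"
      using N unfolding h_def by (simp add: field_simps)
    finally have hd: "h * (norm a + norm b) < d" .
    obtain y where y: "dist y x \<le> h * (norm a + norm b)"
      "f (x + h *\<^sub>R a + h *\<^sub>R b) - f (x + h *\<^sub>R a) - f (x + h *\<^sub>R b) + f x = h * (h * ?A y)"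
      using second_difference_mean_value[OF fr h, of a b] hd by (auto simp: d_def)
    obtain z where z: "dist z x \<le> h * (norm b + norm a)"
      "f (x + h *\<^sub>R b + h *\<^sub>R a) - f (x + h *\<^sub>R b) - f (x + h *\<^sub>R a) + f x = h * (h * ?B z)"
      using second_difference_mean_value[OF fr h, of b a] hd by (auto simp: d_def add.commute)
    have "h * (h * ?A y) = h * (h * ?B z)"
      using y(2) z(2) by (simp add: algebra_simps)
    then have "?A y = ?B z"
      using h by simp
    moreover have "dist (?A y) (?A x) < e/2" "dist (?B z) (?B x) < e/2"
      using y(1) z(1) hd d1(2) d2(2) by (auto simp: d_def add.commute)
    ultimately show ?thesis
      unfolding dist_real_def by linarith
  qed
  then have "dist (?A x) (?B x) \<le> 0"
    by (rule field_le_epsilon) simp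
  then show ?thesis
    by simp
qed

lemma second_derivative_symmetric:
  fixes f :: "'a::euclidean_space \<Rightarrow> 'b::euclidean_space"
  assumes f: "smooth_on S f" and S: "open S" "x \<in> S"
  shows "frechet_derivative (\<lambda>u. frechet_derivative f (at u) a) (at x) b =
    frechet_derivative (\<lambda>u. frechet_derivative f (at u) b) (at x) a"
proof (rule euclidean_eqI)
  fix e :: 'b
  assume "e \<in> Basis"
  have comp: "frechet_derivative (\<lambda>v. g v \<bullet> e) (at u) c = frechet_derivative g (at u) c \<bullet> e"
    if "g differentiable (at u)" for g :: "'a \<Rightarrow> 'b" and u c
  proof -
    have "((\<lambda>v. g v \<bullet> e) has_derivative (\<lambda>c. frechet_derivative g (at u) c \<bullet> e)) (at u)"
      using that by (intro has_derivative_inner_left frechet_derivative_worksI)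
    then show ?thesis
      by (metis frechet_derivative_at)
  qed
  have df: "f differentiable (at u)" "(\<lambda>u. frechet_derivative f (at u) c) differentiable (at u)"
    if "u \<in> S" for u c
    using that f by (auto intro: smooth_on_imp_differentiable smooth_on_frechet_derivative)
  have mixed: "frechet_derivative (\<lambda>u. frechet_derivative (\<lambda>v. f v \<bullet> e) (at u) c) (at x) d =
      frechet_derivative (\<lambda>u. frechet_derivative f (at u) c) (at x) d \<bullet> e" for c d
  proof -
    have "frechet_derivative (\<lambda>u. frechet_derivative f (at u) c \<bullet> e) (at x) =
        frechet_derivative (\<lambda>u. frechet_derivative (\<lambda>v. f v \<bullet> e) (at u) c) (at x)"
    proof (rule frechet_derivative_transform_within_open[OF _ S])
      show "(\<lambda>u. frechet_derivative f (at u) c \<bullet> e) differentiable at x"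
        using df[OF S(2)] by (intro differentiable_inner) auto
    qed (simp add: comp df)
    then show ?thesis
      using comp[OF df(2)[OF S(2)]] by metis
  qed
  have "smooth_on S (\<lambda>v. f v \<bullet> e)"
    using f S by (intro smooth_on_inner smooth_on_const)
  then have "C_on 2 S (\<lambda>v. f v \<bullet> e)"
    by (simp only: smooth_on_def)
  from second_derivative_symmetric_real[OF this S, of a b]
  show "frechet_derivative (\<lambda>u. frechet_derivative f (at u) a) (at x) b \<bullet> e =
    frechet_derivative (\<lambda>u. frechet_derivative f (at u) b) (at x) a \<bullet> e"
    by (simp add: mixed)
qed

text \<open>
  Product rule for \<open>Df(x) (y(x))\<close>, regarded as the sum of the products \<open>(y(x) \<bullet> b) Df(x) b\<close>. It gives the
  derivative of the components of a vector field after a change of chart.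
\<close>

lemma frechet_derivative_leibniz:
  fixes f :: "'a::euclidean_space \<Rightarrow> 'b::euclidean_space" and y :: "'a \<Rightarrow> 'a"
  assumes f: "smooth_on N f" and N: "open N" and u: "u \<in> N" and y: "y differentiable (at u)"
  shows "(\<lambda>x. frechet_derivative f (at x) (y x)) differentiable (at u)" (is ?diff)
    and "frechet_derivative (\<lambda>x. frechet_derivative f (at x) (y x)) (at u) a =
      frechet_derivative (\<lambda>x. frechet_derivative f (at x) (y u)) (at u) a +
      frechet_derivative f (at u) (frechet_derivative y (at u) a)" (is ?eq)
proof -
  let ?f2 = "\<lambda>v. frechet_derivative (\<lambda>x. frechet_derivative f (at x) v) (at u)"
  have df: "f differentiable (at x)" if "x \<in> N" for x
    using f that by (rule smooth_on_imp_differentiable)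
  have d2: "((\<lambda>x. frechet_derivative f (at x) v) has_derivative ?f2 v) (at u)" for v
    by (intro frechet_derivative_worksI smooth_on_imp_differentiable[OF _ u] smooth_on_frechet_derivative f)
  have expand: "((\<lambda>x. \<Sum>b\<in>Basis. (z x \<bullet> b) *\<^sub>R frechet_derivative f (at x) b) has_derivative
      (\<lambda>h. \<Sum>b\<in>Basis. (z u \<bullet> b) *\<^sub>R ?f2 b h + (z' h \<bullet> b) *\<^sub>R frechet_derivative f (at u) b)) (at u)"
    if "(z has_derivative z') (at u)" for z z'
    by (intro has_derivative_sum has_derivative_scaleR has_derivative_inner_left that d2)
  have leibniz: "((\<lambda>x. frechet_derivative f (at x) (z x)) has_derivative
      (\<lambda>h. (\<Sum>b\<in>Basis. (z u \<bullet> b) *\<^sub>R ?f2 b h) + frechet_derivative f (at u) (z' h))) (at u)"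
    if z: "(z has_derivative z') (at u)" for z z'
  proof -
    have split: "(\<lambda>h. \<Sum>b\<in>Basis. (z u \<bullet> b) *\<^sub>R ?f2 b h + (z' h \<bullet> b) *\<^sub>R frechet_derivative f (at u) b) =
        (\<lambda>h. (\<Sum>b\<in>Basis. (z u \<bullet> b) *\<^sub>R ?f2 b h) + frechet_derivative f (at u) (z' h))"
      unfolding sum.distrib frechet_derivative_basis_expand[OF df[OF u], of "z' _", symmetric] ..
    show ?thesis
      using has_derivative_transform_within_open[OF expand[OF z] N u
          frechet_derivative_basis_expand[OF df, symmetric]]
      unfolding split .
  qed
  have const: "?f2 (y u) a = (\<Sum>b\<in>Basis. (y u \<bullet> b) *\<^sub>R ?f2 b a) + frechet_derivative f (at u) 0"
    using fun_cong[OF frechet_derivative_at[OF leibniz[of "\<lambda>_. y u" "\<lambda>_. 0", OF has_derivative_const]], of a]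
    by (rule sym)
  note dy = leibniz[OF frechet_derivative_worksI[OF y]]
  show ?diff
    using dy by (rule differentiableI)
  show ?eq
    unfolding const linear_0[OF linear_frechet_derivative[OF df[OF u]]] add_0_right
    using fun_cong[OF frechet_derivative_at[OF dy], of a] by (rule sym)
qed

section \<open>Calculus in the charts of an atlas\<close>

lemma frechet_derivative_agree:
  assumes "open N" "u \<in> N" "\<And>y. y \<in> N \<Longrightarrow> f y = g y" "g differentiable (at u)"
  shows "f differentiable (at u)" "frechet_derivative f (at u) = frechet_derivative g (at u)"
proof -
  have "(g has_derivative frechet_derivative g (at u)) (at u)"
    using assms(4) by (rule frechet_derivative_worksI)
  then have "(f has_derivative frechet_derivative g (at u)) (at u)"
    using assms(1,2) by (rule has_derivative_transform_within_open) (simp add: assms(3))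
  then show "f differentiable (at u)" "frechet_derivative f (at u) = frechet_derivative g (at u)"
    by (auto intro: differentiableI frechet_derivative_at[symmetric])
qed

lemma chart_cinv: "u \<in> snd c ` fst c \<Longrightarrow> snd c (cinv c u) = u"
  by (simp add: cinv_def f_inv_into_f)

lemma cinv_in: "u \<in> snd c ` fst c \<Longrightarrow> cinv c u \<in> fst c"
  by (simp add: cinv_def inv_into_into)

lemma chart_at_props:
  assumes "x \<in> points A"
  shows "chart_at A x \<in> A" "x \<in> fst (chart_at A x)"
proof -
  have "\<exists>c. c \<in> A \<and> x \<in> fst c"
    using assms by (auto simp: points_def)
  from someI_ex[OF this] show "chart_at A x \<in> A" "x \<in> fst (chart_at A x)"
    by (auto simp: chart_at_def)
qed

lemma in_pointsI: "c \<in> A \<Longrightarrow> x \<in> fst c \<Longrightarrow> x \<in> points A"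
  by (auto simp: points_def)

lemma tangent_zero_chart:
  "v \<in> tangent_space A x \<Longrightarrow> \<not> (c \<in> A \<and> x \<in> fst c) \<Longrightarrow> v c = 0"
  unfolding tangent_space_def mem_Collect_eq by (elim conjE allE[where x = c] impE)

lemma tangent_transform:
  "v \<in> tangent_space A x \<Longrightarrow> c \<in> A \<Longrightarrow> d \<in> A \<Longrightarrow> x \<in> fst c \<Longrightarrow> x \<in> fst d \<Longrightarrow>
     v d = frechet_derivative (snd d \<circ> cinv c) (at (snd c x)) (v c)"
  unfolding tangent_space_def by blast

lemma tangent_spaceI:
  assumes "\<And>c d. c \<in> A \<Longrightarrow> d \<in> A \<Longrightarrow> x \<in> fst c \<Longrightarrow> x \<in> fst d \<Longrightarrow>
      v d = frechet_derivative (snd d \<circ> cinv c) (at (snd c x)) (v c)"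
    and "\<And>c. \<not> (c \<in> A \<and> x \<in> fst c) \<Longrightarrow> v c = 0"
  shows "v \<in> tangent_space A x"
  using assms unfolding tangent_space_def by blast

text \<open>
  The clauses of \<open>smooth_manifold\<close> that concern charts and transition maps. They pass from an atlas to
  its cotangent atlas, so that one set of lemmas serves the configuration space, the state space and
  the cotangent bundles of both.
\<close>

locale smooth_atlas =
  fixes A :: "('m, 'e::euclidean_space) atlas"
  assumes chart_inj: "c \<in> A \<Longrightarrow> inj_on (snd c) (fst c)"
    and chart_open: "c \<in> A \<Longrightarrow> open (snd c ` fst c)"
    and overlap_open: "c \<in> A \<Longrightarrow> d \<in> A \<Longrightarrow> open (snd c ` (fst c \<inter> fst d))"
    and transition_smooth:
      "c \<in> A \<Longrightarrow> d \<in> A \<Longrightarrow> smooth_on (snd c ` (fst c \<inter> fst d)) (snd d \<circ> cinv c)"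

lemma smooth_manifold_atlas: "smooth_manifold A \<Longrightarrow> smooth_atlas A"
  by (unfold_locales) (auto simp: smooth_manifold_def)

context smooth_atlas
begin

lemma cinv_chart: "c \<in> A \<Longrightarrow> x \<in> fst c \<Longrightarrow> cinv c (snd c x) = x"
  by (simp add: cinv_def chart_inj)

lemma image_Int_cinv:
  assumes "c \<in> A" "u \<in> snd c ` (fst c \<inter> W)"
  shows "cinv c u \<in> fst c" "cinv c u \<in> W" "snd c (cinv c u) = u"
  using assms(2) cinv_chart[OF assms(1)] by auto

text \<open>
  The chain rule through a transition map. Differentials and tangent maps are defined by means of an
  arbitrarily chosen chart; this is why any other chart computes them as well.
\<close>

lemma change_chart:
  fixes F :: "'m \<Rightarrow> 'b::real_normed_vector"
  assumes c: "c \<in> A" "x \<in> fst c" and d: "d \<in> A" "x \<in> fst d"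
    and F: "(F \<circ> cinv d) differentiable (at (snd d x))"
  shows "(F \<circ> cinv c) differentiable (at (snd c x))"
    "frechet_derivative (F \<circ> cinv c) (at (snd c x)) v =
     frechet_derivative (F \<circ> cinv d) (at (snd d x))
       (frechet_derivative (snd d \<circ> cinv c) (at (snd c x)) v)"
proof -
  have x: "snd c x \<in> snd c ` (fst c \<inter> fst d)"
    using c d by blast
  have tr: "(snd d \<circ> cinv c) differentiable (at (snd c x))"
    using transition_smooth[OF c(1) d(1)] x by (rule smooth_on_imp_differentiable)
  have pt: "(snd d \<circ> cinv c) (snd c x) = snd d x"
    using cinv_chart c by simp
  have F': "(F \<circ> cinv d) differentiable (at ((snd d \<circ> cinv c) (snd c x)))"
    unfolding pt by (rule F)
  have agree: "(F \<circ> cinv c) u = ((F \<circ> cinv d) \<circ> (snd d \<circ> cinv c)) u"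
    if "u \<in> snd c ` (fst c \<inter> fst d)" for u
    using image_Int_cinv[OF c(1) that] cinv_chart[OF d(1)] by simp
  have D: "(F \<circ> cinv d \<circ> (snd d \<circ> cinv c)) differentiable (at (snd c x))"
    by (rule differentiable_chain_at[OF tr F'])
  note fr = frechet_derivative_agree[OF overlap_open[OF c(1) d(1)] x agree D]
  show "(F \<circ> cinv c) differentiable (at (snd c x))"
    by (rule fr(1))
  show "frechet_derivative (F \<circ> cinv c) (at (snd c x)) v =
     frechet_derivative (F \<circ> cinv d) (at (snd d x))
       (frechet_derivative (snd d \<circ> cinv c) (at (snd c x)) v)"
    using frechet_derivative_chain[OF tr F', of v] by (simp only: fr(2) pt)
qed

lemma transition_differentiable:
  assumes "c \<in> A" "x \<in> fst c" "d \<in> A" "x \<in> fst d"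
  shows "(snd d \<circ> cinv c) differentiable (at (snd c x))"
  by (rule smooth_on_imp_differentiable[OF transition_smooth]) (use assms in auto)

lemmas transition_linear = linear_frechet_derivative[OF transition_differentiable]

lemma transition_self:
  assumes "c \<in> A" "x \<in> fst c"
  shows "frechet_derivative (snd c \<circ> cinv c) (at (snd c x)) v = v"
proof -
  have "frechet_derivative (snd c \<circ> cinv c) (at (snd c x)) = frechet_derivative (\<lambda>y. y) (at (snd c x))"
    by (rule frechet_derivative_agree(2)[OF chart_open[OF assms(1)]])
      (use assms in \<open>auto simp: cinv_chart\<close>)
  then show ?thesis
    by (simp add: frechet_derivative_ident)
qed

lemma coord_vec_apply:
  "d \<in> A \<Longrightarrow> x \<in> fst d \<Longrightarrow>
     coord_vec A c x a d = frechet_derivative (snd d \<circ> cinv c) (at (snd c x)) a"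
  by (simp add: coord_vec_def)

lemma coord_vec_self: "c \<in> A \<Longrightarrow> x \<in> fst c \<Longrightarrow> coord_vec A c x a c = a"
  by (simp add: coord_vec_apply transition_self)

lemma coord_vec_in:
  assumes "c \<in> A" "x \<in> fst c"
  shows "coord_vec A c x a \<in> tangent_space A x"
proof (rule tangent_spaceI)
  fix d d'
  assume d: "d \<in> A" "x \<in> fst d" and d': "d' \<in> A" "x \<in> fst d'"
  show "coord_vec A c x a d' =
      frechet_derivative (snd d' \<circ> cinv d) (at (snd d x)) (coord_vec A c x a d)"
    unfolding coord_vec_apply[OF d] coord_vec_apply[OF d']
    by (rule change_chart(2)[OF assms d transition_differentiable[OF d d']])
qed (simp add: coord_vec_def if_not_P)

lemma tangent_eqI:
  assumes "v \<in> tangent_space A x" "w \<in> tangent_space A x" "c \<in> A" "x \<in> fst c" "v c = w c"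
  shows "v = w"
proof
  fix d
  show "v d = w d"
  proof (cases "d \<in> A \<and> x \<in> fst d")
    case True
    then show ?thesis
      using tangent_transform[OF assms(1,3) _ assms(4)] tangent_transform[OF assms(2,3) _ assms(4)]
        assms(5) by metis
  next
    case False
    then show ?thesis
      using assms(1,2) by (metis tangent_zero_chart)
  qed
qed

lemma tangent_eq_coord_vec:
  assumes "v \<in> tangent_space A x" "c \<in> A" "x \<in> fst c"
  shows "coord_vec A c x (v c) = v"
  using assms by (intro tangent_eqI[OF coord_vec_in]) (auto simp: coord_vec_self)

lemma tangent_lincomb:
  assumes "v \<in> tangent_space A x" "w \<in> tangent_space A x"
  shows "(\<lambda>c. r *\<^sub>R v c + s *\<^sub>R w c) \<in> tangent_space A x"
proof -
  show ?thesis
  proof (rule tangent_spaceI)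
    fix c d
    assume that: "c \<in> A" "d \<in> A" "x \<in> fst c" "x \<in> fst d"
    show "r *\<^sub>R v d + s *\<^sub>R w d =
        frechet_derivative (snd d \<circ> cinv c) (at (snd c x)) (r *\<^sub>R v c + s *\<^sub>R w c)"
      unfolding tangent_transform[OF assms(1) that] tangent_transform[OF assms(2) that]
        linear_add[OF transition_linear[OF that(1,3,2,4)]]
        linear_scale[OF transition_linear[OF that(1,3,2,4)]] ..
  next
    fix c
    assume "\<not> (c \<in> A \<and> x \<in> fst c)"
    then show "r *\<^sub>R v c + s *\<^sub>R w c = 0"
      using assms tangent_zero_chart by (metis add_0 scale_zero_right)
  qed
qed

lemma tangent_zero: "(\<lambda>_. 0) \<in> tangent_space A x"
  by (rule tangent_spaceI) (simp_all add: linear_0[OF transition_linear])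

lemma tangent_scale: "v \<in> tangent_space A x \<Longrightarrow> (\<lambda>c. r *\<^sub>R v c) \<in> tangent_space A x"
  using tangent_lincomb[of v x v r 0] by simp

lemma tangent_zeroI:
  "v \<in> tangent_space A x \<Longrightarrow> c \<in> A \<Longrightarrow> x \<in> fst c \<Longrightarrow> v c = 0 \<Longrightarrow> v = (\<lambda>_. 0)"
  by (rule tangent_eqI[OF _ tangent_zero])

lemma coord_vec_lincomb:
  assumes "c \<in> A" "x \<in> fst c"
  shows "coord_vec A c x (r *\<^sub>R a + s *\<^sub>R b) =
    (\<lambda>d. r *\<^sub>R coord_vec A c x a d + s *\<^sub>R coord_vec A c x b d)"
  using assms by (intro tangent_eqI[OF coord_vec_in tangent_lincomb[OF coord_vec_in coord_vec_in]])
    (auto simp: coord_vec_self)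

lemma coord_vec_0:
  assumes "c \<in> A" "x \<in> fst c"
  shows "coord_vec A c x 0 = (\<lambda>_. 0)"
  using assms by (intro tangent_eqI[OF coord_vec_in tangent_zero]) (auto simp: coord_vec_self)

subsection \<open>Covectors\<close>

lemma cotangent_lincomb:
  "\<alpha> \<in> cotangent_space A x \<Longrightarrow> v \<in> tangent_space A x \<Longrightarrow> w \<in> tangent_space A x \<Longrightarrow>
     \<alpha> (\<lambda>c. r *\<^sub>R v c + s *\<^sub>R w c) = r * \<alpha> v + s * \<alpha> w"
  by (auto simp: cotangent_space_def)

lemma cotangent_zero:
  assumes "\<alpha> \<in> cotangent_space A x"
  shows "\<alpha> (\<lambda>_. 0) = 0"
  using cotangent_lincomb[OF assms tangent_zero tangent_zero, of 0 0] by simp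

lemma cotangent_scale:
  "\<alpha> \<in> cotangent_space A x \<Longrightarrow> v \<in> tangent_space A x \<Longrightarrow> \<alpha> (\<lambda>c. r *\<^sub>R v c) = r * \<alpha> v"
  using cotangent_lincomb[of \<alpha> x v v r 0] by simp

lemma cotangent_add:
  assumes "\<alpha> \<in> cotangent_space A x" "\<beta> \<in> cotangent_space A x"
  shows "(\<lambda>v. \<alpha> v + \<beta> v) \<in> cotangent_space A x"
  using assms by (auto simp: cotangent_space_def algebra_simps)

lemma cotangent_sum:
  assumes "\<And>i. i \<in> I \<Longrightarrow> \<eta> i \<in> cotangent_space A x"
  shows "(\<lambda>v. \<Sum>i\<in>I. m i * \<eta> i v) \<in> cotangent_space A x"
  using assms
proof (induction I rule: infinite_finite_induct)
  case (insert i I)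
  have "(\<lambda>v. m i * \<eta> i v) \<in> cotangent_space A x"
    using insert.prems by (auto simp: cotangent_space_def algebra_simps)
  then show ?case
    using insert cotangent_add by simp
qed (auto simp: cotangent_space_def)

end

text \<open>
  The fibre coordinate of \<open>cotangent_chart\<close>; \<open>covector_of\<close> below is its inverse in a given fibre.
\<close>

definition momentum ::
    "('m, 'e::euclidean_space) atlas \<Rightarrow> ('m, 'e) chart \<Rightarrow> 'm \<Rightarrow> ('m, 'e) covec \<Rightarrow> 'e" where
  "momentum A c x \<alpha> = (\<Sum>b\<in>Basis. \<alpha> (coord_vec A c x b) *\<^sub>R b)"

definition covector_of ::
    "('m, 'e::euclidean_space) atlas \<Rightarrow> ('m, 'e) chart \<Rightarrow> 'm \<Rightarrow> 'e \<Rightarrow> ('m, 'e) covec" where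
  "covector_of A c x p = covector_restrict A x (\<lambda>v. v c \<bullet> p)"

context smooth_atlas
begin

lemma cotangent_linear:
  assumes \<alpha>: "\<alpha> \<in> cotangent_space A x" and c: "c \<in> A" "x \<in> fst c"
  shows "linear (\<lambda>a. \<alpha> (coord_vec A c x a))"
proof (rule linearI)
  fix a b :: 'e and r :: real
  show "\<alpha> (coord_vec A c x (a + b)) = \<alpha> (coord_vec A c x a) + \<alpha> (coord_vec A c x b)"
    using coord_vec_lincomb[OF c, of 1 a 1 b]
      cotangent_lincomb[OF \<alpha> coord_vec_in[OF c] coord_vec_in[OF c], of 1 a 1 b] by simp
  show "\<alpha> (coord_vec A c x (r *\<^sub>R a)) = r *\<^sub>R \<alpha> (coord_vec A c x a)"
    using coord_vec_lincomb[OF c, of r a 0 a]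
      cotangent_lincomb[OF \<alpha> coord_vec_in[OF c] coord_vec_in[OF c], of r a 0 a] by simp
qed

lemma covector_coord_vec:
  assumes \<alpha>: "\<alpha> \<in> cotangent_space A x" and c: "c \<in> A" "x \<in> fst c"
  shows "\<alpha> (coord_vec A c x a) = a \<bullet> momentum A c x \<alpha>"
proof -
  interpret l: linear "\<lambda>a. \<alpha> (coord_vec A c x a)"
    by (rule cotangent_linear[OF assms])
  have "\<alpha> (coord_vec A c x (\<Sum>b\<in>Basis. (a \<bullet> b) *\<^sub>R b)) = (\<Sum>b\<in>Basis. (a \<bullet> b) * \<alpha> (coord_vec A c x b))"
    by (simp add: l.sum l.scale)
  then have "\<alpha> (coord_vec A c x a) = (\<Sum>b\<in>Basis. (a \<bullet> b) * \<alpha> (coord_vec A c x b))"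
    by (simp only: euclidean_representation)
  then show ?thesis
    by (simp add: momentum_def inner_sum_right mult.commute)
qed

lemma covector_apply:
  assumes "\<alpha> \<in> cotangent_space A x" "c \<in> A" "x \<in> fst c" "v \<in> tangent_space A x"
  shows "\<alpha> v = v c \<bullet> momentum A c x \<alpha>"
  using covector_coord_vec[OF assms(1-3), of "v c"] tangent_eq_coord_vec[OF assms(4,2,3)] by simp

lemma covector_eqI:
  assumes "\<alpha> \<in> cotangent_space A x" "\<beta> \<in> cotangent_space A x"
    "\<And>v. v \<in> tangent_space A x \<Longrightarrow> \<alpha> v = \<beta> v"
  shows "\<alpha> = \<beta>"
proof
  show "\<alpha> v = \<beta> v" for v
    using assms by (cases "v \<in> tangent_space A x") (auto simp: cotangent_space_def)
qed

lemma momentum_inj: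
  assumes "\<alpha> \<in> cotangent_space A x" "\<beta> \<in> cotangent_space A x" "c \<in> A" "x \<in> fst c"
    "momentum A c x \<alpha> = momentum A c x \<beta>"
  shows "\<alpha> = \<beta>"
  using assms by (intro covector_eqI[OF assms(1,2)]) (simp add: covector_apply[where c = c])

lemma covector_restrict_in:
  assumes "\<And>v w r s. v \<in> tangent_space A x \<Longrightarrow> w \<in> tangent_space A x \<Longrightarrow>
    f (\<lambda>c. r *\<^sub>R v c + s *\<^sub>R w c) = r * f v + s * f w"
  shows "covector_restrict A x f \<in> cotangent_space A x"
  using assms tangent_lincomb by (auto simp: cotangent_space_def covector_restrict_def)

lemma covector_of_in: "covector_of A c x p \<in> cotangent_space A x"
  unfolding covector_of_def by (rule covector_restrict_in) (simp add: inner_add_left)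

lemma covector_of_apply: "v \<in> tangent_space A x \<Longrightarrow> covector_of A c x p v = v c \<bullet> p"
  by (simp add: covector_of_def covector_restrict_def)

lemma momentum_covector_of:
  assumes "c \<in> A" "x \<in> fst c"
  shows "momentum A c x (covector_of A c x p) = p"
  unfolding momentum_def using assms
  by (simp add: covector_of_apply coord_vec_in coord_vec_self inner_commute[of _ p] euclidean_representation)

lemma covector_of_momentum:
  assumes "\<alpha> \<in> cotangent_space A x" "c \<in> A" "x \<in> fst c"
  shows "covector_of A c x (momentum A c x \<alpha>) = \<alpha>"
  using assms by (intro momentum_inj[OF covector_of_in]) (auto simp: momentum_covector_of)

text \<open>
  Momenta transform by the transposed derivative of the inverse transition map. As this is smooth in
  the base point and linear in the momentum, the cotangent atlas is smooth.
\<close>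

lemma momentum_change:
  assumes c: "c \<in> A" "x \<in> fst c" and d: "d \<in> A" "x \<in> fst d"
  shows "momentum A d x (covector_of A c x p) =
    (\<Sum>b\<in>Basis. (frechet_derivative (snd c \<circ> cinv d) (at (snd d x)) b \<bullet> p) *\<^sub>R b)"
  unfolding momentum_def
  using assms by (simp add: covector_of_apply coord_vec_in coord_vec_apply)

end

section \<open>The cotangent bundle of an atlas\<close>

lemma fst_cotangent_chart [simp]:
  "(x, \<alpha>) \<in> fst (cotangent_chart A c) \<longleftrightarrow> x \<in> fst c \<and> \<alpha> \<in> cotangent_space A x"
  by (simp add: cotangent_chart_def)

lemma snd_cotangent_chart [simp]:
  "snd (cotangent_chart A c) (x, \<alpha>) = (snd c x, momentum A c x \<alpha>)"
  by (simp add: cotangent_chart_def momentum_def)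

lemma points_cotangent_atlas:
  "points (cotangent_atlas A) = {(x, \<alpha>). x \<in> points A \<and> \<alpha> \<in> cotangent_space A x}"
  unfolding points_def cotangent_atlas_def by fastforce

lemma cotangent_chart_in: "c \<in> A \<Longrightarrow> cotangent_chart A c \<in> cotangent_atlas A"
  by (simp add: cotangent_atlas_def)

context smooth_atlas
begin

lemma cotangent_chart_image_Int:
  assumes "c \<in> A"
  shows "snd (cotangent_chart A c) ` (fst (cotangent_chart A c) \<inter> {z. fst z \<in> W}) =
    snd c ` (fst c \<inter> W) \<times> UNIV"
proof (intro equalityI subsetI)
  fix u
  assume "u \<in> snd c ` (fst c \<inter> W) \<times> (UNIV :: 'e set)"
  then obtain x p where x: "x \<in> fst c" "x \<in> W" and u: "u = (snd c x, p)"
    by auto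
  then have "u = snd (cotangent_chart A c) (x, covector_of A c x p)"
    using assms by (simp add: momentum_covector_of)
  then show "u \<in> snd (cotangent_chart A c) ` (fst (cotangent_chart A c) \<inter> {z. fst z \<in> W})"
    using x by (intro image_eqI[where x = "(x, covector_of A c x p)"]) (auto simp: covector_of_in)
qed auto

lemma cotangent_chart_image:
  assumes "c \<in> A"
  shows "snd (cotangent_chart A c) ` fst (cotangent_chart A c) = snd c ` fst c \<times> UNIV"
  using cotangent_chart_image_Int[OF assms, of UNIV] by simp

lemma cotangent_chart_inj:
  assumes "c \<in> A"
  shows "inj_on (snd (cotangent_chart A c)) (fst (cotangent_chart A c))"
proof (rule inj_onI, clarsimp)
  fix x \<alpha> y \<beta>
  assume "x \<in> fst c" "y \<in> fst c" "snd c x = snd c y"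
    and \<alpha>: "\<alpha> \<in> cotangent_space A x" "\<beta> \<in> cotangent_space A y"
      "momentum A c x \<alpha> = momentum A c y \<beta>"
  then have "x = y" "x \<in> fst c"
    using chart_inj[OF assms] by (auto dest: inj_onD)
  then show "x = y \<and> \<alpha> = \<beta>"
    using momentum_inj[OF _ _ assms] \<alpha> by blast
qed

lemma cinv_cotangent_chart:
  assumes "c \<in> A" "u \<in> snd c ` fst c"
  shows "cinv (cotangent_chart A c) (u, p) = (cinv c u, covector_of A c (cinv c u) p)"
proof -
  have "cinv (cotangent_chart A c) (snd (cotangent_chart A c) (cinv c u, covector_of A c (cinv c u) p))
      = (cinv c u, covector_of A c (cinv c u) p)"
    unfolding cinv_def[of "cotangent_chart A c"]
    using cotangent_chart_inj[OF assms(1)] cinv_in[OF assms(2)] covector_of_in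
    by (intro inv_into_f_f) auto
  then show ?thesis
    using assms cinv_in[OF assms(2)] by (simp add: momentum_covector_of chart_cinv)
qed

lemma cotangent_overlap:
  assumes "c \<in> A"
  shows "snd (cotangent_chart A c) ` (fst (cotangent_chart A c) \<inter> fst (cotangent_chart A d)) =
    snd c ` (fst c \<inter> fst d) \<times> UNIV"
proof -
  have "fst (cotangent_chart A c) \<inter> fst (cotangent_chart A d) =
      fst (cotangent_chart A c) \<inter> {z. fst z \<in> fst d}"
    by auto
  then show ?thesis
    using cotangent_chart_image_Int[OF assms] by simp
qed

lemma cotangent_transition_smooth:
  assumes c: "c \<in> A" and d: "d \<in> A"
  shows "smooth_on (snd c ` (fst c \<inter> fst d) \<times> UNIV)
    (snd (cotangent_chart A d) \<circ> cinv (cotangent_chart A c))"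
proof (rule smooth_on_cong)
  let ?N = "snd c ` (fst c \<inter> fst d) \<times> (UNIV :: 'e set)"
  let ?\<phi> = "\<lambda>z :: 'e \<times> 'e. (snd d \<circ> cinv c) (fst z)"
  let ?p = "\<lambda>z :: 'e \<times> 'e. \<Sum>b\<in>Basis. (frechet_derivative (snd c \<circ> cinv d) (at (?\<phi> z)) b \<bullet> snd z) *\<^sub>R b"
  show N: "open ?N"
    using overlap_open[OF c d] by (simp add: open_Times)
  have \<phi>: "smooth_on ?N ?\<phi>"
    by (rule smooth_on_compose[OF N smooth_on_bounded_linear[OF bounded_linear_fst]
          transition_smooth[OF c d]]) auto
  have "?\<phi> ` ?N \<subseteq> snd d ` (fst d \<inter> fst c)"
    using image_Int_cinv[OF c, where W = "fst d"] by fastforce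
  then have D: "smooth_on ?N (\<lambda>z. frechet_derivative (snd c \<circ> cinv d) (at (?\<phi> z)) b)" for b
    by (intro smooth_on_frechet_derivative_apply[OF N transition_smooth[OF d c] \<phi>] smooth_on_const)
  have "smooth_on ?N snd"
    by (rule smooth_on_bounded_linear[OF bounded_linear_snd])
  then show "smooth_on ?N (\<lambda>z. (?\<phi> z, ?p z))"
    by (intro smooth_on_Pair smooth_on_sum smooth_on_scaleR smooth_on_inner smooth_on_const N \<phi> D)
  show "(?\<phi> z, ?p z) = (snd (cotangent_chart A d) \<circ> cinv (cotangent_chart A c)) z" if "z \<in> ?N" for z
  proof -
    obtain u p where z: "z = (u, p)" "u \<in> snd c ` (fst c \<inter> fst d)"
      using \<open>z \<in> ?N\<close> by auto
    note u = image_Int_cinv[OF c z(2)]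
    have "u \<in> snd c ` fst c"
      using z(2) by auto
    then show ?thesis
      using u c d by (simp add: z cinv_cotangent_chart momentum_change)
  qed
qed

lemma cotangent_smooth_atlas: "smooth_atlas (cotangent_atlas A)"
proof
  fix C D
  assume "C \<in> cotangent_atlas A"
  then obtain c where c: "c \<in> A" "C = cotangent_chart A c"
    by (auto simp: cotangent_atlas_def)
  show "inj_on (snd C) (fst C)"
    using cotangent_chart_inj c by simp
  show "open (snd C ` fst C)"
    using cotangent_chart_image chart_open c by (simp add: open_Times)
  assume "D \<in> cotangent_atlas A"
  then obtain d where d: "d \<in> A" "D = cotangent_chart A d"
    by (auto simp: cotangent_atlas_def)
  show "open (snd C ` (fst C \<inter> fst D))"
    using cotangent_overlap overlap_open c d by (simp add: open_Times)
  show "smooth_on (snd C ` (fst C \<inter> fst D)) (snd D \<circ> cinv C)"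
    using cotangent_overlap cotangent_transition_smooth c d by simp
qed

end

section \<open>Smooth functions and maps\<close>

context smooth_atlas
begin

lemma smooth_fun_chart:
  assumes "smooth_fun A f" "c \<in> A"
  shows "smooth_on (snd c ` fst c) (f \<circ> cinv c)"
proof -
  have "fst c \<inter> points A = fst c"
    using assms(2) by (auto simp: points_def)
  then show ?thesis
    using assms unfolding smooth_fun_def smooth_fun_on_def by metis
qed

lemma smooth_funI:
  assumes "\<And>c. c \<in> A \<Longrightarrow> smooth_on (snd c ` fst c) (f \<circ> cinv c)"
  shows "smooth_fun A f"
proof -
  have "fst c \<inter> points A = fst c" if "c \<in> A" for c
    using that by (auto simp: points_def)
  then show ?thesis
    using assms by (simp add: smooth_fun_def smooth_fun_on_def)
qed

lemma smooth_fun_differentiable: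
  assumes "smooth_fun A f" "c \<in> A" "x \<in> fst c"
  shows "(f \<circ> cinv c) differentiable (at (snd c x))"
  using smooth_on_imp_differentiable[OF smooth_fun_chart[OF assms(1,2)]] assms(3) by auto

text \<open>
  The chart that enters the definition of \<open>differential\<close> is replaced by an arbitrary one.
\<close>

lemma differential_chart:
  assumes f: "(f \<circ> cinv c) differentiable (at (snd c x))"
    and c: "c \<in> A" "x \<in> fst c" and v: "v \<in> tangent_space A x"
  shows "differential A f x v = frechet_derivative (f \<circ> cinv c) (at (snd c x)) (v c)"
proof -
  have d: "chart_at A x \<in> A" "x \<in> fst (chart_at A x)"
    using chart_at_props in_pointsI c by metis+
  show ?thesis
    using change_chart(2)[OF d c f, of "v (chart_at A x)"] tangent_transform[OF v d(1) c(1) d(2) c(2)] v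
    by (simp add: differential_def covector_restrict_def Let_def)
qed

end

locale smooth_map_between = M: smooth_atlas M + N: smooth_atlas N
  for M :: "('m, 'e::euclidean_space) atlas" and N :: "('n, 'f::euclidean_space) atlas" +
  fixes F :: "'m \<Rightarrow> 'n"
  assumes smooth_map: "smooth_map M N F"
begin

lemma maps_points: "x \<in> points M \<Longrightarrow> F x \<in> points N"
  using smooth_map by (auto simp: smooth_map_def)

lemma
  assumes "c \<in> M" "d \<in> N"
  shows domain_open: "open (snd c ` (fst c \<inter> F -` fst d))"
    and smooth_in_charts: "smooth_on (snd c ` (fst c \<inter> F -` fst d)) (snd d \<circ> F \<circ> cinv c)"
  using smooth_map assms by (auto simp: smooth_map_def)

lemma differentiable_in_charts:
  assumes "c \<in> M" "x \<in> fst c" "d \<in> N" "F x \<in> fst d"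
  shows "(snd d \<circ> F \<circ> cinv c) differentiable (at (snd c x))"
  by (rule smooth_on_imp_differentiable[OF smooth_in_charts]) (use assms in auto)

lemma in_domain:
  assumes "c \<in> M" "u \<in> snd c ` (fst c \<inter> F -` fst d)"
  shows "cinv c u \<in> fst c" "F (cinv c u) \<in> fst d" "snd c (cinv c u) = u"
  using M.image_Int_cinv[OF assms] by auto

lemma compose_chart:
  fixes f :: "'n \<Rightarrow> 'b::real_normed_vector"
  assumes c: "c \<in> M" "x \<in> fst c" and d: "d \<in> N" "F x \<in> fst d"
    and f: "(f \<circ> cinv d) differentiable (at (snd d (F x)))"
  shows "(f \<circ> F \<circ> cinv c) differentiable (at (snd c x))"
    "frechet_derivative (f \<circ> F \<circ> cinv c) (at (snd c x)) a =
     frechet_derivative (f \<circ> cinv d) (at (snd d (F x)))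
       (frechet_derivative (snd d \<circ> F \<circ> cinv c) (at (snd c x)) a)"
proof -
  let ?N = "snd c ` (fst c \<inter> F -` fst d)"
  have x: "snd c x \<in> ?N"
    using c d by blast
  note tr = differentiable_in_charts[OF c d]
  have pt: "(snd d \<circ> F \<circ> cinv c) (snd c x) = snd d (F x)"
    using M.cinv_chart c by simp
  have f': "(f \<circ> cinv d) differentiable (at ((snd d \<circ> F \<circ> cinv c) (snd c x)))"
    unfolding pt by (rule f)
  have agree: "(f \<circ> F \<circ> cinv c) u = ((f \<circ> cinv d) \<circ> (snd d \<circ> F \<circ> cinv c)) u" if "u \<in> ?N" for u
    using in_domain[OF c(1) that] N.cinv_chart[OF d(1)] by simp
  have D: "((f \<circ> cinv d) \<circ> (snd d \<circ> F \<circ> cinv c)) differentiable (at (snd c x))"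
    by (rule differentiable_chain_at[OF tr f'])
  note fr = frechet_derivative_agree[OF domain_open[OF c(1) d(1)] x agree D]
  show "(f \<circ> F \<circ> cinv c) differentiable (at (snd c x))"
    by (rule fr(1))
  show "frechet_derivative (f \<circ> F \<circ> cinv c) (at (snd c x)) a =
     frechet_derivative (f \<circ> cinv d) (at (snd d (F x)))
       (frechet_derivative (snd d \<circ> F \<circ> cinv c) (at (snd c x)) a)"
    using frechet_derivative_chain[OF tr f', of a] by (simp only: fr(2) pt)
qed

lemma tangent_map_chart:
  assumes c: "c \<in> M" "x \<in> fst c" and d: "d \<in> N" "F x \<in> fst d" and v: "v \<in> tangent_space M x"
  shows "tangent_map M N F x v d = frechet_derivative (snd d \<circ> F \<circ> cinv c) (at (snd c x)) (v c)"
proof -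
  have c': "chart_at M x \<in> M" "x \<in> fst (chart_at M x)"
    using chart_at_props in_pointsI c by metis+
  show ?thesis
    using M.change_chart(2)[OF c' c differentiable_in_charts[OF c d], of "v (chart_at M x)"]
      tangent_transform[OF v c'(1) c(1) c'(2) c(2)] d
    by (simp add: tangent_map_def Let_def)
qed

lemma tangent_map_in:
  assumes x: "x \<in> points M" and v: "v \<in> tangent_space M x"
  shows "tangent_map M N F x v \<in> tangent_space N (F x)"
proof -
  obtain c where c: "c \<in> M" "x \<in> fst c"
    using chart_at_props x by metis
  show ?thesis
  proof (rule tangent_spaceI)
    fix d d'
    assume d: "d \<in> N" "F x \<in> fst d" and d': "d' \<in> N" "F x \<in> fst d'"
    show "tangent_map M N F x v d' =
        frechet_derivative (snd d' \<circ> cinv d) (at (snd d (F x))) (tangent_map M N F x v d)"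
      unfolding tangent_map_chart[OF c d v] tangent_map_chart[OF c d' v]
      by (rule compose_chart(2)[OF c d N.transition_differentiable[OF d d']])
  qed (simp add: tangent_map_def if_not_P)
qed

lemma tangent_map_lincomb:
  assumes x: "x \<in> points M" and v: "v \<in> tangent_space M x" and w: "w \<in> tangent_space M x"
  shows "tangent_map M N F x (\<lambda>c. r *\<^sub>R v c + s *\<^sub>R w c) =
    (\<lambda>d. r *\<^sub>R tangent_map M N F x v d + s *\<^sub>R tangent_map M N F x w d)"
proof -
  obtain c where c: "c \<in> M" "x \<in> fst c"
    using chart_at_props x by metis
  obtain d where d: "d \<in> N" "F x \<in> fst d"
    using chart_at_props maps_points[OF x] by metis
  note lin = linear_frechet_derivative[OF differentiable_in_charts[OF c d]]
  show ?thesis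
    by (rule N.tangent_eqI[OF tangent_map_in[OF x M.tangent_lincomb[OF v w]]
          N.tangent_lincomb[OF tangent_map_in[OF x v] tangent_map_in[OF x w]] d])
      (simp add: tangent_map_chart[OF c d M.tangent_lincomb[OF v w]] tangent_map_chart[OF c d v]
        tangent_map_chart[OF c d w] linear_add[OF lin] linear_scale[OF lin])
qed

text \<open>
  Smoothness of the composition can be checked near one point, where a single chart of the target
  contains the image.
\<close>

lemma smooth_fun_compose:
  assumes f: "smooth_fun N f"
  shows "smooth_fun M (f \<circ> F)"
proof (rule M.smooth_funI)
  fix c
  assume c: "c \<in> M"
  show "smooth_on (snd c ` fst c) (f \<circ> F \<circ> cinv c)"
  proof (rule smooth_on_local)
    fix u
    assume "u \<in> snd c ` fst c"
    then obtain x where x: "x \<in> fst c" "u = snd c x"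
      by auto
    obtain d where d: "d \<in> N" "F x \<in> fst d"
      using chart_at_props[OF maps_points[OF in_pointsI[OF c x(1)]]] by metis
    let ?N = "snd c ` (fst c \<inter> F -` fst d)"
    have "smooth_on ?N (f \<circ> F \<circ> cinv c)"
    proof (rule smooth_on_cong[OF domain_open[OF c d(1)]])
      show "smooth_on ?N (\<lambda>u. (f \<circ> cinv d) ((snd d \<circ> F \<circ> cinv c) u))"
        using domain_open[OF c d(1)] smooth_in_charts[OF c d(1)] N.smooth_fun_chart[OF f d(1)]
        by (rule smooth_on_compose) (use in_domain[OF c, where d = d] in force)
      show "(f \<circ> cinv d) ((snd d \<circ> F \<circ> cinv c) u) = (f \<circ> F \<circ> cinv c) u" if "u \<in> ?N" for u
        using in_domain[OF c that] N.cinv_chart[OF d(1)] by simp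
    qed
    then show "\<exists>T. open T \<and> u \<in> T \<and> smooth_on T (f \<circ> F \<circ> cinv c)"
      using domain_open[OF c d(1)] x d by blast
  qed
qed

lemma differential_compose:
  assumes f: "smooth_fun N f" and x: "x \<in> points M" and v: "v \<in> tangent_space M x"
  shows "differential M (f \<circ> F) x v = differential N f (F x) (tangent_map M N F x v)"
proof -
  obtain c where c: "c \<in> M" "x \<in> fst c"
    using chart_at_props x by metis
  obtain d where d: "d \<in> N" "F x \<in> fst d"
    using chart_at_props[OF maps_points[OF x]] by metis
  note f' = N.smooth_fun_differentiable[OF f d]
  show ?thesis
    unfolding N.differential_chart[OF f' d tangent_map_in[OF x v]] tangent_map_chart[OF c d v]
      M.differential_chart[OF compose_chart(1)[OF c d f'] c v]
    by (rule compose_chart(2)[OF c d f'])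
qed

end

section \<open>Projection and fibres of the cotangent bundle\<close>

context smooth_atlas
begin

lemma cotangent_projection_local:
  assumes c: "c \<in> A" and u: "u \<in> snd c ` (fst c \<inter> fst d) \<times> UNIV"
  shows "(snd d \<circ> fst \<circ> cinv (cotangent_chart A c)) u = (snd d \<circ> cinv c) (fst u)"
proof -
  obtain a p where "u = (a, p)" "a \<in> snd c ` fst c"
    using u by auto
  then show ?thesis
    using cinv_cotangent_chart[OF c] by simp
qed

lemma cotangent_projection_smooth: "smooth_map (cotangent_atlas A) A fst"
  unfolding smooth_map_def
proof (intro conjI ballI)
  show "fst ` points (cotangent_atlas A) \<subseteq> points A"
    by (auto simp: points_cotangent_atlas)
  fix C d
  assume "C \<in> cotangent_atlas A" and d: "d \<in> A"
  then obtain c where c: "c \<in> A" "C = cotangent_chart A c"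
    by (auto simp: cotangent_atlas_def)
  have eq: "snd C ` (fst C \<inter> fst -` fst d) = snd c ` (fst c \<inter> fst d) \<times> UNIV"
    using cotangent_chart_image_Int[OF c(1), of "fst d"] c(2) by (simp add: vimage_def)
  have N: "open (snd c ` (fst c \<inter> fst d) \<times> (UNIV :: 'e set))"
    using overlap_open[OF c(1) d] by (simp add: open_Times)
  show "open (snd C ` (fst C \<inter> fst -` fst d))"
    using eq N by simp
  have "smooth_on (snd c ` (fst c \<inter> fst d) \<times> (UNIV :: 'e set)) (\<lambda>u. (snd d \<circ> cinv c) (fst u))"
    by (rule smooth_on_compose[OF N smooth_on_bounded_linear[OF bounded_linear_fst]
          transition_smooth[OF c(1) d]]) auto
  then show "smooth_on (snd C ` (fst C \<inter> fst -` fst d)) (snd d \<circ> fst \<circ> cinv C)"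
    unfolding eq unfolding c(2)
    by (rule smooth_on_cong[OF N, rotated]) (simp only: cotangent_projection_local[OF c(1)])
qed

lemma cotangent_projection_map: "smooth_map_between (cotangent_atlas A) A fst"
  by (intro smooth_map_between.intro cotangent_smooth_atlas smooth_atlas_axioms
      smooth_map_between_axioms.intro cotangent_projection_smooth)

lemma cotangent_pointI:
  "x \<in> points A \<Longrightarrow> \<alpha> \<in> cotangent_space A x \<Longrightarrow> (x, \<alpha>) \<in> points (cotangent_atlas A)"
  by (simp add: points_cotangent_atlas)

lemma cotangent_pointD:
  "z \<in> points (cotangent_atlas A) \<Longrightarrow> fst z \<in> points A"
  "z \<in> points (cotangent_atlas A) \<Longrightarrow> snd z \<in> cotangent_space A (fst z)"
  by (auto simp: points_cotangent_atlas)

lemma in_cotangent_chart: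
  "z \<in> points (cotangent_atlas A) \<Longrightarrow> fst z \<in> fst c \<Longrightarrow> z \<in> fst (cotangent_chart A c)"
  by (cases z) (simp add: points_cotangent_atlas)

lemma projection_in_charts:
  assumes c: "c \<in> A" and z: "z \<in> fst (cotangent_chart A c)"
  shows "frechet_derivative (snd c \<circ> fst \<circ> cinv (cotangent_chart A c))
    (at (snd (cotangent_chart A c) z)) w = fst w"
proof -
  let ?N = "snd c ` fst c \<times> (UNIV :: 'e set)"
  have "snd (cotangent_chart A c) z \<in> ?N"
    using z cotangent_chart_image[OF c] by blast
  moreover have "(snd c \<circ> fst \<circ> cinv (cotangent_chart A c)) u = fst u" if "u \<in> ?N" for u
    using that cinv_cotangent_chart[OF c] chart_cinv[where c = c] by (cases u) auto
  ultimately have "frechet_derivative (snd c \<circ> fst \<circ> cinv (cotangent_chart A c))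
      (at (snd (cotangent_chart A c) z)) = frechet_derivative fst (at (snd (cotangent_chart A c) z))"
    using chart_open[OF c]
    by (intro frechet_derivative_agree(2)[where N = ?N])
      (auto intro: bounded_linear_imp_differentiable bounded_linear_fst open_Times)
  also have "\<dots> = fst"
    by (rule frechet_derivative_at[symmetric])
      (rule bounded_linear_imp_has_derivative[OF bounded_linear_fst])
  finally show ?thesis
    by simp
qed

lemma projection_apply:
  assumes z: "z \<in> points (cotangent_atlas A)" and c: "c \<in> A" "fst z \<in> fst c"
    and w: "w \<in> tangent_space (cotangent_atlas A) z"
  shows "tangent_map (cotangent_atlas A) A fst z w c = fst (w (cotangent_chart A c))"
  using smooth_map_between.tangent_map_chart[OF cotangent_projection_map cotangent_chart_in[OF c(1)]
      in_cotangent_chart[OF z c(2)] c w]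
    projection_in_charts[OF c(1) in_cotangent_chart[OF z c(2)]] by simp

lemma cinv_fiber_point:
  assumes c: "c \<in> A" "x \<in> fst c"
  shows "cinv (cotangent_chart A c) (snd c x, p) = (x, covector_of A c x p)"
  using cinv_cotangent_chart[OF c(1)] c by (simp add: cinv_chart)

text \<open>
  The partial derivatives of \<open>F\<close> in the fibre coordinates are derivatives along lines in one fibre.
  There the values of \<open>F\<close> are known from its definition on covectors, without any chart.
\<close>

lemma fiber_line_derivative:
  assumes c: "c \<in> A" "x \<in> fst c" and y: "y \<in> cotangent_space A x"
    and F: "(F \<circ> cinv (cotangent_chart A c)) differentiable (at (snd (cotangent_chart A c) (x, y)))"
  shows "((\<lambda>t. F (x, covector_of A c x (momentum A c x y + t *\<^sub>R r))) has_real_derivative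
    frechet_derivative (F \<circ> cinv (cotangent_chart A c)) (at (snd (cotangent_chart A c) (x, y))) (0, r))
    (at 0)"
proof -
  let ?C = "cotangent_chart A c" and ?p = "momentum A c x y"
  let ?D = "frechet_derivative (F \<circ> cinv ?C) (at (snd ?C (x, y)))"
  have path: "((\<lambda>t::real. (snd c x, ?p + t *\<^sub>R r)) has_derivative (\<lambda>t. (0, t *\<^sub>R r))) (at 0)"
    by (auto intro!: derivative_eq_intros)
  have D: "((F \<circ> cinv ?C) has_derivative ?D) (at (snd c x, ?p + 0 *\<^sub>R r))"
    using frechet_derivative_worksI[OF F] by simp
  have "((\<lambda>t. (F \<circ> cinv ?C) (snd c x, ?p + t *\<^sub>R r)) has_derivative (\<lambda>t. ?D (0, t *\<^sub>R r))) (at 0)"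
    by (rule has_derivative_compose[OF path D])
  moreover have "?D (0, t *\<^sub>R r) = t * ?D (0, r)" for t
    using linear_cmul[OF linear_frechet_derivative[OF F], of t "(0, r)"] by simp
  ultimately show ?thesis
    using cinv_fiber_point[OF c] by (simp add: has_field_derivative_def o_def mult_commute_abs)
qed

text \<open>
  The chart is affine along the line \<open>\<mu> + t \<nu>\<close>.
\<close>

lemma vertical_lift_chart:
  assumes c: "c \<in> A" "x \<in> fst c" and \<mu>: "\<mu> \<in> cotangent_space A x"
  shows "vertical_lift A (x, \<mu>) \<nu> (cotangent_chart A c) = (0, momentum A c x \<nu>)"
proof -
  have "snd (cotangent_chart A c) (x, \<lambda>v. \<mu> v + t * \<nu> v) =
      (snd c x, momentum A c x \<mu> + t *\<^sub>R momentum A c x \<nu>)" for t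
    by (simp add: momentum_def scaleR_add_left sum.distrib scaleR_sum_right)
  moreover have "((\<lambda>t. (snd c x, momentum A c x \<mu> + t *\<^sub>R momentum A c x \<nu>)) has_vector_derivative
      (0, momentum A c x \<nu>)) (at 0)"
    unfolding has_vector_derivative_def by (auto intro!: derivative_eq_intros)
  ultimately show ?thesis
    using c \<mu> cotangent_chart_in[OF c(1)] by (simp add: vertical_lift_def vector_derivative_at)
qed

end

section \<open>Optimal control on a cotangent bundle\<close>

lemma optimal_hamiltonian_attained:
  assumes "optimal_control S U l X Bopt" "z \<in> points (cotangent_atlas S)"
  shows "optimal_hamiltonian U l X z = extended_hamiltonian l X (Bopt z) z" (is ?eq)
    and "B \<in> U \<Longrightarrow> optimal_hamiltonian U l X z \<le> extended_hamiltonian l X B z"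
    and "Bopt z \<in> U"
proof -
  show U: "Bopt z \<in> U"
    using assms unfolding optimal_control_def critical_control_def by blast
  have le: "extended_hamiltonian l X (Bopt z) z \<le> extended_hamiltonian l X B z" if "B \<in> U" for B
    using assms that unfolding optimal_control_def by blast
  show ?eq
    unfolding optimal_hamiltonian_def using U le by (intro Least_equality) auto
  then show "B \<in> U \<Longrightarrow> optimal_hamiltonian U l X z \<le> extended_hamiltonian l X B z"
    using le by simp
qed

locale optimal_system = smooth_atlas S
  for S :: "('s, 'd::euclidean_space) atlas" +
  fixes U :: "'b::euclidean_space set"
    and l :: "'s \<Rightarrow> 'b \<Rightarrow> real"
    and X :: "'b \<Rightarrow> 's \<Rightarrow> ('s, 'd) tvec"
    and Bopt :: "('s, 'd) cotangent \<Rightarrow> 'b"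
    and Y :: "('s, 'd) cotangent \<Rightarrow> (('s, 'd) cotangent, 'd \<times> 'd) tvec"
  assumes velocity_in: "B \<in> U \<Longrightarrow> x \<in> points S \<Longrightarrow> X B x \<in> tangent_space S x"
    and optimal: "optimal_control S U l X Bopt"
    and hopt_smooth: "smooth_fun (cotangent_atlas S) (optimal_hamiltonian U l X)"
    and flow: "hamiltonian_vector_field S (optimal_hamiltonian U l X) Y"
begin

abbreviation hopt :: "('s, 'd) cotangent \<Rightarrow> real" where
  "hopt \<equiv> optimal_hamiltonian U l X"

abbreviation Xopt :: "('s, 'd) cotangent \<Rightarrow> ('s, 'd) tvec" where
  "Xopt z \<equiv> X (Bopt z) (fst z)"

lemma Xopt_in: "z \<in> points (cotangent_atlas S) \<Longrightarrow> Xopt z \<in> tangent_space S (fst z)"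
  using velocity_in optimal_hamiltonian_attained(3)[OF optimal] cotangent_pointD(1) by blast

lemma flow_in: "z \<in> points (cotangent_atlas S) \<Longrightarrow> Y z \<in> tangent_space (cotangent_atlas S) z"
  using flow by (simp add: hamiltonian_vector_field_def vector_field_def)

text \<open>
  With \<open>B\<close> fixed at the optimal control of \<open>z\<close>, the extended Hamiltonian is affine along the fibre, lies above
  the optimal one and touches it at \<open>z\<close>. Hence the difference has a minimum there and both have the
  same fibre derivative.
\<close>

lemma envelope:
  assumes z: "z \<in> points (cotangent_atlas S)" and c: "c \<in> S" "fst z \<in> fst c"
  shows "frechet_derivative (hopt \<circ> cinv (cotangent_chart S c)) (at (snd (cotangent_chart S c) z)) (0, r)
    = Xopt z c \<bullet> r"
proof -
  obtain x y where xy: "z = (x, y)"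
    by (cases z)
  have y: "y \<in> cotangent_space S x" and x: "x \<in> points S" "x \<in> fst c"
    using z c xy cotangent_pointD by auto
  let ?p = "momentum S c x y" and ?v = "Xopt z"
  let ?z = "\<lambda>t. (x, covector_of S c x (?p + t *\<^sub>R r))"
  let ?\<phi> = "\<lambda>t. (l x (Bopt z) + ?v c \<bullet> (?p + t *\<^sub>R r)) - hopt (?z t)"
  have v: "?v \<in> tangent_space S x"
    using Xopt_in[OF z] xy by simp
  have ext: "extended_hamiltonian l X (Bopt z) (?z t) = l x (Bopt z) + ?v c \<bullet> (?p + t *\<^sub>R r)" for t
    using v xy by (simp add: extended_hamiltonian_def covector_of_apply)
  have z0: "?z 0 = z"
    using covector_of_momentum[OF y c(1) x(2)] xy by simp
  have D: "(hopt \<circ> cinv (cotangent_chart S c)) differentiable (at (snd (cotangent_chart S c) (x, y)))"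
    using smooth_atlas.smooth_fun_differentiable[OF cotangent_smooth_atlas hopt_smooth
        cotangent_chart_in[OF c(1)] in_cotangent_chart[OF z c(2)]] xy by simp
  have "(?\<phi> has_real_derivative ?v c \<bullet> r - frechet_derivative (hopt \<circ> cinv (cotangent_chart S c))
      (at (snd (cotangent_chart S c) z)) (0, r)) (at 0)"
  proof (rule DERIV_diff)
    show "((\<lambda>t. l x (Bopt z) + ?v c \<bullet> (?p + t *\<^sub>R r)) has_real_derivative ?v c \<bullet> r) (at 0)"
      by (auto intro!: derivative_eq_intros simp: inner_add_right)
    show "((\<lambda>t. hopt (?z t)) has_real_derivative frechet_derivative (hopt \<circ> cinv (cotangent_chart S c))
      (at (snd (cotangent_chart S c) z)) (0, r)) (at 0)"
      using fiber_line_derivative[OF c(1) x(2) y D] xy by simp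
  qed
  moreover have "\<forall>t. \<bar>0 - t\<bar> < 1 \<longrightarrow> ?\<phi> 0 \<le> ?\<phi> t"
  proof (intro allI impI)
    fix t :: real
    have "?z t \<in> points (cotangent_atlas S)"
      using x covector_of_in by (intro cotangent_pointI)
    then have "hopt (?z t) \<le> extended_hamiltonian l X (Bopt z) (?z t)"
      using optimal_hamiltonian_attained[OF optimal] z by blast
    moreover have "hopt (?z 0) = extended_hamiltonian l X (Bopt z) (?z 0)"
      unfolding z0 by (rule optimal_hamiltonian_attained(1)[OF optimal z])
    ultimately show "?\<phi> 0 \<le> ?\<phi> t"
      unfolding ext by simp
  qed
  ultimately have "?v c \<bullet> r - frechet_derivative (hopt \<circ> cinv (cotangent_chart S c))
      (at (snd (cotangent_chart S c) z)) (0, r) = 0"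
    by (intro DERIV_local_min[where d = 1 and f = ?\<phi> and x = 0]) simp_all
  then show ?thesis
    by simp
qed

text \<open>
  Half of Hamilton's equations, \<open>dx/dt = \<partial>Hopt/\<partial>y\<close>, obtained by testing with vertical vectors.
\<close>

lemma flow_projection:
  assumes z: "z \<in> points (cotangent_atlas S)"
  shows "tangent_map (cotangent_atlas S) S fst z (Y z) = Xopt z"
proof -
  let ?c = "chart_at S (fst z)" and ?M = "cotangent_atlas S"
  let ?C = "cotangent_chart S ?c"
  interpret M: smooth_atlas ?M
    by (rule cotangent_smooth_atlas)
  have c: "?c \<in> S" "fst z \<in> fst ?c"
    using chart_at_props cotangent_pointD(1)[OF z] by metis+
  note C = cotangent_chart_in[OF c(1)] in_cotangent_chart[OF z c(2)]
  have "fst (Y z ?C) \<bullet> r = Xopt z ?c \<bullet> r" for r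
  proof -
    let ?w = "coord_vec ?M ?C z (0, r)"
    have w: "?w \<in> tangent_space ?M z" "?w ?C = (0, r)"
      using M.coord_vec_in[OF C] M.coord_vec_self[OF C] by auto
    have "canonical_form S z (Y z) ?w = differential ?M hopt z ?w"
      using flow z w by (simp add: hamiltonian_vector_field_def)
    then show ?thesis
      using M.differential_chart[OF M.smooth_fun_differentiable[OF hopt_smooth C] C w(1)]
        envelope[OF z c] w(2) by (simp add: canonical_form_def Let_def)
  qed
  then have "fst (Y z ?C) = Xopt z ?c"
    by (metis vector_eq_rdot)
  then have "tangent_map ?M S fst z (Y z) ?c = Xopt z ?c"
    using projection_apply[OF z c flow_in[OF z]] by simp
  then show ?thesis
    using smooth_map_between.tangent_map_in[OF cotangent_projection_map z flow_in[OF z]]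
      Xopt_in[OF z] c by (intro tangent_eqI)
qed

lemma hopt_constant_of_motion: "constant_of_motion (cotangent_atlas S) Y hopt"
  unfolding constant_of_motion_def lie_derivative_def
proof (intro conjI hopt_smooth ballI)
  fix z
  assume z: "z \<in> points (cotangent_atlas S)"
  then have "differential (cotangent_atlas S) hopt z (Y z) = canonical_form S z (Y z) (Y z)"
    using flow flow_in by (simp add: hamiltonian_vector_field_def)
  then show "differential (cotangent_atlas S) hopt z (Y z) = 0"
    by (simp add: canonical_form_def Let_def inner_commute)
qed

lemma pullback_constant_of_motion:
  assumes f: "smooth_fun S f"
    and stat: "\<And>z. z \<in> points (cotangent_atlas S) \<Longrightarrow> differential S f (fst z) (Xopt z) = 0"
  shows "constant_of_motion (cotangent_atlas S) Y (f \<circ> fst)"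
proof -
  interpret p: smooth_map_between "cotangent_atlas S" S fst
    by (rule cotangent_projection_map)
  show ?thesis
    unfolding constant_of_motion_def lie_derivative_def
    using p.smooth_fun_compose[OF f] p.differential_compose[OF f _ flow_in] flow_projection stat
    by simp
qed

text \<open>
  A vertical vector along \<open>Xopt z\<close> detects \<open>hopt\<close> and not \<open>f \<circ> fst\<close>; once the coefficient of \<open>hopt\<close> is known
  to vanish, a horizontal vector over a direction in which \<open>f\<close> varies detects the other one.
\<close>

lemma functionally_independent_hopt:
  assumes f: "smooth_fun S f" and z: "z \<in> points (cotangent_atlas S)"
    and "Xopt z \<noteq> (\<lambda>_. 0)"
    and crit: "\<exists>v\<in>tangent_space S (fst z). differential S f (fst z) v \<noteq> 0"
  shows "functionally_independent_at (cotangent_atlas S) hopt (f \<circ> fst) z"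
  unfolding functionally_independent_at_def
proof (intro allI impI)
  fix a b :: real
  let ?M = "cotangent_atlas S"
  assume comb: "\<forall>w\<in>tangent_space ?M z. a * differential ?M hopt z w + b * differential ?M (f \<circ> fst) z w = 0"
  interpret M: smooth_atlas ?M
    by (rule cotangent_smooth_atlas)
  interpret p: smooth_map_between ?M S fst
    by (rule cotangent_projection_map)
  obtain c where c: "c \<in> S" "fst z \<in> fst c"
    using chart_at_props cotangent_pointD(1)[OF z] by metis
  let ?C = "cotangent_chart S c"
  note C = cotangent_chart_in[OF c(1)] in_cotangent_chart[OF z c(2)]
  have proj: "tangent_map ?M S fst z (coord_vec ?M ?C z (e, r)) = coord_vec S c (fst z) e" for e r
    using projection_apply[OF z c M.coord_vec_in[OF C]] M.coord_vec_self[OF C] coord_vec_self[OF c]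
    by (intro tangent_eqI[OF p.tangent_map_in[OF z M.coord_vec_in[OF C]] coord_vec_in[OF c] c]) simp
  have Df: "differential ?M (f \<circ> fst) z (coord_vec ?M ?C z (e, r)) =
      differential S f (fst z) (coord_vec S c (fst z) e)" for e r
    using p.differential_compose[OF f z M.coord_vec_in[OF C]] proj by simp
  have f': "(f \<circ> cinv c) differentiable (at (snd c (fst z)))"
    by (rule smooth_fun_differentiable[OF f c])
  have "a * (Xopt z c \<bullet> Xopt z c) = 0"
  proof -
    let ?w = "coord_vec ?M ?C z (0, Xopt z c)"
    have "differential S f (fst z) (coord_vec S c (fst z) 0) = 0"
      using linear_0[OF linear_frechet_derivative[OF f']]
      by (simp add: differential_chart[OF f' c coord_vec_in[OF c]] coord_vec_self[OF c])
    moreover have "differential ?M hopt z ?w = Xopt z c \<bullet> Xopt z c"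
      using M.differential_chart[OF M.smooth_fun_differentiable[OF hopt_smooth C] C M.coord_vec_in[OF C]]
        M.coord_vec_self[OF C] envelope[OF z c] by simp
    ultimately show ?thesis
      using comb[rule_format, OF M.coord_vec_in[OF C], of "(0, Xopt z c)"] Df by simp
  qed
  moreover have "Xopt z c \<noteq> 0"
    using assms(3) tangent_zeroI[OF Xopt_in[OF z] c] by blast
  ultimately have a: "a = 0"
    by simp
  obtain v where v: "v \<in> tangent_space S (fst z)" "differential S f (fst z) v \<noteq> 0"
    using crit by blast
  have "b * differential S f (fst z) v = 0"
    using comb[rule_format, OF M.coord_vec_in[OF C], of "(v c, 0)"] Df[of "v c" 0]
      tangent_eq_coord_vec[OF v(1) c] a by simp
  then show "a = 0 \<and> b = 0"
    using a v by simp
qed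

end

lemma (in smooth_atlas) functionally_independent_imp_independent:
  assumes f: "smooth_fun A f" and g: "smooth_fun A g" and x: "x \<in> points A"
    and ind: "functionally_independent_at A f g x"
  shows "independent_modulo_constants A f g"
  unfolding independent_modulo_constants_def
proof (intro allI impI)
  fix a b :: real
  assume "\<exists>r. \<forall>x\<in>points A. a * f x + b * g x = r"
  then obtain r where r: "\<And>x. x \<in> points A \<Longrightarrow> a * f x + b * g x = r"
    by blast
  obtain c where c: "c \<in> A" "x \<in> fst c"
    using chart_at_props x by metis
  note f' = smooth_fun_differentiable[OF f c] and g' = smooth_fun_differentiable[OF g c]
  have "((\<lambda>u. a * (f \<circ> cinv c) u + b * (g \<circ> cinv c) u) has_derivative
      (\<lambda>h. a * frechet_derivative (f \<circ> cinv c) (at (snd c x)) h +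
        b * frechet_derivative (g \<circ> cinv c) (at (snd c x)) h)) (at (snd c x))"
    by (intro has_derivative_add has_derivative_mult_right frechet_derivative_worksI f' g')
  moreover have "a * (f \<circ> cinv c) u + b * (g \<circ> cinv c) u = r" if "u \<in> snd c ` fst c" for u
    using r[OF in_pointsI[OF c(1) cinv_in[OF that]]] by simp
  ultimately have "((\<lambda>_. r) has_derivative
      (\<lambda>h. a * frechet_derivative (f \<circ> cinv c) (at (snd c x)) h +
        b * frechet_derivative (g \<circ> cinv c) (at (snd c x)) h)) (at (snd c x))"
    using c by (elim has_derivative_transform_within_open[OF _ chart_open[OF c(1)]]) auto
  from fun_cong[OF has_derivative_unique[OF this has_derivative_const]]
  have "a * frechet_derivative (f \<circ> cinv c) (at (snd c x)) h +
        b * frechet_derivative (g \<circ> cinv c) (at (snd c x)) h = 0" for h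
    by simp
  then have "\<forall>w\<in>tangent_space A x. a * differential A f x w + b * differential A g x w = 0"
    using differential_chart[OF f' c] differential_chart[OF g' c] by metis
  then show "a = 0 \<and> b = 0"
    using ind unfolding functionally_independent_at_def by blast
qed

text \<open>
  A nontrivial polynomial \<open>a t + b t\<^sup>2 - r\<close> has at most two roots.
\<close>

lemma affine_square_independent:
  fixes a b t\<^sub>1 t\<^sub>2 t\<^sub>3 :: real
  assumes "t\<^sub>1 \<noteq> t\<^sub>2" "t\<^sub>1 \<noteq> t\<^sub>3" "t\<^sub>2 \<noteq> t\<^sub>3"
    and "a * t\<^sub>1 + b * t\<^sub>1\<^sup>2 = r" "a * t\<^sub>2 + b * t\<^sub>2\<^sup>2 = r" "a * t\<^sub>3 + b * t\<^sub>3\<^sup>2 = r"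
  shows "a = 0 \<and> b = 0"
proof -
  have "(t\<^sub>1 - t\<^sub>2) * (a + b * (t\<^sub>1 + t\<^sub>2)) = 0" "(t\<^sub>1 - t\<^sub>3) * (a + b * (t\<^sub>1 + t\<^sub>3)) = 0"
    using assms(4-6) by (simp_all add: algebra_simps power2_eq_square)
  then have "a + b * (t\<^sub>1 + t\<^sub>2) = 0" "a + b * (t\<^sub>1 + t\<^sub>3) = 0"
    using assms(1,2) by auto
  moreover from this have "b * (t\<^sub>2 - t\<^sub>3) = 0"
    unfolding distrib_left right_diff_distrib by linarith
  ultimately show ?thesis
    using assms(3) by auto
qed

context optimal_system
begin

text \<open>
  The second case is that of an optimal control that stops the state everywhere. Then \<open>hopt\<close> may fail to be
  independent of \<open>f\<close>, or even be constant, but every function of the state is conserved, and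
  \<open>f\<close> and \<open>f\<^sup>2\<close> serve.
\<close>

lemma two_constants_of_motion:
  assumes f: "smooth_fun S f"
    and conserved: "\<And>B x. B \<in> U \<Longrightarrow> x \<in> points S \<Longrightarrow> differential S f x (X B x) = 0"
    and regular: "\<And>B x. B \<in> U \<Longrightarrow> x \<in> points S \<Longrightarrow> X B x \<noteq> (\<lambda>_. 0) \<Longrightarrow>
      \<exists>v\<in>tangent_space S x. differential S f x v \<noteq> 0"
    and distinct: "x\<^sub>1 \<in> points S" "x\<^sub>2 \<in> points S" "x\<^sub>3 \<in> points S"
      "f x\<^sub>1 \<noteq> f x\<^sub>2" "f x\<^sub>1 \<noteq> f x\<^sub>3" "f x\<^sub>2 \<noteq> f x\<^sub>3"
  shows "\<exists>E\<^sub>1 E\<^sub>2. constant_of_motion (cotangent_atlas S) Y E\<^sub>1 \<and>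
    constant_of_motion (cotangent_atlas S) Y E\<^sub>2 \<and>
    independent_modulo_constants (cotangent_atlas S) E\<^sub>1 E\<^sub>2 \<and>
    (\<forall>z\<in>points (cotangent_atlas S). Xopt z \<noteq> (\<lambda>_. 0) \<longrightarrow>
       functionally_independent_at (cotangent_atlas S) E\<^sub>1 E\<^sub>2 z)"
proof (cases "\<exists>z\<in>points (cotangent_atlas S). Xopt z \<noteq> (\<lambda>_. 0)")
  case True
  then obtain z where z: "z \<in> points (cotangent_atlas S)" "Xopt z \<noteq> (\<lambda>_. 0)"
    by blast
  have f_const: "constant_of_motion (cotangent_atlas S) Y (f \<circ> fst)"
    using conserved optimal_hamiltonian_attained(3)[OF optimal] cotangent_pointD(1)
    by (intro pullback_constant_of_motion f) blast
  have ind: "functionally_independent_at (cotangent_atlas S) hopt (f \<circ> fst) z"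
    if "z \<in> points (cotangent_atlas S)" "Xopt z \<noteq> (\<lambda>_. 0)" for z
    using that regular optimal_hamiltonian_attained(3)[OF optimal] cotangent_pointD(1)
    by (intro functionally_independent_hopt f) blast+
  have "independent_modulo_constants (cotangent_atlas S) hopt (f \<circ> fst)"
    using smooth_atlas.functionally_independent_imp_independent[OF cotangent_smooth_atlas hopt_smooth
        _ z(1) ind[OF z]] f_const by (simp add: constant_of_motion_def)
  then show ?thesis
    using hopt_constant_of_motion f_const ind by blast
next
  case False
  have square: "smooth_fun S (\<lambda>x. (f x)\<^sup>2)"
  proof (rule smooth_funI)
    fix c
    assume "c \<in> S"
    then show "smooth_on (snd c ` fst c) ((\<lambda>x. (f x)\<^sup>2) \<circ> cinv c)"
      using smooth_on_mult[OF chart_open smooth_fun_chart smooth_fun_chart, OF _ f _ f]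
      by (simp add: o_def power2_eq_square)
  qed
  have stat: "differential S g (fst z) (Xopt z) = 0"
    if g: "smooth_fun S g" and z: "z \<in> points (cotangent_atlas S)" for g z
  proof -
    obtain c where c: "c \<in> S" "fst z \<in> fst c"
      using chart_at_props cotangent_pointD(1)[OF z] by metis
    note g' = smooth_fun_differentiable[OF g c]
    show ?thesis
      using differential_chart[OF g' c Xopt_in[OF z]] z False
        linear_0[OF linear_frechet_derivative[OF g']] by auto
  qed
  have "constant_of_motion (cotangent_atlas S) Y (g \<circ> fst)" if "smooth_fun S g" for g
    using that stat by (intro pullback_constant_of_motion) auto
  moreover have "independent_modulo_constants (cotangent_atlas S) (f \<circ> fst) ((\<lambda>x. (f x)\<^sup>2) \<circ> fst)"
    unfolding independent_modulo_constants_def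
  proof (intro allI impI)
    fix a b :: real
    assume "\<exists>r. \<forall>z\<in>points (cotangent_atlas S). a * (f \<circ> fst) z + b * ((\<lambda>x. (f x)\<^sup>2) \<circ> fst) z = r"
    then obtain r where r: "\<And>z. z \<in> points (cotangent_atlas S) \<Longrightarrow>
        a * (f \<circ> fst) z + b * ((\<lambda>x. (f x)\<^sup>2) \<circ> fst) z = r"
      by blast
    have "a * f x + b * (f x)\<^sup>2 = r" if "x \<in> points S" for x
      using r[OF cotangent_pointI[OF that covector_of_in]] by simp
    then show "a = 0 \<and> b = 0"
      using affine_square_independent distinct by metis
  qed
  ultimately show ?thesis
    using f square False by blast
qed

end

section \<open>Curves in an embedded submanifold\<close>

text \<open>
  Since \<open>\<psi>'\<close> is injective, \<open>u t - u 0\<close> is bounded by a multiple of \<open>\<gamma> t - \<gamma> 0\<close> and so of \<open>t\<close>. Hence \<open>\<gamma> t - \<gamma> 0\<close> lies in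
  the range of \<open>\<psi>'\<close> up to an error \<open>o(t)\<close>, and the range is closed. For a curve in an
  embedded submanifold, the continuity of the lift \<open>u\<close> comes from the subspace topology.
\<close>

lemma lifted_curve_velocity:
  fixes \<psi> :: "'a::euclidean_space \<Rightarrow> 'b::euclidean_space" and u :: "real \<Rightarrow> 'a"
  assumes \<psi>: "(\<psi> has_derivative \<psi>') (at (u 0))" and inj: "inj \<psi>'"
    and u: "isCont u 0" and lift: "\<forall>\<^sub>F t in at 0. \<psi> (u t) = \<gamma> t" "\<psi> (u 0) = \<gamma> 0"
    and \<gamma>: "(\<gamma> has_vector_derivative \<gamma>') (at 0)"
  shows "\<gamma>' \<in> range \<psi>'"
proof -
  have lin: "linear \<psi>'"
    using \<psi> by (rule has_derivative_linear)
  obtain L where L: "linear L" "\<And>h. L (\<psi>' h) = h"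
    using linear_injective_left_inverse[OF lin inj] by (auto simp: o_def id_def fun_eq_iff)
  \<comment> \<open>A projection with kernel the range of \<open>\<psi>'\<close>; the claim is \<open>P \<gamma>' = 0\<close>.\<close>
  define P where "P = (\<lambda>y. y - \<psi>' (L y))"
  have P: "linear P" "\<And>h. P (\<psi>' h) = 0"
    unfolding P_def using linear_compose_sub[OF linear_id linear_compose[OF L(1) lin]] L(2)
    by (simp_all add: o_def id_def)
  obtain KL where KL: "KL > 0" "\<And>y. norm (L y) \<le> norm y * KL"
    using bounded_linear.pos_bounded[OF linear_conv_bounded_linear[THEN iffD1, OF L(1)]] by blast
  obtain KP where KP: "KP > 0" "\<And>y. norm (P y) \<le> norm y * KP"
    using bounded_linear.pos_bounded[OF linear_conv_bounded_linear[THEN iffD1, OF P(1)]] by blast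
  \<comment> \<open>The bound \<open>norm (u t - u 0) \<le> K * \<bar>t\<bar>\<close> will hold for small \<open>t\<close>.\<close>
  define K where "K = 2 * KL * (norm \<gamma>' + 1)"
  have K: "K \<ge> 0"
    using KL(1) by (simp add: K_def)
  have lim: "(u \<longlongrightarrow> u 0) (at 0)"
    using u by (simp add: isCont_def)
  have small_\<psi>: "\<forall>\<^sub>F t in at 0. norm (\<gamma> t - \<gamma> 0 - \<psi>' (u t - u 0)) \<le> e * norm (u t - u 0)"
    if "e > 0" for e
  proof -
    obtain d where d: "d > 0"
      "\<And>y. norm (y - u 0) < d \<Longrightarrow> norm (\<psi> y - \<psi> (u 0) - \<psi>' (y - u 0)) \<le> e * norm (y - u 0)"
      using \<psi> \<open>e > 0\<close> unfolding has_derivative_at_alt by blast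
    have "\<forall>\<^sub>F t in at 0. dist (u t) (u 0) < d"
      using lim d(1) by (rule tendstoD)
    then show ?thesis
      using lift(1)
    proof eventually_elim
      case (elim t)
      then show ?case
        using d(2)[of "u t"] lift(2) by (simp add: dist_norm)
    qed
  qed
  have small_\<gamma>: "\<forall>\<^sub>F t in at 0. norm (\<gamma> t - \<gamma> 0 - t *\<^sub>R \<gamma>') \<le> e * \<bar>t\<bar>" if "e > 0" for e
    using \<gamma> that unfolding has_vector_derivative_def has_derivative_within_alt2 by simp
  have "norm (P \<gamma>') \<le> e" if "e > 0" for e
  proof -
    \<comment> \<open>With \<open>e0\<close>, half of \<open>norm (u t - u 0)\<close> is absorbed; with \<open>e1\<close>, the errors add up to \<open>e * \<bar>t\<bar>\<close>.\<close>
    define e1 where "e1 = e / (KP * (K + 1))"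
    define e0 where "e0 = 1 / (2 * KL)"
    have e: "e0 > 0" "e1 > 0"
      using that KP(1) KL(1) K by (auto simp: e0_def e1_def)
    have "\<forall>\<^sub>F t in at (0::real). t \<noteq> 0"
      by (simp add: eventually_at_filter)
    then have "\<forall>\<^sub>F t in at 0. t \<noteq> 0 \<and> norm (P \<gamma>') * \<bar>t\<bar> \<le> e * \<bar>t\<bar>"
      using small_\<psi>[OF e(1)] small_\<psi>[OF e(2)] small_\<gamma>[OF zero_less_one] small_\<gamma>[OF e(2)]
    proof eventually_elim
      case (elim t)
      let ?\<Delta> = "\<gamma> t - \<gamma> 0" and ?h = "u t - u 0"
      have "norm ?\<Delta> \<le> (norm \<gamma>' + 1) * \<bar>t\<bar>"
        using elim(4) norm_triangle_ineq[of "?\<Delta> - t *\<^sub>R \<gamma>'" "t *\<^sub>R \<gamma>'"] by (simp add: algebra_simps)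
      moreover have "norm (\<psi>' ?h) \<le> norm ?\<Delta> + e0 * norm ?h"
        using elim(2) norm_triangle_ineq4[of ?\<Delta> "?\<Delta> - \<psi>' ?h"] by simp
      ultimately have "norm (\<psi>' ?h) \<le> (norm \<gamma>' + 1) * \<bar>t\<bar> + e0 * norm ?h"
        by simp
      moreover have "norm ?h \<le> norm (\<psi>' ?h) * KL"
        using KL(2)[of "\<psi>' ?h"] L(2) by simp
      ultimately have "norm ?h \<le> ((norm \<gamma>' + 1) * \<bar>t\<bar> + e0 * norm ?h) * KL"
        using KL(1) by (meson mult_right_mono less_imp_le order_trans)
      also have "\<dots> = K * \<bar>t\<bar> / 2 + norm ?h / 2"
        using KL(1) by (simp add: K_def e0_def field_simps)
      finally have h: "norm ?h \<le> K * \<bar>t\<bar>"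
        by simp
      have "norm (P (t *\<^sub>R \<gamma>')) \<le> norm (P (?\<Delta> - \<psi>' ?h)) + norm (P (?\<Delta> - t *\<^sub>R \<gamma>'))"
        using norm_triangle_ineq4[of "P (?\<Delta> - \<psi>' ?h)" "P (?\<Delta> - t *\<^sub>R \<gamma>')"]
        by (simp add: linear_diff[OF P(1)] P(2))
      also have "\<dots> \<le> norm (?\<Delta> - \<psi>' ?h) * KP + norm (?\<Delta> - t *\<^sub>R \<gamma>') * KP"
        by (intro add_mono KP(2))
      also have "\<dots> \<le> (e1 * norm ?h) * KP + (e1 * \<bar>t\<bar>) * KP"
        using elim(3,5) KP(1) by (intro add_mono mult_right_mono) auto
      also have "\<dots> \<le> (e1 * (K * \<bar>t\<bar>)) * KP + (e1 * \<bar>t\<bar>) * KP"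
        using h e KP(1) by (intro add_mono mult_right_mono mult_left_mono) auto
      also have "\<dots> = e1 * (KP * (K + 1)) * \<bar>t\<bar>"
        by (simp add: algebra_simps)
      also have "\<dots> = e * \<bar>t\<bar>"
        using KP(1) K by (simp add: e1_def)
      finally show ?case
        using elim(1) by (simp add: linear_scale[OF P(1)] mult.commute)
    qed
    from eventually_happens'[OF _ this] show ?thesis
      by auto
  qed
  then have "norm (P \<gamma>') \<le> 0"
    by (rule field_le_epsilon[of _ 0, simplified])
  then show ?thesis
    by (simp add: P_def)
qed

lemma (in smooth_atlas) chart_preimage_open:
  assumes s: "s \<in> A" and B: "open B"
  shows "mopen A {x \<in> fst s. snd s x \<in> B}"
  unfolding mopen_def
proof (intro conjI ballI)
  show "{x \<in> fst s. snd s x \<in> B} \<subseteq> points A"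
    using s by (auto simp: points_def)
  fix c
  assume c: "c \<in> A"
  have "snd c ` (fst c \<inter> {x \<in> fst s. snd s x \<in> B}) =
      snd c ` (fst c \<inter> fst s) \<inter> (snd s \<circ> cinv c) -` B"
    using cinv_chart[OF c] by (auto simp: image_iff)
  then show "open (snd c ` (fst c \<inter> {x \<in> fst s. snd s x \<in> B}))"
    using continuous_open_preimage[OF smooth_on_imp_continuous_on[OF transition_smooth[OF c s]]
        overlap_open[OF c s] B] by simp
qed

locale embedded = M: smooth_atlas M + S: smooth_atlas S
  for M :: "('m, 'e::euclidean_space) atlas" and S :: "('m, 'd::euclidean_space) atlas" +
  assumes embedded: "embedded_submanifold M S"
begin

sublocale incl: smooth_map_between S M "\<lambda>z. z"
  using embedded by unfold_locales (simp add: embedded_submanifold_def)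

lemma incl_inj:
  "z \<in> points S \<Longrightarrow> inj_on (tangent_map S M (\<lambda>z. z) z) (tangent_space S z)"
  using embedded by (simp add: embedded_submanifold_def)

lemma incl_eq_zero:
  assumes z: "z \<in> points S" and C: "C \<in> M" "z \<in> fst C" and w: "w \<in> tangent_space S z"
    and "tangent_map S M (\<lambda>z. z) z w C = 0"
  shows "w = (\<lambda>_. 0)"
proof -
  obtain s where s: "s \<in> S" "z \<in> fst s"
    using chart_at_props z by metis
  have "tangent_map S M (\<lambda>z. z) z (\<lambda>_. 0) C = 0"
    unfolding incl.tangent_map_chart[OF s C S.tangent_zero]
    by (rule linear_0[OF linear_frechet_derivative[OF incl.differentiable_in_charts[OF s C]]])
  then have "tangent_map S M (\<lambda>z. z) z w = tangent_map S M (\<lambda>z. z) z (\<lambda>_. 0)"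
    using incl.tangent_map_in[OF z w] incl.tangent_map_in[OF z S.tangent_zero] C assms(5)
    by (intro M.tangent_eqI) auto
  then show ?thesis
    using incl_inj[OF z] w S.tangent_zero by (auto dest: inj_onD)
qed

text \<open>
  The curve lifts to a chart of the submanifold because charts of \<open>S\<close> are homeomorphisms for the subspace
  topology: near time \<open>0\<close> it stays in the given chart domain, and its coordinates are continuous.
\<close>

lemma curve_velocity:
  assumes z: "z \<in> points S" and C: "C \<in> M" "z \<in> fst C"
    and \<gamma>: "(\<gamma> has_vector_derivative \<gamma>') (at 0)" "\<gamma> 0 = snd C z"
    and on: "\<forall>\<^sub>F t in nhds 0. \<gamma> t \<in> snd C ` (fst C \<inter> points S)"
  shows "\<exists>w\<in>tangent_space S z. tangent_map S M (\<lambda>z. z) z w C = \<gamma>'"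
proof -
  obtain s where s: "s \<in> S" "z \<in> fst s"
    using chart_at_props z by metis
  define \<psi> where "\<psi> = snd C \<circ> (\<lambda>z. z) \<circ> cinv s"
  define \<psi>' where "\<psi>' = frechet_derivative \<psi> (at (snd s z))"
  define u where "u = (\<lambda>t. snd s (cinv C (\<gamma> t)))"
  have u0: "u 0 = snd s z"
    using \<gamma>(2) M.cinv_chart[OF C] by (simp add: u_def)
  have \<psi>d: "\<psi> differentiable (at (snd s z))"
    unfolding \<psi>_def by (rule incl.differentiable_in_charts[OF s C])
  have coord: "tangent_map S M (\<lambda>z. z) z (coord_vec S s z a) C = \<psi>' a" for a
    using incl.tangent_map_chart[OF s C S.coord_vec_in[OF s]] S.coord_vec_self[OF s]
    by (simp add: \<psi>'_def \<psi>_def)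
  have inj: "inj \<psi>'"
  proof (rule injI)
    fix a b
    assume "\<psi>' a = \<psi>' b"
    then have "tangent_map S M (\<lambda>z. z) z (coord_vec S s z a) =
        tangent_map S M (\<lambda>z. z) z (coord_vec S s z b)"
      using incl.tangent_map_in[OF z S.coord_vec_in[OF s]] C coord
      by (intro M.tangent_eqI) auto
    then have "coord_vec S s z a = coord_vec S s z b"
      using incl_inj[OF z] S.coord_vec_in[OF s] by (auto dest: inj_onD)
    then show "a = b"
      using S.coord_vec_self[OF s] by metis
  qed
  have near: "\<forall>\<^sub>F t in nhds 0. u t \<in> B \<and> cinv C (\<gamma> t) \<in> fst s" if B: "open B" "u 0 \<in> B" for B
  proof -
    define N where "N = {x \<in> fst s. snd s x \<in> B}"
    have "mopen S N"
      unfolding N_def by (rule S.chart_preimage_open[OF s(1) B(1)])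
    then obtain W where W: "mopen M W" "N = points S \<inter> W"
      using embedded unfolding embedded_submanifold_def mopen_def by meson
    have "z \<in> W"
      using B(2) u0 s W(2) by (auto simp: N_def)
    then have "\<gamma> 0 \<in> snd C ` (fst C \<inter> W)"
      using C \<gamma>(2) by auto
    moreover have "open (snd C ` (fst C \<inter> W))"
      using W(1) C(1) unfolding mopen_def by blast
    moreover have "isCont \<gamma> 0"
      using \<gamma>(1) by (rule has_vector_derivative_continuous)
    ultimately have "\<forall>\<^sub>F t in nhds 0. \<gamma> t \<in> snd C ` (fst C \<inter> W)"
      by (intro topological_tendstoD[where l = "\<gamma> 0"]) (auto simp: isCont_def tendsto_at_iff_tendsto_nhds)
    then show ?thesis
      using on
    proof eventually_elim
      case (elim t)
      then have "cinv C (\<gamma> t) \<in> N"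
        using M.image_Int_cinv[OF C(1)] W(2) by blast
      then show ?case
        by (simp add: N_def u_def)
    qed
  qed
  have "isCont u 0"
    unfolding isCont_def tendsto_at_iff_tendsto_nhds
    by (rule topological_tendstoI, rule eventually_mono[OF near]) auto
  moreover have "\<forall>\<^sub>F t in nhds 0. \<psi> (u t) = \<gamma> t"
    using near[OF open_UNIV UNIV_I] on
  proof eventually_elim
    case (elim t)
    then show ?case
      using S.cinv_chart[OF s(1)] M.image_Int_cinv(3)[OF C(1)] by (simp add: \<psi>_def u_def)
  qed
  then have "\<forall>\<^sub>F t in at 0. \<psi> (u t) = \<gamma> t" "\<psi> (u 0) = \<gamma> 0"
    by (auto simp: eventually_nhds_conv_at)
  ultimately have "\<gamma>' \<in> range \<psi>'"
    using frechet_derivative_worksI[OF \<psi>d] inj \<gamma>(1)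
    by (intro lifted_curve_velocity[of \<psi> \<psi>' u]) (auto simp: \<psi>'_def u0)
  then obtain a where "\<gamma>' = \<psi>' a"
    by blast
  then show ?thesis
    using coord S.coord_vec_in[OF s] by blast
qed

end

section \<open>Natural Hamiltonians\<close>

text \<open>
  The covector that corresponds to a vector under the metric.
\<close>

abbreviation flat ::
    "('m, 'e::euclidean_space) atlas \<Rightarrow> ('m, 'e) tensor2 \<Rightarrow> 'm \<Rightarrow> ('m, 'e) tvec \<Rightarrow> ('m, 'e) covec" where
  "flat A g x v \<equiv> covector_restrict A x (g x v)"

locale natural_system = smooth_atlas A
  for A :: "('m, 'e::euclidean_space) atlas" +
  fixes H :: "('m, 'e) cotangent \<Rightarrow> real" and g :: "('m, 'e) tensor2" and V :: "'m \<Rightarrow> real"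
  assumes metric: "riemannian_metric A g"
    and H_smooth: "smooth_fun (cotangent_atlas A) H"
    and H_flat: "x \<in> points A \<Longrightarrow> v \<in> tangent_space A x \<Longrightarrow> H (x, flat A g x v) = g x v v / 2 + V x"
begin

lemma metric_sym:
  "x \<in> points A \<Longrightarrow> v \<in> tangent_space A x \<Longrightarrow> w \<in> tangent_space A x \<Longrightarrow> g x v w = g x w v"
  using metric by (auto simp: riemannian_metric_def)

lemma metric_eq_0_imp:
  "x \<in> points A \<Longrightarrow> v \<in> tangent_space A x \<Longrightarrow> g x v v = 0 \<Longrightarrow> v = (\<lambda>_. 0)"
  using metric unfolding riemannian_metric_def by (metis less_irrefl)

lemma flat_in:
  "x \<in> points A \<Longrightarrow> v \<in> tangent_space A x \<Longrightarrow> flat A g x v \<in> cotangent_space A x"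
  using metric by (simp add: riemannian_metric_def smooth_tensor2_def)

lemma flat_apply: "w \<in> tangent_space A x \<Longrightarrow> flat A g x v w = g x v w"
  by (simp add: covector_restrict_def)

lemma metric_lincomb:
  assumes "x \<in> points A" "u \<in> tangent_space A x" "v \<in> tangent_space A x" "w \<in> tangent_space A x"
  shows "g x u (\<lambda>c. r *\<^sub>R v c + s *\<^sub>R w c) = r * g x u v + s * g x u w"
    and "g x (\<lambda>c. r *\<^sub>R v c + s *\<^sub>R w c) u = r * g x v u + s * g x w u"
proof -
  show *: "g x u (\<lambda>c. r *\<^sub>R v c + s *\<^sub>R w c) = r * g x u v + s * g x u w"
    using cotangent_lincomb[OF flat_in[OF assms(1,2)] assms(3,4)] flat_apply assms tangent_lincomb
    by simp
  show "g x (\<lambda>c. r *\<^sub>R v c + s *\<^sub>R w c) u = r * g x v u + s * g x w u"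
    using * metric_sym[OF assms(1) assms(2)] tangent_lincomb assms by simp
qed

lemma momentum_flat:
  assumes "x \<in> points A" "v \<in> tangent_space A x" "w \<in> tangent_space A x" "c \<in> A" "x \<in> fst c"
  shows "w c \<bullet> momentum A c x (flat A g x v) = g x v w"
  using covector_apply[OF flat_in[OF assms(1,2)] assms(4,5,3)] flat_apply[OF assms(3)] by simp

lemma momentum_flat_lincomb:
  assumes x: "x \<in> points A" and v: "v \<in> tangent_space A x" and w: "w \<in> tangent_space A x"
    and c: "c \<in> A" "x \<in> fst c"
  shows "momentum A c x (flat A g x (\<lambda>c. r *\<^sub>R v c + s *\<^sub>R w c)) =
    r *\<^sub>R momentum A c x (flat A g x v) + s *\<^sub>R momentum A c x (flat A g x w)"
proof -
  have "a \<bullet> momentum A c x (flat A g x (\<lambda>c. r *\<^sub>R v c + s *\<^sub>R w c)) =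
    a \<bullet> (r *\<^sub>R momentum A c x (flat A g x v) + s *\<^sub>R momentum A c x (flat A g x w))" for a
  proof -
    let ?e = "coord_vec A c x a"
    note e = coord_vec_in[OF c, of a]
    show ?thesis
      using momentum_flat[OF x tangent_lincomb[OF v w] e c] momentum_flat[OF x v e c]
        momentum_flat[OF x w e c] metric_lincomb(2)[OF x e v w]
      by (simp add: coord_vec_self[OF c] inner_add_right)
  qed
  then show ?thesis
    using vector_eq_ldot by blast
qed

text \<open>
  Positive definiteness makes the Gram matrix of \<open>g\<close> in a chart injective, hence surjective.
\<close>

lemma flat_surj:
  assumes x: "x \<in> points A" and \<alpha>: "\<alpha> \<in> cotangent_space A x"
  shows "\<exists>v\<in>tangent_space A x. \<alpha> = flat A g x v"
proof -
  obtain c where c: "c \<in> A" "x \<in> fst c"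
    using chart_at_props x by metis
  let ?e = "coord_vec A c x"
  define L where "L a = momentum A c x (flat A g x (?e a))" for a
  note e = coord_vec_in[OF c]
  have lin: "linear L"
  proof (rule linearI)
    show "L (a + b) = L a + L b" for a b
      using momentum_flat_lincomb[OF x e e c, of 1 a 1 b] coord_vec_lincomb[OF c, of 1 a 1 b]
      by (simp add: L_def)
    show "L (r *\<^sub>R a) = r *\<^sub>R L a" for r a
      using momentum_flat_lincomb[OF x e e c, of r a 0 a] coord_vec_lincomb[OF c, of r a 0 a]
      by (simp add: L_def)
  qed
  have "a = 0" if "L a = 0" for a
  proof -
    have "g x (?e a) (?e a) = 0"
      using momentum_flat[OF x e e c, of a a] that by (simp add: L_def)
    then show ?thesis
      using metric_eq_0_imp[OF x e] coord_vec_self[OF c] by metis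
  qed
  then have "surj L"
    using lin by (intro linear_injective_imp_surjective) (auto simp: linear_injective_0)
  then obtain a where "L a = momentum A c x \<alpha>"
    by (metis surjD)
  then have "\<alpha> = flat A g x (?e a)"
    using momentum_inj[OF \<alpha> flat_in[OF x e] c] by (simp add: L_def)
  then show ?thesis
    using e by blast
qed

text \<open>
  On the line of the covectors of \<open>v + t w\<close> the Hamiltonian is a quadratic polynomial in \<open>t\<close> whose linear
  coefficient is \<open>g(v, w)\<close>. It follows that the fibre derivative inverts \<open>flat\<close>.
\<close>

lemma fiber_derivative_flat:
  assumes c: "c \<in> A" "x \<in> fst c" and v: "v \<in> tangent_space A x"
  shows "frechet_derivative (H \<circ> cinv (cotangent_chart A c))
    (at (snd (cotangent_chart A c) (x, flat A g x v))) (0, r) = v c \<bullet> r"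
proof -
  have x: "x \<in> points A"
    using c by (rule in_pointsI)
  let ?C = "cotangent_chart A c"
  obtain w where w: "w \<in> tangent_space A x" "covector_of A c x r = flat A g x w"
    using flat_surj[OF x covector_of_in] by blast
  then have r: "r = momentum A c x (flat A g x w)"
    using momentum_covector_of[OF c] by metis
  let ?vt = "\<lambda>t::real. \<lambda>d. 1 *\<^sub>R v d + t *\<^sub>R w d"
  have vt: "?vt t \<in> tangent_space A x" for t
    using v w(1) by (rule tangent_lincomb)
  have path: "covector_of A c x (momentum A c x (flat A g x v) + t *\<^sub>R r) = flat A g x (?vt t)" for t
    using momentum_flat_lincomb[OF x v w(1) c, of 1 t]
      covector_of_momentum[OF flat_in[OF x vt] c, of t] by (simp add: r)
  have H: "H (x, covector_of A c x (momentum A c x (flat A g x v) + t *\<^sub>R r)) =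
      (g x v v + 2 * t * g x v w + t * t * g x w w) / 2 + V x" for t
    unfolding path H_flat[OF x vt]
    using metric_lincomb[OF x vt v w(1), of 1 t t] metric_lincomb[OF x v v w(1), of 1 t]
      metric_lincomb[OF x w(1) v w(1), of 1 t] metric_sym[OF x v w(1)]
    by (simp add: algebra_simps)
  have "(x, flat A g x v) \<in> fst ?C"
    using c flat_in[OF x v] by simp
  then have "(H \<circ> cinv ?C) differentiable (at (snd ?C (x, flat A g x v)))"
    by (rule smooth_atlas.smooth_fun_differentiable[OF cotangent_smooth_atlas H_smooth
        cotangent_chart_in[OF c(1)]])
  from fiber_line_derivative[OF c flat_in[OF x v] this, of r]
  have "((\<lambda>t. (g x v v + 2 * t * g x v w + t * t * g x w w) / 2 + V x) has_real_derivative
      frechet_derivative (H \<circ> cinv ?C) (at (snd ?C (x, flat A g x v))) (0, r)) (at 0)"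
    unfolding H .
  moreover have "((\<lambda>t. (g x v v + 2 * t * g x v w + t * t * g x w w) / 2 + V x) has_real_derivative
      g x v w) (at 0)"
    by (auto intro!: derivative_eq_intros)
  ultimately have "frechet_derivative (H \<circ> cinv ?C) (at (snd ?C (x, flat A g x v))) (0, r) = g x v w"
    by (rule DERIV_unique)
  then show ?thesis
    using momentum_flat[OF x w(1) v c] metric_sym[OF x v w(1)] r by simp
qed

lemma fiber_deriv_flat:
  assumes x: "x \<in> points A" and v: "v \<in> tangent_space A x"
  shows "fiber_deriv A H (x, flat A g x v) = v"
proof
  fix c
  show "fiber_deriv A H (x, flat A g x v) c = v c"
  proof (cases "c \<in> A \<and> x \<in> fst c")
    case True
    then show ?thesis
      using fiber_derivative_flat[of c x v] v euclidean_representation[of "v c"]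
      by (simp add: fiber_deriv_def Let_def)
  next
    case False
    then show ?thesis
      using tangent_zero_chart[OF v, of c] by (simp add: fiber_deriv_def if_not_P)
  qed
qed

lemma fiber_derivative_apply:
  assumes c: "c \<in> A" "fst z \<in> fst c" and z: "z \<in> points (cotangent_atlas A)"
  shows "frechet_derivative (H \<circ> cinv (cotangent_chart A c)) (at (snd (cotangent_chart A c) z)) (0, r) =
    fiber_deriv A H z c \<bullet> r"
proof -
  obtain v where v: "v \<in> tangent_space A (fst z)" "snd z = flat A g (fst z) v"
    using flat_surj cotangent_pointD[OF z] by blast
  then have "z = (fst z, flat A g (fst z) v)"
    by (metis prod.collapse)
  then show ?thesis
    using fiber_derivative_flat[OF c v(1)] fiber_deriv_flat[OF cotangent_pointD(1)[OF z] v(1)] by metis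
qed

lemma fiber_deriv_in:
  assumes z: "z \<in> points (cotangent_atlas A)"
  shows "fiber_deriv A H z \<in> tangent_space A (fst z)"
proof -
  obtain v where v: "v \<in> tangent_space A (fst z)" "snd z = flat A g (fst z) v"
    using flat_surj cotangent_pointD[OF z] by blast
  then have "z = (fst z, flat A g (fst z) v)"
    by (metis prod.collapse)
  then show ?thesis
    using fiber_deriv_flat[OF cotangent_pointD(1)[OF z] v(1)] v by metis
qed

lemma flat_zero: "x \<in> points A \<Longrightarrow> flat A g x (\<lambda>_. 0) = (\<lambda>_. 0)"
  using metric_lincomb(2)[OF _ _ tangent_zero tangent_zero, of x _ 0 0]
  by (auto simp: covector_restrict_def fun_eq_iff)

end

section \<open>Constrained states\<close>

locale constrained_hamiltonian = natural_system A H g V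
  for A :: "('q, 'e::euclidean_space) atlas" and H g V +
  fixes k :: nat and D :: "'q \<Rightarrow> ('q, 'e) tvec set"
  assumes distribution: "distribution A k D" and rank: "k < DIM('e)"
begin

lemma frame_at: "x \<in> points A \<Longrightarrow> \<exists>W \<eta>. x \<in> W \<and> annihilator_frame A k D W \<eta>"
  using distribution by (simp add: distribution_def)

lemma basis_at: "x \<in> points A \<Longrightarrow> \<exists>\<eta>. annihilator_basis A k D x \<eta>"
  using frame_at by (meson annihilator_frame_def)

lemma distribution_tangent: "x \<in> points A \<Longrightarrow> v \<in> D x \<Longrightarrow> v \<in> tangent_space A x"
  using basis_at unfolding annihilator_basis_def by blast

lemma distribution_scale:
  assumes x: "x \<in> points A" and v: "v \<in> D x"
  shows "(\<lambda>c. r *\<^sub>R v c) \<in> D x"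
proof -
  obtain \<eta> where \<eta>: "annihilator_basis A k D x \<eta>"
    using basis_at x by blast
  have "\<eta> i (\<lambda>c. r *\<^sub>R v c) = 0" if "i < k" for i
    using cotangent_scale[of "\<eta> i" x v r] \<eta> that v unfolding annihilator_basis_def by simp
  then show ?thesis
    using tangent_scale[OF distribution_tangent[OF x v]] \<eta> unfolding annihilator_basis_def by simp
qed

text \<open>
  Fewer than \<open>DIM('e)\<close> linear conditions have a common nonzero solution.
\<close>

lemma distribution_nonzero:
  assumes x: "x \<in> points A"
  shows "\<exists>v\<in>D x. v \<noteq> (\<lambda>_. 0)"
proof -
  obtain \<eta> where \<eta>: "annihilator_basis A k D x \<eta>"
    using basis_at x by blast
  obtain c where c: "c \<in> A" "x \<in> fst c"
    using chart_at_props x by metis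
  let ?P = "(\<lambda>i. momentum A c x (\<eta> i)) ` {..<k}"
  have "dim ?P \<le> card ?P"
    by (rule dim_le_card') simp
  also have "\<dots> \<le> k"
    using card_image_le[of "{..<k}" "\<lambda>i. momentum A c x (\<eta> i)"] by simp
  finally have "dim ?P < DIM('e)"
    using rank by simp
  then obtain a where a: "a \<noteq> 0" "span ?P \<subseteq> {y. a \<bullet> y = 0}"
    using lowdim_subset_hyperplane by blast
  have "\<eta> i (coord_vec A c x a) = 0" if "i < k" for i
  proof -
    have "momentum A c x (\<eta> i) \<in> span ?P"
      using that by (intro span_base) simp
    then show ?thesis
      using covector_coord_vec[OF _ c] a(2) \<eta> that unfolding annihilator_basis_def by auto
  qed
  then have "coord_vec A c x a \<in> D x"
    using \<eta> coord_vec_in[OF c] unfolding annihilator_basis_def by simp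
  moreover have "coord_vec A c x a \<noteq> (\<lambda>_. 0)"
    using a(1) coord_vec_self[OF c] by metis
  ultimately show ?thesis
    by blast
qed

lemma distribution_zero: "x \<in> points A \<Longrightarrow> (\<lambda>_. 0) \<in> D x"
  using distribution_nonzero distribution_scale[of x _ 0] by fastforce

end

text \<open>
  The features that the state spaces of general and of reduced systems share. The scaling condition says
  that with a momentum the state space contains the ray through it.
\<close>

locale constrained_system = constrained_hamiltonian A H g V k D
  for A :: "('q, 'e::euclidean_space) atlas" and H g V k D +
  fixes S :: "(('q, 'e) cotangent, 'd::euclidean_space) atlas"
  assumes state_space: "embedded_submanifold (cotangent_atlas A) S"
    and state_point: "z \<in> points S \<Longrightarrow> z \<in> points (cotangent_atlas A)"
    and state_velocity: "z \<in> points S \<Longrightarrow> fiber_deriv A H z \<in> D (fst z)"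
    and state_scale: "(x, flat A g x v) \<in> points S \<Longrightarrow> v \<in> tangent_space A x \<Longrightarrow>
      (x, flat A g x (\<lambda>c. r *\<^sub>R v c)) \<in> points S"
begin

sublocale state: embedded "cotangent_atlas A" S
  using state_space
  by (intro embedded.intro embedded_axioms.intro cotangent_smooth_atlas smooth_manifold_atlas)
    (simp_all add: embedded_submanifold_def)

lemma state_base: "z \<in> points S \<Longrightarrow> fst z \<in> points A"
  using state_point cotangent_pointD(1) by blast

lemma state_flat:
  assumes z: "z \<in> points S"
  shows "z = (fst z, flat A g (fst z) (fiber_deriv A H z))"
proof -
  note x = state_base[OF z] and \<alpha> = cotangent_pointD(2)[OF state_point[OF z]]
  obtain v where v: "v \<in> tangent_space A (fst z)" "snd z = flat A g (fst z) v"
    using flat_surj[OF x \<alpha>] by blast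
  then have "z = (fst z, flat A g (fst z) v)"
    by (metis prod.collapse)
  then show ?thesis
    using fiber_deriv_flat[OF x v(1)] by metis
qed

lemma H_state_smooth: "smooth_fun S H"
  using state.incl.smooth_fun_compose[OF H_smooth] by (simp add: o_def)

lemma differential_state:
  assumes "z \<in> points S" "w \<in> tangent_space S z"
  shows "differential S H z w =
    differential (cotangent_atlas A) H z (tangent_map S (cotangent_atlas A) (\<lambda>z. z) z w)"
  using state.incl.differential_compose[OF H_smooth assms] by (simp add: o_def)

text \<open>
  Curves in the state space turn a vanishing differential on the abstract manifold \<open>S\<close> into
  a vanishing derivative of \<open>H\<close> in the coordinates of the cotangent bundle.
\<close>

lemma curve_differential:
  assumes z: "z \<in> points S" and c: "c \<in> A" "fst z \<in> fst c"
    and crit: "\<And>w. w \<in> tangent_space S z \<Longrightarrow> differential S H z w = 0"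
    and \<gamma>: "(\<gamma> has_vector_derivative \<gamma>') (at 0)" "\<gamma> 0 = snd (cotangent_chart A c) z"
    and on: "\<forall>\<^sub>F t in nhds 0. \<gamma> t \<in> snd (cotangent_chart A c) ` (fst (cotangent_chart A c) \<inter> points S)"
  shows "frechet_derivative (H \<circ> cinv (cotangent_chart A c)) (at (snd (cotangent_chart A c) z)) \<gamma>' = 0"
proof -
  note C = cotangent_chart_in[OF c(1)] in_cotangent_chart[OF state_point[OF z] c(2)]
  obtain w where w: "w \<in> tangent_space S z"
    "tangent_map S (cotangent_atlas A) (\<lambda>z. z) z w (cotangent_chart A c) = \<gamma>'"
    using state.curve_velocity[OF z C \<gamma> on] by blast
  show ?thesis
    using crit[OF w(1)] differential_state[OF z w(1)] w(2)
      state.M.differential_chart[OF state.M.smooth_fun_differentiable[OF H_smooth C] C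
        state.incl.tangent_map_in[OF z w(1)]] by simp
qed

text \<open>
  The momentum can be rescaled within the state space, and the derivative of \<open>H\<close> under rescaling is twice
  the kinetic energy.
\<close>

lemma critical_state_at_rest:
  assumes z: "z \<in> points S"
    and crit: "\<And>w. w \<in> tangent_space S z \<Longrightarrow> differential S H z w = 0"
  shows "fiber_deriv A H z = (\<lambda>_. 0)"
proof -
  let ?x = "fst z" and ?v = "fiber_deriv A H z"
  obtain c where c: "c \<in> A" "?x \<in> fst c"
    using chart_at_props state_base[OF z] by metis
  let ?C = "cotangent_chart A c" and ?p = "momentum A c ?x (flat A g ?x ?v)"
  note x = state_base[OF z]
  have v: "?v \<in> tangent_space A ?x"
    by (rule fiber_deriv_in[OF state_point[OF z]])
  have zS: "(?x, flat A g ?x ?v) \<in> points S"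
    using state_flat[OF z] z by simp
  let ?\<gamma> = "\<lambda>t::real. (snd c ?x, ?p + t *\<^sub>R ?p)"
  have "?\<gamma> t \<in> snd ?C ` (fst ?C \<inter> points S)" for t
  proof -
    let ?vt = "\<lambda>d. (1 + t) *\<^sub>R ?v d"
    have "(?x, flat A g ?x ?vt) \<in> points S"
      by (rule state_scale[OF zS v])
    moreover have "(?x, flat A g ?x ?vt) \<in> fst ?C"
      using flat_in[OF x tangent_scale[OF v]] c by simp
    moreover have "snd ?C (?x, flat A g ?x ?vt) = ?\<gamma> t"
      using momentum_flat_lincomb[OF x v v c, of 1 t] by (simp add: scaleR_add_left)
    ultimately show ?thesis
      by (metis IntI imageI)
  qed
  moreover have "(?\<gamma> has_vector_derivative (0, ?p)) (at 0)"
    unfolding has_vector_derivative_def by (auto intro!: derivative_eq_intros)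
  moreover have "?\<gamma> 0 = snd ?C z"
    by (subst state_flat[OF z]) simp
  ultimately have "frechet_derivative (H \<circ> cinv ?C) (at (snd ?C z)) (0, ?p) = 0"
    using curve_differential[OF z c crit, of ?\<gamma> "(0, ?p)"] by simp
  then have "g ?x ?v ?v = 0"
    using fiber_derivative_apply[OF c state_point[OF z]] momentum_flat[OF x v v c] by simp
  then show ?thesis
    by (rule metric_eq_0_imp[OF x v])
qed

text \<open>
  The constraint \<open>\<eta>\<^sub>i(v) = 0\<close>, as a function of the momentum, vanishes on the state space, so its derivative
  kills tangent vectors of the state space. The extension by \<open>0\<close> outside of \<open>W\<close> makes it vanish at all
  states and not only at those over \<open>W\<close>.
\<close>

lemma constraint_derivative:
  assumes z: "z \<in> points S" and w: "w \<in> tangent_space S z" and c: "c \<in> A" "fst z \<in> fst c"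
    and W: "annihilator_frame A k D W \<eta>" "fst z \<in> W" and i: "i < k"
  defines "f \<equiv> \<lambda>z. if fst z \<in> W then \<eta> i (fst z) (fiber_deriv A H z) else 0"
  shows "(f \<circ> cinv (cotangent_chart A c)) differentiable (at (snd (cotangent_chart A c) z))"
    and "frechet_derivative (f \<circ> cinv (cotangent_chart A c)) (at (snd (cotangent_chart A c) z))
      (tangent_map S (cotangent_atlas A) (\<lambda>z. z) z w (cotangent_chart A c)) = 0"
proof -
  let ?C = "cotangent_chart A c"
  let ?N = "snd c ` (fst c \<inter> W) \<times> (UNIV :: 'e set)"
  \<comment> \<open>The coordinate expression of \<open>f\<close> over \<open>W\<close>.\<close>
  let ?F = "\<lambda>u. \<Sum>b\<in>Basis. \<eta> i (cinv c (fst u)) (coord_vec A c (cinv c (fst u)) b) *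
      frechet_derivative (H \<circ> cinv ?C) (at u) (0, b)"
  note C = cotangent_chart_in[OF c(1)] in_cotangent_chart[OF state_point[OF z] c(2)]
  have Wo: "open (snd c ` (fst c \<inter> W))"
    and form: "one_form_on A W (\<eta> i)" and basis: "\<And>x. x \<in> W \<Longrightarrow> annihilator_basis A k D x (\<lambda>i. \<eta> i x)"
    using W(1) c(1) i unfolding annihilator_frame_def mopen_def by auto
  have N: "open ?N"
    using Wo by (simp add: open_Times)
  have "smooth_on ?N (\<lambda>u. \<eta> i (cinv c (fst u)) (coord_vec A c (cinv c (fst u)) b))" for b
    using form c(1) unfolding one_form_on_def
    by (intro smooth_on_compose[OF N smooth_on_bounded_linear[OF bounded_linear_fst],
          where g = "\<lambda>u. \<eta> i (cinv c u) (coord_vec A c (cinv c u) b)"]) auto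
  moreover have "smooth_on ?N (\<lambda>u. frechet_derivative (H \<circ> cinv ?C) (at u) (0, b))" for b
    by (rule smooth_on_subset[OF smooth_on_frechet_derivative[OF
          state.M.smooth_fun_chart[OF H_smooth C(1)]]])
      (auto simp: cotangent_chart_image[OF c(1)])
  ultimately have F: "smooth_on ?N ?F"
    by (intro smooth_on_sum N smooth_on_mult)
  have zN: "snd ?C z \<in> ?N"
    using c W(2) by (cases z) auto
  have agree: "(f \<circ> cinv ?C) u = ?F u" if uN: "u \<in> ?N" for u
  proof -
    obtain a p where u: "u = (a, p)" "a \<in> snd c ` (fst c \<inter> W)"
      using uN by (meson SigmaE)
    let ?x = "cinv c a"
    note x = image_Int_cinv[OF c(1) u(2)]
    have xA: "?x \<in> points A"
      using in_pointsI[OF c(1) x(1)] .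
    have "a \<in> snd c ` fst c"
      using u(2) by auto
    then have Cu: "cinv ?C u = (?x, covector_of A c ?x p)"
      using cinv_cotangent_chart[OF c(1)] u(1) by simp
    let ?z = "(?x, covector_of A c ?x p)"
    have z': "?z \<in> points (cotangent_atlas A)"
      by (rule cotangent_pointI[OF xA covector_of_in])
    have coords: "snd ?C ?z = u"
      using u(1) x momentum_covector_of[OF c(1) x(1)] by simp
    have \<eta>: "\<eta> i ?x \<in> cotangent_space A ?x"
      using form x(2) unfolding one_form_on_def by blast
    have "?F u = (\<Sum>b\<in>Basis. \<eta> i ?x (coord_vec A c ?x b) * (fiber_deriv A H ?z c \<bullet> b))"
      using fiber_derivative_apply[OF c(1) _ z', simplified, OF x(1)] coords u(1) by simp
    also have "\<dots> = fiber_deriv A H ?z c \<bullet> momentum A c ?x (\<eta> i ?x)"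
      by (simp add: momentum_def inner_sum_right mult.commute)
    also have "\<dots> = \<eta> i ?x (fiber_deriv A H ?z)"
      using covector_apply[OF \<eta> c(1) x(1)] fiber_deriv_in[OF z'] by simp
    finally show ?thesis
      using x(2) by (simp add: f_def Cu)
  qed
  show fd: "(f \<circ> cinv ?C) differentiable (at (snd ?C z))"
    by (rule frechet_derivative_agree(1)[OF N zN agree smooth_on_imp_differentiable[OF F zN]])
  obtain s where s: "s \<in> S" "z \<in> fst s"
    using chart_at_props z by metis
  have zero: "(f \<circ> (\<lambda>z. z) \<circ> cinv s) u = 0" if "u \<in> snd s ` fst s" for u
  proof -
    let ?z = "cinv s u"
    have "?z \<in> points S"
      using in_pointsI[OF s(1) cinv_in[OF that]] .
    then have "fiber_deriv A H ?z \<in> D (fst ?z)"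
      by (rule state_velocity)
    moreover have "\<eta> i x v = 0" if "x \<in> W" "v \<in> D x" for x v
      using basis[OF that(1)] that(2) i unfolding annihilator_basis_def by simp
    ultimately show ?thesis
      by (simp add: f_def)
  qed
  have "frechet_derivative (f \<circ> (\<lambda>z. z) \<circ> cinv s) (at (snd s z)) = frechet_derivative (\<lambda>_. 0) (at (snd s z))"
    by (rule frechet_derivative_agree(2)[OF state.S.chart_open[OF s(1)] _ zero]) (use s in auto)
  then show "frechet_derivative (f \<circ> cinv ?C) (at (snd ?C z))
      (tangent_map S (cotangent_atlas A) (\<lambda>z. z) z w ?C) = 0"
    using state.incl.compose_chart(2)[OF s C fd, of "w s"] state.incl.tangent_map_chart[OF s C w]
    by (simp add: frechet_derivative_const)
qed

text \<open>
  A vertical vector \<open>r\<close> that annihilates \<open>D\<close> is of the kind of a reaction force. If it is tangent to the state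
  space at zero momentum, then the derivative of the constraints along it shows that the vector \<open>v\<close> with
  \<open>flat v = r\<close> lies in \<open>D\<close>, because along the line \<open>t r\<close> the constraints are \<open>t \<eta>\<^sub>i(v)\<close>. So \<open>g(v, v) = r(v) = 0\<close>.
\<close>

lemma vertical_reaction_vanishes:
  assumes z: "z \<in> points S" and w: "w \<in> tangent_space S z" and c: "c \<in> A" "fst z \<in> fst c"
    and rest: "fiber_deriv A H z = (\<lambda>_. 0)"
    and vert: "tangent_map S (cotangent_atlas A) (\<lambda>z. z) z w (cotangent_chart A c) = (0, r)"
    and reaction: "\<And>d. d \<in> D (fst z) \<Longrightarrow> r \<bullet> d c = 0"
  shows "w = (\<lambda>_. 0)"
proof -
  let ?x = "fst z" and ?C = "cotangent_chart A c"
  note x = state_base[OF z]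
  note C = cotangent_chart_in[OF c(1)] in_cotangent_chart[OF state_point[OF z] c(2)]
  obtain v where v: "v \<in> tangent_space A ?x" "covector_of A c ?x r = flat A g ?x v"
    using flat_surj[OF x covector_of_in] by blast
  then have r: "r = momentum A c ?x (flat A g ?x v)"
    using momentum_covector_of[OF c] by metis
  have z0: "z = (?x, flat A g ?x (\<lambda>_. 0))"
    using state_flat[OF z] rest by simp
  obtain W \<eta> where W: "annihilator_frame A k D W \<eta>" "?x \<in> W"
    using frame_at[OF x] by blast
  then have basis: "annihilator_basis A k D ?x (\<lambda>i. \<eta> i ?x)"
    by (simp add: annihilator_frame_def)
  have "\<eta> i ?x v = 0" if i: "i < k" for i
  proof -
    define f where "f = (\<lambda>z. if fst z \<in> W then \<eta> i (fst z) (fiber_deriv A H z) else 0)"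
    have \<eta>: "\<eta> i ?x \<in> cotangent_space A ?x"
      using basis i by (simp add: annihilator_basis_def)
    note f = constraint_derivative[OF z w c W i, folded f_def]
    have path: "covector_of A c ?x (momentum A c ?x (flat A g ?x (\<lambda>_. 0)) + t *\<^sub>R r) =
        flat A g ?x (\<lambda>d. t *\<^sub>R v d)" for t
      using momentum_flat_lincomb[OF x tangent_zero v(1) c, of 1 t]
        covector_of_momentum[OF flat_in[OF x tangent_scale[OF v(1)]] c, of t] by (simp add: r)
    have f_path: "f (?x, flat A g ?x (\<lambda>d. t *\<^sub>R v d)) = t * \<eta> i ?x v" for t
      using W(2) fiber_deriv_flat[OF x tangent_scale[OF v(1)]] cotangent_scale[OF \<eta> v(1)]
      by (simp add: f_def)
    have "(f \<circ> cinv ?C) differentiable (at (snd ?C (?x, flat A g ?x (\<lambda>_. 0))))"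
      using f(1) z0 by metis
    from fiber_line_derivative[OF c flat_in[OF x tangent_zero] this, of r]
    have "((\<lambda>t. t * \<eta> i ?x v) has_real_derivative
        frechet_derivative (f \<circ> cinv ?C) (at (snd ?C z)) (0, r)) (at 0)"
      unfolding path f_path z0[symmetric] .
    moreover have "((\<lambda>t. t * \<eta> i ?x v) has_real_derivative \<eta> i ?x v) (at 0)"
      by (auto intro!: derivative_eq_intros)
    ultimately show ?thesis
      using f(2) vert DERIV_unique by metis
  qed
  then have "v \<in> D ?x"
    using basis v(1) unfolding annihilator_basis_def by simp
  then have "g ?x v v = 0"
    using reaction momentum_flat[OF x v(1) v(1) c] r by (simp add: inner_commute)
  then have "v = (\<lambda>_. 0)"
    by (rule metric_eq_0_imp[OF x v(1)])
  then have "r = 0"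
    using r momentum_flat_lincomb[OF x tangent_zero tangent_zero c, of 0 0] by simp
  then show ?thesis
    using state.incl_eq_zero[OF z C w] vert by (simp add: zero_prod_def)
qed

text \<open>
  At \<open>t\<close> times a given momentum the kinetic energy is \<open>t\<^sup>2\<close> times the given one; \<open>t = 0, 1, 2\<close> will do.
\<close>

lemma three_energies:
  assumes z: "(x, flat A g x v) \<in> points S" and v: "v \<in> tangent_space A x" "v \<noteq> (\<lambda>_. 0)"
  shows "\<exists>z\<^sub>1\<in>points S. \<exists>z\<^sub>2\<in>points S. \<exists>z\<^sub>3\<in>points S. H z\<^sub>1 \<noteq> H z\<^sub>2 \<and> H z\<^sub>1 \<noteq> H z\<^sub>3 \<and> H z\<^sub>2 \<noteq> H z\<^sub>3"
proof -
  have x: "x \<in> points A"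
    using state_base[OF z] by simp
  let ?z = "\<lambda>t. (x, flat A g x (\<lambda>c. t *\<^sub>R v c))"
  have energy: "H (?z t) = t\<^sup>2 * g x v v / 2 + V x" for t
    using H_flat[OF x tangent_scale[OF v(1)], of t]
      metric_lincomb[OF x v(1) v(1) v(1), of t 0] metric_lincomb[OF x tangent_scale[OF v(1), of t] v(1) v(1), of t 0]
    by (simp add: power2_eq_square)
  have "g x v v \<noteq> 0"
    using metric_eq_0_imp[OF x v(1)] v(2) by blast
  then have "H (?z 0) \<noteq> H (?z 1)" "H (?z 0) \<noteq> H (?z 2)" "H (?z 1) \<noteq> H (?z 2)"
    unfolding energy by simp_all
  moreover have "?z t \<in> points S" for t
    by (rule state_scale[OF z v(1)])
  ultimately show ?thesis
    by blast
qed

text \<open>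
  What remains to be proved for either kind of system: conservation of energy, and that the controlled
  velocity vanishes at states at rest that are critical for the energy.
\<close>

lemma two_constants_of_motion:
  assumes opt: "optimal_system S U l X Bopt Y"
    and conserved: "\<And>B z. B \<in> U \<Longrightarrow> z \<in> points S \<Longrightarrow> differential S H z (X B z) = 0"
    and equilibrium: "\<And>B z. B \<in> U \<Longrightarrow> z \<in> points S \<Longrightarrow> fiber_deriv A H z = (\<lambda>_. 0) \<Longrightarrow>
      (\<And>w. w \<in> tangent_space S z \<Longrightarrow> differential S H z w = 0) \<Longrightarrow> X B z = (\<lambda>_. 0)"
    and moving: "(x, flat A g x v) \<in> points S" "v \<in> tangent_space A x" "v \<noteq> (\<lambda>_. 0)"
  shows "\<exists>E\<^sub>1 E\<^sub>2. constant_of_motion (cotangent_atlas S) Y E\<^sub>1 \<and>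
    constant_of_motion (cotangent_atlas S) Y E\<^sub>2 \<and>
    independent_modulo_constants (cotangent_atlas S) E\<^sub>1 E\<^sub>2 \<and>
    (\<forall>z\<in>points (cotangent_atlas S). X (Bopt z) (fst z) \<noteq> (\<lambda>_. 0) \<longrightarrow>
       functionally_independent_at (cotangent_atlas S) E\<^sub>1 E\<^sub>2 z)"
proof -
  have regular: "\<exists>w\<in>tangent_space S z. differential S H z w \<noteq> 0"
    if "B \<in> U" "z \<in> points S" "X B z \<noteq> (\<lambda>_. 0)" for B z
    using equilibrium[OF that(1,2)] critical_state_at_rest[OF that(2)] that(3) by blast
  obtain z\<^sub>1 z\<^sub>2 z\<^sub>3 where "z\<^sub>1 \<in> points S" "z\<^sub>2 \<in> points S" "z\<^sub>3 \<in> points S"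
    "H z\<^sub>1 \<noteq> H z\<^sub>2" "H z\<^sub>1 \<noteq> H z\<^sub>3" "H z\<^sub>2 \<noteq> H z\<^sub>3"
    using three_energies[OF moving] by blast
  from optimal_system.two_constants_of_motion[OF opt H_state_smooth conserved regular this]
  show ?thesis .
qed

end

section \<open>General systems\<close>

lemma optimal_systemI:
  assumes S: "smooth_atlas S" and X: "controlled_vector_fields S U X"
    and "optimal_control S U l X Bopt"
    and "smooth_fun (cotangent_atlas S) (optimal_hamiltonian U l X)"
    and "hamiltonian_vector_field S (optimal_hamiltonian U l X) Y"
  shows "optimal_system S U l X Bopt Y"
  using assms unfolding controlled_vector_fields_def vector_field_def
  by (intro optimal_system.intro optimal_system_axioms.intro) blast+

lemma (in natural_system) constrained_hamiltonianI:
  assumes "nonholonomic_system A H k D"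
  shows "constrained_hamiltonian A H g V k D"
  using assms unfolding nonholonomic_system_def
  by (intro constrained_hamiltonian.intro natural_system_axioms constrained_hamiltonian_axioms.intro) blast+

lemma natural_systemE:
  assumes "nonholonomic_system A H k D"
  obtains g V where "natural_system A H g V"
  using assms smooth_manifold_atlas[of A]
  unfolding nonholonomic_system_def natural_hamiltonian_def natural_system_def natural_system_axioms_def
  by blast

context smooth_atlas
begin

lemma closed_two_form_props:
  assumes \<beta>: "closed_two_form A \<beta>" and x: "x \<in> points A" and v: "v \<in> tangent_space A x"
  shows "covector_restrict A x (\<beta> x v) \<in> cotangent_space A x"
    and "\<beta> x v (\<lambda>_. 0) = 0" and "\<beta> x (\<lambda>_. 0) v = 0" and "\<beta> x v v = 0"
proof -
  show *: "covector_restrict A x (\<beta> x v) \<in> cotangent_space A x"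
    using assms unfolding closed_two_form_def smooth_tensor2_def by blast
  have alt: "\<beta> x v w = - \<beta> x w v" if "w \<in> tangent_space A x" for w
    using assms that unfolding closed_two_form_def by blast
  show 0: "\<beta> x v (\<lambda>_. 0) = 0"
    using cotangent_zero[OF *] tangent_zero by (simp add: covector_restrict_def)
  show "\<beta> x (\<lambda>_. 0) v = 0"
    using alt[OF tangent_zero] 0 by simp
  show "\<beta> x v v = 0"
    using alt[OF v] by simp
qed

end

text \<open>
  A state \<open>z\<close> of a general system, its controlled velocity \<open>X\<close> and the magnetic form \<open>\<beta>\<close> for one fixed control.
\<close>

locale magnetic_system = constrained_system A H g V k D S
  for A :: "('q, 'e::euclidean_space) atlas" and H g V k D
    and S :: "(('q, 'e) cotangent, 'd::euclidean_space) atlas" +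
  fixes z :: "('q, 'e) cotangent" and \<beta> :: "('q, 'e) tensor2" and X :: "(('q, 'e) cotangent, 'd) tvec"
  assumes z: "z \<in> points S" and \<beta>: "closed_two_form A \<beta>" and X: "X \<in> tangent_space S z"
    and motion: "annihilator_frame A k D W \<eta> \<Longrightarrow> fst z \<in> W \<Longrightarrow>
      \<exists>m :: nat \<Rightarrow> real. \<forall>w\<in>tangent_space (cotangent_atlas A) z.
        canonical_form A z (incl A S z X) w + \<beta> (fst z) (proj A z (incl A S z X)) (proj A z w) =
        differential (cotangent_atlas A) H z w + (\<Sum>i<k. m i * \<eta> i (fst z) (proj A z w))"
begin

abbreviation "c \<equiv> chart_at A (fst z)"
abbreviation "C \<equiv> cotangent_chart A c"

lemma base_chart: "c \<in> A" "fst z \<in> fst c"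
  using chart_at_props state_base[OF z] by metis+

lemmas lifted_chart = cotangent_chart_in[OF base_chart(1)] in_cotangent_chart[OF state_point[OF z] base_chart(2)]

lemma incl_in: "incl A S z X \<in> tangent_space (cotangent_atlas A) z"
  by (rule state.incl.tangent_map_in[OF z X])

lemma proj_in: "w \<in> tangent_space (cotangent_atlas A) z \<Longrightarrow> proj A z w \<in> tangent_space A (fst z)"
  by (rule smooth_map_between.tangent_map_in[OF cotangent_projection_map state_point[OF z]])

lemma proj_apply: "w \<in> tangent_space (cotangent_atlas A) z \<Longrightarrow> proj A z w c = fst (w C)"
  by (rule projection_apply[OF state_point[OF z] base_chart])

lemma differential_in_chart:
  assumes "w \<in> tangent_space (cotangent_atlas A) z"
  shows "differential (cotangent_atlas A) H z w =
    frechet_derivative (H \<circ> cinv C) (at (snd C z)) (w C)"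
  by (rule state.M.differential_chart[OF state.M.smooth_fun_differentiable[OF H_smooth lifted_chart] lifted_chart assms])

lemma constraint_kills:
  assumes "annihilator_frame A k D W \<eta>" "fst z \<in> W" "v \<in> D (fst z)"
  shows "(\<Sum>i<k. m i * \<eta> i (fst z) v) = 0"
  using assms unfolding annihilator_frame_def annihilator_basis_def by (intro sum.neutral) auto

lemma coordinate_lift:
  shows "coord_vec (cotangent_atlas A) C z u \<in> tangent_space (cotangent_atlas A) z"
    and "coord_vec (cotangent_atlas A) C z u C = u"
    and "proj A z (coord_vec (cotangent_atlas A) C z u) = coord_vec A c (fst z) (fst u)"
proof -
  show *: "coord_vec (cotangent_atlas A) C z u \<in> tangent_space (cotangent_atlas A) z"
    "coord_vec (cotangent_atlas A) C z u C = u"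
    by (rule state.M.coord_vec_in[OF lifted_chart] state.M.coord_vec_self[OF lifted_chart])+
  show "proj A z (coord_vec (cotangent_atlas A) C z u) = coord_vec A c (fst z) (fst u)"
    using proj_apply[OF *(1)] *(2) coord_vec_self[OF base_chart]
    by (intro tangent_eqI[OF proj_in[OF *(1)] coord_vec_in[OF base_chart] base_chart]) simp
qed

text \<open>
  Testing the equation of motion with vertical vectors removes the magnetic and the reaction forces
  and leaves \<open>dq/dt = \<partial>H/\<partial>p\<close>.
\<close>

lemma proj_velocity: "proj A z (incl A S z X) = fiber_deriv A H z"
proof -
  obtain W \<eta> where W: "annihilator_frame A k D W \<eta>" "fst z \<in> W"
    using frame_at state_base[OF z] by blast
  note x = state_base[OF z]
  let ?Z = "incl A S z X"
  have "fst (?Z C) \<bullet> r = fiber_deriv A H z c \<bullet> r" for r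
  proof -
    let ?w = "coord_vec (cotangent_atlas A) C z (0, r)"
    have p: "proj A z ?w = (\<lambda>_. 0)"
      using coordinate_lift(3) coord_vec_0[OF base_chart] by simp
    obtain m :: "nat \<Rightarrow> real" where
      "canonical_form A z ?Z ?w + \<beta> (fst z) (proj A z ?Z) (proj A z ?w) =
        differential (cotangent_atlas A) H z ?w + (\<Sum>i<k. m i * \<eta> i (fst z) (proj A z ?w))"
      using motion[OF W] coordinate_lift(1) by blast
    then have "canonical_form A z ?Z ?w = differential (cotangent_atlas A) H z ?w"
      unfolding p using closed_two_form_props(2)[OF \<beta> x proj_in[OF incl_in]]
        constraint_kills[OF W distribution_zero[OF x]] by simp
    then show ?thesis
      using differential_in_chart[OF coordinate_lift(1)] coordinate_lift(2) fiber_derivative_apply[OF base_chart state_point[OF z]]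
      by (simp add: canonical_form_def Let_def)
  qed
  then have "fst (?Z C) = fiber_deriv A H z c"
    by (metis vector_eq_rdot)
  then show ?thesis
    using proj_apply[OF incl_in]
    by (intro tangent_eqI[OF proj_in[OF incl_in] fiber_deriv_in[OF state_point[OF z]] base_chart]) simp
qed

text \<open>
  The equation of motion is evaluated on the velocity itself, which satisfies the constraints.
\<close>

lemma energy_conserved: "differential S H z X = 0"
proof -
  obtain W \<eta> where W: "annihilator_frame A k D W \<eta>" "fst z \<in> W"
    using frame_at state_base[OF z] by blast
  let ?Z = "incl A S z X"
  obtain m :: "nat \<Rightarrow> real" where
    "canonical_form A z ?Z ?Z + \<beta> (fst z) (proj A z ?Z) (proj A z ?Z) =
      differential (cotangent_atlas A) H z ?Z + (\<Sum>i<k. m i * \<eta> i (fst z) (proj A z ?Z))"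
    using motion[OF W] incl_in by blast
  moreover have "canonical_form A z ?Z ?Z = 0"
    by (simp add: canonical_form_def Let_def inner_commute)
  moreover have "\<beta> (fst z) (proj A z ?Z) (proj A z ?Z) = 0"
    by (rule closed_two_form_props(4)[OF \<beta> state_base[OF z] proj_in[OF incl_in]])
  moreover have "(\<Sum>i<k. m i * \<eta> i (fst z) (proj A z ?Z)) = 0"
    unfolding proj_velocity by (rule constraint_kills[OF W state_velocity[OF z]])
  ultimately show ?thesis
    using differential_state[OF z X] by simp
qed

end

context constrained_system
begin

text \<open>
  The zero section consists of states, which gives the horizontal derivatives of \<open>H\<close>; the vertical ones are
  the velocity.
\<close>

lemma state_differential_zero:
  assumes z: "z \<in> points S" and rest: "fiber_deriv A H z = (\<lambda>_. 0)"
    and crit: "\<And>w. w \<in> tangent_space S z \<Longrightarrow> differential S H z w = 0"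
    and zero_section: "\<And>x. x \<in> points A \<Longrightarrow> (x, flat A g x (\<lambda>_. 0)) \<in> points S"
    and c: "c \<in> A" "fst z \<in> fst c"
  shows "frechet_derivative (H \<circ> cinv (cotangent_chart A c)) (at (snd (cotangent_chart A c) z)) u = 0"
proof -
  let ?C = "cotangent_chart A c" and ?x = "fst z"
  let ?D = "frechet_derivative (H \<circ> cinv ?C) (at (snd ?C z))"
  note C = cotangent_chart_in[OF c(1)] in_cotangent_chart[OF state_point[OF z] c(2)]
  obtain a b where u: "u = (a, b)"
    by (cases u)
  have flat0: "momentum A c x (flat A g x (\<lambda>_. 0)) = 0" if "x \<in> fst c" for x
    using momentum_flat_lincomb[OF in_pointsI[OF c(1) that] tangent_zero tangent_zero c(1) that, of 0 0]
    by simp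
  have z0: "z = (?x, flat A g ?x (\<lambda>_. 0))"
    using state_flat[OF z] rest by simp
  let ?\<gamma> = "\<lambda>t::real. (snd c ?x + t *\<^sub>R a, 0 :: 'e)"
  have on: "?\<gamma> t \<in> snd ?C ` (fst ?C \<inter> points S)" if "snd c ?x + t *\<^sub>R a \<in> snd c ` fst c" for t
  proof -
    obtain y where y: "y \<in> fst c" "snd c ?x + t *\<^sub>R a = snd c y"
      using \<open>snd c ?x + t *\<^sub>R a \<in> snd c ` fst c\<close> by blast
    have yA: "y \<in> points A"
      by (rule in_pointsI[OF c(1) y(1)])
    have "(y, flat A g y (\<lambda>_. 0)) \<in> fst ?C"
      using y(1) flat_in[OF yA tangent_zero] by simp
    moreover have "snd ?C (y, flat A g y (\<lambda>_. 0)) = ?\<gamma> t"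
      using y flat0 by simp
    ultimately show ?thesis
      using zero_section[OF yA] by (metis IntI imageI)
  qed
  have "((\<lambda>t::real. snd c ?x + t *\<^sub>R a) \<longlongrightarrow> snd c ?x + 0 *\<^sub>R a) (nhds 0)"
    by (intro tendsto_add tendsto_const tendsto_scaleR filterlim_ident)
  then have "\<forall>\<^sub>F t in nhds 0. snd c ?x + t *\<^sub>R a \<in> snd c ` fst c"
    using chart_open[OF c(1)] c(2) by (intro topological_tendstoD) auto
  then have "\<forall>\<^sub>F t in nhds 0. ?\<gamma> t \<in> snd ?C ` (fst ?C \<inter> points S)"
    by (rule eventually_mono) (rule on)
  moreover have "(?\<gamma> has_vector_derivative (a, 0)) (at 0)"
    unfolding has_vector_derivative_def by (auto intro!: derivative_eq_intros)
  moreover have "?\<gamma> 0 = snd ?C z"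
    by (subst z0) (simp add: flat0[OF c(2)])
  ultimately have "?D (a, 0) = 0"
    using curve_differential[OF z c crit] by blast
  moreover have "?D (0, b) = 0"
    using fiber_derivative_apply[OF c state_point[OF z]] rest by simp
  ultimately show ?thesis
    using linear_add[OF linear_frechet_derivative[OF state.M.smooth_fun_differentiable[OF H_smooth C]],
        of "(a, 0)" "(0, b)"] u by simp
qed

end

text \<open>
  With zero velocity there is no magnetic force, and \<open>dH = 0\<close>; so \<open>X\<close> is vertical and equal to a reaction
  force.
\<close>

lemma (in magnetic_system) equilibrium:
  assumes rest: "fiber_deriv A H z = (\<lambda>_. 0)"
    and crit: "\<And>w. w \<in> tangent_space S z \<Longrightarrow> differential S H z w = 0"
    and zero_section: "\<And>x. x \<in> points A \<Longrightarrow> (x, flat A g x (\<lambda>_. 0)) \<in> points S"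
  shows "X = (\<lambda>_. 0)"
proof (rule vertical_reaction_vanishes[OF z X base_chart rest])
  let ?Z = "incl A S z X"
  note x = state_base[OF z]
  have Z: "fst (?Z C) = 0"
    using proj_apply[OF incl_in] proj_velocity rest by simp
  then show "incl A S z X C = (0, snd (?Z C))"
    by (simp add: prod_eq_iff)
  fix d
  assume d: "d \<in> D (fst z)"
  obtain W \<eta> where W: "annihilator_frame A k D W \<eta>" "fst z \<in> W"
    using frame_at x by blast
  let ?w = "coord_vec (cotangent_atlas A) C z (d c, 0)"
  have p: "proj A z ?w = d"
    using coordinate_lift(3) tangent_eq_coord_vec[OF distribution_tangent[OF x d] base_chart] by simp
  obtain m :: "nat \<Rightarrow> real" where
    "canonical_form A z ?Z ?w + \<beta> (fst z) (proj A z ?Z) (proj A z ?w) =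
      differential (cotangent_atlas A) H z ?w + (\<Sum>i<k. m i * \<eta> i (fst z) (proj A z ?w))"
    using motion[OF W] coordinate_lift(1) by blast
  then have "canonical_form A z ?Z ?w = 0"
    unfolding p proj_velocity rest
    using closed_two_form_props(3)[OF \<beta> x distribution_tangent[OF x d]] constraint_kills[OF W d]
      differential_in_chart[OF coordinate_lift(1)] state_differential_zero[OF z rest crit zero_section base_chart] by simp
  then show "snd (?Z C) \<bullet> d c = 0"
    using coordinate_lift(2) Z by (simp add: canonical_form_def Let_def inner_commute)
qed

lemma general_constants_of_motion:
  assumes sys: "magnetic_nonholonomic_general A H k D U \<beta> S X"
    and opt: "optimal_control S U l X Bopt"
    and smooth: "smooth_fun (cotangent_atlas S) (optimal_hamiltonian U l X)"
    and Y: "hamiltonian_vector_field S (optimal_hamiltonian U l X) Y"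
  shows "\<exists>E\<^sub>1 E\<^sub>2. constant_of_motion (cotangent_atlas S) Y E\<^sub>1 \<and>
    constant_of_motion (cotangent_atlas S) Y E\<^sub>2 \<and>
    independent_modulo_constants (cotangent_atlas S) E\<^sub>1 E\<^sub>2 \<and>
    (\<forall>z\<in>points (cotangent_atlas S). X (Bopt z) (fst z) \<noteq> (\<lambda>_. 0) \<longrightarrow>
       functionally_independent_at (cotangent_atlas S) E\<^sub>1 E\<^sub>2 z)"
proof -
  have nh: "nonholonomic_system A H k D" and forms: "control_forms A U \<beta>"
    and emb: "embedded_submanifold (cotangent_atlas A) S" and pts: "points S = constraint_space A H D"
    and ctrl: "controlled_vector_fields S U X"
    using sys unfolding magnetic_nonholonomic_general_def by - (elim conjE, assumption)+
  have motion: "\<exists>m :: nat \<Rightarrow> real. \<forall>w\<in>tangent_space (cotangent_atlas A) z.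
        canonical_form A z (incl A S z (X B z)) w + \<beta> B (fst z) (proj A z (incl A S z (X B z))) (proj A z w) =
        differential (cotangent_atlas A) H z w + (\<Sum>i<k. m i * \<eta> i (fst z) (proj A z w))"
    if "B \<in> U" "z \<in> points S" "annihilator_frame A k D W \<eta>" "fst z \<in> W" for B z W \<eta>
    by (rule sys[unfolded magnetic_nonholonomic_general_def, THEN conjunct2, THEN conjunct2,
          THEN conjunct2, THEN conjunct2, THEN conjunct2, rule_format, OF that(1,2) conjI[OF that(3,4)]])
  obtain g V where "natural_system A H g V"
    using nh by (rule natural_systemE)
  then interpret constrained_hamiltonian A H g V k D
    using nh by (rule natural_system.constrained_hamiltonianI)
  have S_iff: "(x, flat A g x v) \<in> points S \<longleftrightarrow> v \<in> D x" if "x \<in> points A" "v \<in> tangent_space A x" for x v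
    using that flat_in fiber_deriv_flat by (simp add: pts constraint_space_def points_cotangent_atlas)
  interpret constrained_system A H g V k D S
  proof
    fix x v r
    assume xv: "(x, flat A g x v) \<in> points S" and v: "v \<in> tangent_space A x"
    then have x: "x \<in> points A"
      by (simp add: pts constraint_space_def points_cotangent_atlas)
    show "(x, flat A g x (\<lambda>c. r *\<^sub>R v c)) \<in> points S"
      using S_iff[OF x v] S_iff[OF x tangent_scale[OF v]] xv distribution_scale[OF x] by blast
  qed (auto simp: pts constraint_space_def emb)
  have zero_section: "(x, flat A g x (\<lambda>_. 0)) \<in> points S" if "x \<in> points A" for x
    using S_iff[OF that tangent_zero] distribution_zero[OF that] by blast
  have magnetic: "magnetic_system A H g V k D S z (\<beta> B) (X B z)" if "B \<in> U" "z \<in> points S" for B z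
    using that forms ctrl motion[OF that]
    unfolding control_forms_def controlled_vector_fields_def vector_field_def
    by (intro magnetic_system.intro magnetic_system_axioms.intro constrained_system_axioms) blast+
  \<comment> \<open>An empty configuration space would make every distribution integrable.\<close>
  have "points A \<noteq> {}"
  proof
    assume "points A = {}"
    then have "integrable_distribution A k D"
      by (simp add: integrable_distribution_def)
    then show False
      using nh by (simp add: nonholonomic_system_def)
  qed
  then obtain x where x: "x \<in> points A"
    by blast
  then obtain v where v: "v \<in> D x" "v \<noteq> (\<lambda>_. 0)"
    using distribution_nonzero by blast
  have moving: "(x, flat A g x v) \<in> points S"
    using S_iff[OF x distribution_tangent[OF x v(1)]] v by blast
  show ?thesis
  proof (rule two_constants_of_motion[OF _ _ _ moving distribution_tangent[OF x v(1)] v(2)])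
    show "optimal_system S U l X Bopt Y"
      by (rule optimal_systemI[OF state.S.smooth_atlas_axioms ctrl opt smooth Y])
    show "differential S H z (X B z) = 0" if "B \<in> U" "z \<in> points S" for B z
      by (rule magnetic_system.energy_conserved[OF magnetic[OF that]])
    show "X B z = (\<lambda>_. 0)" if "B \<in> U" "z \<in> points S" "fiber_deriv A H z = (\<lambda>_. 0)"
      "\<And>w. w \<in> tangent_space S z \<Longrightarrow> differential S H z w = 0" for B z
      by (rule magnetic_system.equilibrium[OF magnetic[OF that(1,2)] that(3,4) zero_section])
  qed
qed

section \<open>The bracket of vector fields\<close>

context smooth_atlas
begin

text \<open>
  In a new chart each of the two terms of the bracket acquires a second derivative of the transition map,
  evaluated on \<open>X\<close> and \<open>Y\<close>. These additional terms cancel by symmetry.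
\<close>

lemma bracket_in:
  assumes X: "\<And>y. y \<in> points A \<Longrightarrow> X y \<in> tangent_space A y"
    and Y: "\<And>y. y \<in> points A \<Longrightarrow> Y y \<in> tangent_space A y"
    and dX: "\<And>c. c \<in> A \<Longrightarrow> x \<in> fst c \<Longrightarrow> (\<lambda>u. X (cinv c u) c) differentiable (at (snd c x))"
    and dY: "\<And>c. c \<in> A \<Longrightarrow> x \<in> fst c \<Longrightarrow> (\<lambda>u. Y (cinv c u) c) differentiable (at (snd c x))"
  shows "vector_field_bracket A X Y x \<in> tangent_space A x"
proof (rule tangent_spaceI)
  fix c d
  assume c: "c \<in> A" and d: "d \<in> A" and xc: "x \<in> fst c" and xd: "x \<in> fst d"
  have x: "x \<in> points A"
    by (rule in_pointsI[OF c xc])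
  let ?u = "snd c x" and ?N = "snd c ` (fst c \<inter> fst d)" and ?\<phi> = "snd d \<circ> cinv c"
  let ?\<phi>' = "frechet_derivative ?\<phi> (at ?u)"
  have u: "?u \<in> ?N"
    using xc xd by blast
  note \<phi> = transition_smooth[OF c d]
  have push: "frechet_derivative (\<lambda>u. Z (cinv d u) d) (at (snd d x)) (W x d) =
      frechet_derivative (\<lambda>u. frechet_derivative ?\<phi> (at u) (Z x c)) (at ?u) (W x c) +
      ?\<phi>' (frechet_derivative (\<lambda>u. Z (cinv c u) c) (at ?u) (W x c))"
    if Z: "\<And>y. y \<in> points A \<Longrightarrow> Z y \<in> tangent_space A y"
      and dZ: "\<And>c. c \<in> A \<Longrightarrow> x \<in> fst c \<Longrightarrow> (\<lambda>u. Z (cinv c u) c) differentiable (at (snd c x))"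
      and W: "W x \<in> tangent_space A x" for Z W
  proof -
    let ?y = "\<lambda>u. Z (cinv c u) c"
    have "frechet_derivative ((\<lambda>y. Z y d) \<circ> cinv c) (at ?u) (W x c) =
        frechet_derivative ((\<lambda>y. Z y d) \<circ> cinv d) (at (snd d x)) (?\<phi>' (W x c))"
      using dZ[OF d xd] by (intro change_chart(2)[OF c xc d xd]) (simp add: o_def)
    then have "frechet_derivative (\<lambda>u. Z (cinv d u) d) (at (snd d x)) (W x d) =
        frechet_derivative (\<lambda>u. Z (cinv c u) d) (at ?u) (W x c)"
      using tangent_transform[OF W c d xc xd] by (simp add: o_def)
    also have "frechet_derivative (\<lambda>u. Z (cinv c u) d) (at ?u) =
        frechet_derivative (\<lambda>u. frechet_derivative ?\<phi> (at u) (?y u)) (at ?u)"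
    proof (rule frechet_derivative_agree(2)[OF overlap_open[OF c d] u])
      fix v
      assume "v \<in> ?N"
      note v = image_Int_cinv[OF c this]
      show "Z (cinv c v) d = frechet_derivative ?\<phi> (at v) (?y v)"
        using tangent_transform[OF Z[OF in_pointsI[OF c v(1)]] c d v(1,2)] v(3) by simp
    qed (rule frechet_derivative_leibniz(1)[OF \<phi> overlap_open[OF c d] u dZ[OF c xc]])
    also have "\<dots> (W x c) = frechet_derivative (\<lambda>u. frechet_derivative ?\<phi> (at u) (?y ?u)) (at ?u) (W x c) +
        ?\<phi>' (frechet_derivative ?y (at ?u) (W x c))"
      by (rule frechet_derivative_leibniz(2)[OF \<phi> overlap_open[OF c d] u dZ[OF c xc]])
    finally show ?thesis
      by (simp only: cinv_chart[OF c xc])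
  qed
  have "frechet_derivative (\<lambda>u. frechet_derivative ?\<phi> (at u) (Y x c)) (at ?u) (X x c) =
      frechet_derivative (\<lambda>u. frechet_derivative ?\<phi> (at u) (X x c)) (at ?u) (Y x c)"
    by (rule second_derivative_symmetric[OF \<phi> overlap_open[OF c d] u])
  then show "vector_field_bracket A X Y x d = ?\<phi>' (vector_field_bracket A X Y x c)"
    using push[of Y X, OF Y dY X[OF x]] push[of X Y, OF X dX Y[OF x]] c d xc xd
    by (simp add: vector_field_bracket_def linear_diff[OF transition_linear[OF c xc d xd]])
qed (simp add: vector_field_bracket_def if_not_P)

end

section \<open>The coadjoint operator\<close>

locale lie_group_atlas = smooth_atlas A
  for G :: "'m monoid" and A :: "('m, 'e::euclidean_space) atlas" +
  assumes lie: "lie_group G A"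
begin

lemma group: "group G" and carrier: "points A = carrier G"
  using lie by (simp_all add: lie_group_def)

lemma one_point: "\<one>\<^bsub>G\<^esub> \<in> points A"
  using group.is_monoid[OF group] carrier by (simp add: monoid.one_closed)

lemma mult_closed: "x \<in> points A \<Longrightarrow> y \<in> points A \<Longrightarrow> x \<otimes>\<^bsub>G\<^esub> y \<in> points A"
  using group.is_monoid[OF group] carrier by (simp add: monoid.m_closed)

lemma mult_one: "x \<in> points A \<Longrightarrow> x \<otimes>\<^bsub>G\<^esub> \<one>\<^bsub>G\<^esub> = x"
  using group.is_monoid[OF group] carrier by (simp add: monoid.r_one)

text \<open>
  The coordinate domain and the coordinate expression of the group multiplication, with charts \<open>c\<close> and \<open>d\<close>
  for the factors and \<open>e\<close> for the product.
\<close>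

definition mult_domain :: "('m, 'e) chart \<Rightarrow> ('m, 'e) chart \<Rightarrow> ('m, 'e) chart \<Rightarrow> ('e \<times> 'e) set" where
  "mult_domain c d e = {(snd c x, snd d y) | x y. x \<in> fst c \<and> y \<in> fst d \<and> x \<otimes>\<^bsub>G\<^esub> y \<in> fst e}"

definition mult_map :: "('m, 'e) chart \<Rightarrow> ('m, 'e) chart \<Rightarrow> ('m, 'e) chart \<Rightarrow> 'e \<times> 'e \<Rightarrow> 'e" where
  "mult_map c d e u = snd e (cinv c (fst u) \<otimes>\<^bsub>G\<^esub> cinv d (snd u))"

lemma mult_smooth:
  assumes c: "c \<in> A" and d: "d \<in> A" and e: "e \<in> A"
  shows "open (mult_domain c d e)" "smooth_on (mult_domain c d e) (mult_map c d e)"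
proof -
  let ?P = "(fst c \<times> fst d, map_prod (snd c) (snd d))"
  let ?m = "\<lambda>(x, y). x \<otimes>\<^bsub>G\<^esub> y"
  let ?N = "snd ?P ` (fst ?P \<inter> ?m -` fst e)"
  have P: "?P \<in> prod_atlas A A"
    unfolding prod_atlas_def using c d by blast
  have N: "?N = mult_domain c d e"
    by (auto simp: mult_domain_def image_iff)
  have sm: "smooth_map (prod_atlas A A) A ?m"
    using lie by (simp add: lie_group_def)
  then have smP: "open ?N \<and> smooth_on ?N (snd e \<circ> ?m \<circ> cinv ?P)"
    unfolding smooth_map_def using P e by blast
  then show O: "open (mult_domain c d e)"
    by (simp only: N)
  have inj: "inj_on (snd ?P) (fst ?P)"
    using chart_inj[OF c] chart_inj[OF d] by (auto simp: inj_on_def)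
  have "(snd e \<circ> ?m \<circ> cinv ?P) u = mult_map c d e u" if "u \<in> mult_domain c d e" for u
  proof -
    obtain x y where u: "u = (snd c x, snd d y)" "x \<in> fst c" "y \<in> fst d"
      using \<open>u \<in> mult_domain c d e\<close> by (auto simp: mult_domain_def)
    have "cinv ?P (snd ?P (x, y)) = (x, y)"
      unfolding cinv_def by (rule inv_into_f_f[OF inj]) (use u in auto)
    then show ?thesis
      using u cinv_chart[OF c] cinv_chart[OF d] by (simp add: mult_map_def)
  qed
  then show "smooth_on (mult_domain c d e) (mult_map c d e)"
    using smP O unfolding N by (blast intro: smooth_on_cong)
qed

text \<open>
  In coordinates a left translation is the multiplication with the first argument fixed.
\<close>

lemma left_translation_local:
  assumes x: "x \<in> fst c" and c: "c \<in> A" and d: "d \<in> A" and e: "e \<in> A"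
  defines "N \<equiv> snd d ` (fst d \<inter> (\<lambda>y. x \<otimes>\<^bsub>G\<^esub> y) -` fst e)"
  shows "N = (\<lambda>u. (snd c x, u)) -` mult_domain c d e"
    and "open N"
    and "u \<in> N \<Longrightarrow> (snd e \<circ> (\<lambda>y. x \<otimes>\<^bsub>G\<^esub> y) \<circ> cinv d) u = mult_map c d e (snd c x, u)"
proof -
  have "(snd c x, u) \<in> mult_domain c d e \<longleftrightarrow> u \<in> N" for u
    using x inj_onD[OF chart_inj[OF c]] unfolding N_def mult_domain_def by blast
  then show N: "N = (\<lambda>u. (snd c x, u)) -` mult_domain c d e"
    by blast
  show "open N"
    unfolding N by (rule open_vimage[OF mult_smooth(1)[OF c d e]]) (intro continuous_intros)
  show "(snd e \<circ> (\<lambda>y. x \<otimes>\<^bsub>G\<^esub> y) \<circ> cinv d) u = mult_map c d e (snd c x, u)"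
    using cinv_chart[OF c x] by (simp add: mult_map_def)
qed

lemma left_translation_map:
  assumes x: "x \<in> points A"
  shows "smooth_map_between A A (\<lambda>y. x \<otimes>\<^bsub>G\<^esub> y)"
proof (intro smooth_map_between.intro smooth_atlas_axioms smooth_map_between_axioms.intro)
  obtain c where c: "c \<in> A" "x \<in> fst c"
    using chart_at_props x by metis
  have "smooth_on (snd d ` (fst d \<inter> (\<lambda>y. x \<otimes>\<^bsub>G\<^esub> y) -` fst e)) (snd e \<circ> (\<lambda>y. x \<otimes>\<^bsub>G\<^esub> y) \<circ> cinv d)"
    if d: "d \<in> A" and e: "e \<in> A" for d e
  proof -
    let ?N = "snd d ` (fst d \<inter> (\<lambda>y. x \<otimes>\<^bsub>G\<^esub> y) -` fst e)"
    note loc = left_translation_local[OF c(2,1) d e]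
    have "smooth_on ?N (\<lambda>u. mult_map c d e (snd c x, u))"
      using loc(1) by (intro smooth_on_compose[OF loc(2) _ mult_smooth(2)[OF c(1) d e]]
          smooth_on_Pair loc(2) smooth_on_const smooth_on_id) auto
    then show ?thesis
      by (rule smooth_on_cong[OF loc(2), rotated]) (rule loc(3)[symmetric])
  qed
  then show "smooth_map A A (\<lambda>y. x \<otimes>\<^bsub>G\<^esub> y)"
    unfolding smooth_map_def using left_translation_local(2)[OF c(2,1)] mult_closed[OF x] by blast
qed

abbreviation left_field :: "('m, 'e) tvec \<Rightarrow> 'm \<Rightarrow> ('m, 'e) tvec" where
  "left_field \<zeta> \<equiv> \<lambda>x. left_translate G A x \<one>\<^bsub>G\<^esub> \<zeta>"

lemma left_field_in:
  assumes "x \<in> points A" "\<zeta> \<in> tangent_space A \<one>\<^bsub>G\<^esub>"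
  shows "left_field \<zeta> x \<in> tangent_space A x"
  using smooth_map_between.tangent_map_in[OF left_translation_map[OF assms(1)] one_point assms(2)]
    mult_one[OF assms(1)] by simp

lemma left_field_lincomb:
  assumes "x \<in> points A" "\<zeta> \<in> tangent_space A \<one>\<^bsub>G\<^esub>" "\<xi> \<in> tangent_space A \<one>\<^bsub>G\<^esub>"
  shows "left_field (\<lambda>c. r *\<^sub>R \<zeta> c + s *\<^sub>R \<xi> c) x = (\<lambda>c. r *\<^sub>R left_field \<zeta> x c + s *\<^sub>R left_field \<xi> x c)"
  by (rule smooth_map_between.tangent_map_lincomb[OF left_translation_map[OF assms(1)] one_point assms(2,3)])

text \<open>
  The left-invariant field is the partial derivative of the multiplication with respect to the second
  factor at the identity, as a function of the first factor.
\<close>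

lemma left_field_smooth:
  assumes \<zeta>: "\<zeta> \<in> tangent_space A \<one>\<^bsub>G\<^esub>" and c: "c \<in> A"
  shows "smooth_on (snd c ` fst c) (\<lambda>u. left_field \<zeta> (cinv c u) c)"
proof -
  obtain d where d: "d \<in> A" "\<one>\<^bsub>G\<^esub> \<in> fst d"
    using chart_at_props one_point by metis
  let ?F = "mult_map c d c" and ?u1 = "snd d \<one>\<^bsub>G\<^esub>" and ?N = "mult_domain c d c"
  note F = mult_smooth[OF c d(1) c]
  have inN: "(u, ?u1) \<in> ?N" if "u \<in> snd c ` fst c" for u
    using that d(2) mult_one in_pointsI[OF c] unfolding mult_domain_def by fastforce
  show ?thesis
  proof (rule smooth_on_cong[OF chart_open[OF c]])
    show "smooth_on (snd c ` fst c) (\<lambda>u. frechet_derivative ?F (at (u, ?u1)) (0, \<zeta> d))"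
      using inN by (intro smooth_on_frechet_derivative_apply[OF chart_open[OF c] F(2)]
          smooth_on_Pair chart_open c smooth_on_const smooth_on_id) auto
    fix u
    assume u: "u \<in> snd c ` fst c"
    let ?x = "cinv c u"
    note x = cinv_in[OF u] chart_cinv[OF u]
    have xA: "?x \<in> points A"
      by (rule in_pointsI[OF c x(1)])
    have x1: "?x \<otimes>\<^bsub>G\<^esub> \<one>\<^bsub>G\<^esub> \<in> fst c"
      using mult_one[OF xA] x(1) by simp
    interpret t: smooth_map_between A A "\<lambda>y. ?x \<otimes>\<^bsub>G\<^esub> y"
      by (rule left_translation_map[OF xA])
    note loc = left_translation_local[OF x(1) c d(1) c]
    have pair: "((\<lambda>y. (u, y)) has_derivative (\<lambda>h. (0, h))) (at ?u1)"
      by (auto intro!: derivative_eq_intros)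
    have DF: "(?F has_derivative frechet_derivative ?F (at (u, ?u1))) (at (u, ?u1))"
      by (rule frechet_derivative_worksI[OF smooth_on_imp_differentiable[OF F(2) inN[OF u]]])
    have D: "((\<lambda>y. ?F (u, y)) has_derivative (\<lambda>h. frechet_derivative ?F (at (u, ?u1)) (0, h))) (at ?u1)"
      by (rule has_derivative_compose[OF pair DF])
    have "frechet_derivative (snd c \<circ> (\<lambda>y. ?x \<otimes>\<^bsub>G\<^esub> y) \<circ> cinv d) (at ?u1) =
        frechet_derivative (\<lambda>y. ?F (u, y)) (at ?u1)"
    proof (rule frechet_derivative_agree(2)[OF loc(2)])
      show "?u1 \<in> snd d ` (fst d \<inter> (\<lambda>y. ?x \<otimes>\<^bsub>G\<^esub> y) -` fst c)"
        using d(2) x1 by blast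
      show "(snd c \<circ> (\<lambda>y. ?x \<otimes>\<^bsub>G\<^esub> y) \<circ> cinv d) y = ?F (u, y)"
        if "y \<in> snd d ` (fst d \<inter> (\<lambda>y. ?x \<otimes>\<^bsub>G\<^esub> y) -` fst c)" for y
        using loc(3)[OF that] x(2) by simp
      show "(\<lambda>y. ?F (u, y)) differentiable (at ?u1)"
        using D by (rule differentiableI)
    qed
    then show "frechet_derivative ?F (at (u, ?u1)) (0, \<zeta> d) = left_field \<zeta> ?x c"
      using t.tangent_map_chart[OF d c x1 \<zeta>] frechet_derivative_at[OF D] by metis
  qed
qed

lemma left_field_differentiable:
  assumes "\<zeta> \<in> tangent_space A \<one>\<^bsub>G\<^esub>" "c \<in> A" "x \<in> fst c"
  shows "(\<lambda>u. left_field \<zeta> (cinv c u) c) differentiable (at (snd c x))"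
  by (rule smooth_on_imp_differentiable[OF left_field_smooth[OF assms(1,2)]]) (use assms(3) in blast)

lemma lie_bracket_in:
  assumes "\<xi> \<in> tangent_space A \<one>\<^bsub>G\<^esub>" "\<zeta> \<in> tangent_space A \<one>\<^bsub>G\<^esub>"
  shows "lie_bracket G A \<xi> \<zeta> \<in> tangent_space A \<one>\<^bsub>G\<^esub>"
  unfolding lie_bracket_def
  by (intro bracket_in left_field_in left_field_differentiable assms)

lemma lie_bracket_self: "lie_bracket G A \<xi> \<xi> = (\<lambda>_. 0)"
  by (simp add: lie_bracket_def vector_field_bracket_def fun_eq_iff)

lemma lie_bracket_lincomb:
  assumes \<xi>: "\<xi> \<in> tangent_space A \<one>\<^bsub>G\<^esub>" and v: "v \<in> tangent_space A \<one>\<^bsub>G\<^esub>" and w: "w \<in> tangent_space A \<one>\<^bsub>G\<^esub>"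
  shows "lie_bracket G A \<xi> (\<lambda>c. r *\<^sub>R v c + s *\<^sub>R w c) =
    (\<lambda>c. r *\<^sub>R lie_bracket G A \<xi> v c + s *\<^sub>R lie_bracket G A \<xi> w c)"
proof -
  obtain c where c: "c \<in> A" "\<one>\<^bsub>G\<^esub> \<in> fst c"
    using chart_at_props one_point by metis
  let ?u = "snd c \<one>\<^bsub>G\<^esub>" and ?vw = "\<lambda>c. r *\<^sub>R v c + s *\<^sub>R w c"
  let ?D = "\<lambda>\<zeta>. frechet_derivative (\<lambda>u. left_field \<zeta> (cinv c u) c) (at ?u)"
  note vw = tangent_lincomb[OF v w, of r s]
  note diff = left_field_differentiable[OF _ c]
  have "((\<lambda>u. r *\<^sub>R left_field v (cinv c u) c + s *\<^sub>R left_field w (cinv c u) c) has_derivative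
      (\<lambda>h. r *\<^sub>R ?D v h + s *\<^sub>R ?D w h)) (at ?u)"
    by (intro has_derivative_add has_derivative_scaleR_right frechet_derivative_worksI diff v w)
  then have "((\<lambda>u. left_field ?vw (cinv c u) c) has_derivative (\<lambda>h. r *\<^sub>R ?D v h + s *\<^sub>R ?D w h)) (at ?u)"
    by (rule has_derivative_transform_within_open[OF _ chart_open[OF c(1)]])
      (use c left_field_lincomb[OF in_pointsI[OF c(1) cinv_in] v w] in auto)
  then have D: "?D ?vw = (\<lambda>h. r *\<^sub>R ?D v h + s *\<^sub>R ?D w h)"
    by (rule frechet_derivative_at[symmetric])
  show ?thesis
  proof (rule tangent_eqI[OF lie_bracket_in[OF \<xi> vw] tangent_lincomb[OF lie_bracket_in[OF \<xi> v] lie_bracket_in[OF \<xi> w]] c])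
    show "lie_bracket G A \<xi> ?vw c = r *\<^sub>R lie_bracket G A \<xi> v c + s *\<^sub>R lie_bracket G A \<xi> w c"
      using c fun_cong[OF left_field_lincomb[OF one_point v w]] linear_frechet_derivative[OF diff[OF \<xi>]]
      by (simp add: lie_bracket_def vector_field_bracket_def D linear_add linear_scale algebra_simps)
  qed
qed

text \<open>
  A covector is linear on tangent vectors only, so both the linearity of the bracket and its tangency are
  needed here.
\<close>

lemma ad_star_in:
  assumes \<xi>: "\<xi> \<in> tangent_space A \<one>\<^bsub>G\<^esub>" and \<mu>: "\<mu> \<in> cotangent_space A \<one>\<^bsub>G\<^esub>"
  shows "ad_star G A \<xi> \<mu> \<in> cotangent_space A \<one>\<^bsub>G\<^esub>"
  unfolding ad_star_def
  by (rule covector_restrict_in)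
    (simp add: lie_bracket_lincomb[OF \<xi>] cotangent_lincomb[OF \<mu>] lie_bracket_in[OF \<xi>])

lemma ad_star_self:
  assumes "\<mu> \<in> cotangent_space A \<one>\<^bsub>G\<^esub>"
  shows "ad_star G A \<xi> \<mu> \<xi> = 0"
  using cotangent_zero[OF assms] by (simp add: ad_star_def covector_restrict_def lie_bracket_self)

lemma ad_star_zero: "ad_star G A \<xi> (\<lambda>_. 0) \<zeta> = 0"
  by (simp add: ad_star_def covector_restrict_def)

end

section \<open>Reduced systems\<close>

text \<open>
  The velocity is the vertical lift of a force \<open>\<nu>\<close> whose three parts all annihilate \<open>dh\<close>: the coadjoint part by
  \<open>[dh, dh] = 0\<close>, the magnetic part because \<open>\<beta>\<close> alternates, and the reactions because \<open>dh\<close> lies in \<open>D\<close>. At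
  rest the momentum is zero, so the first two parts vanish and \<open>\<nu>\<close> is a reaction force.
\<close>

lemma reduced_constants_of_motion:
  assumes sys: "magnetic_nonholonomic_reduced G A H k D U \<beta> S X"
    and opt: "optimal_control S U l X Bopt"
    and smooth: "smooth_fun (cotangent_atlas S) (optimal_hamiltonian U l X)"
    and Y: "hamiltonian_vector_field S (optimal_hamiltonian U l X) Y"
  shows "\<exists>E\<^sub>1 E\<^sub>2. constant_of_motion (cotangent_atlas S) Y E\<^sub>1 \<and>
    constant_of_motion (cotangent_atlas S) Y E\<^sub>2 \<and>
    independent_modulo_constants (cotangent_atlas S) E\<^sub>1 E\<^sub>2 \<and>
    (\<forall>z\<in>points (cotangent_atlas S). X (Bopt z) (fst z) \<noteq> (\<lambda>_. 0) \<longrightarrow>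
       functionally_independent_at (cotangent_atlas S) E\<^sub>1 E\<^sub>2 z)"
proof -
  have lie: "lie_group G A" and nh: "nonholonomic_system A H k D" and forms: "control_forms A U \<beta>"
    and emb: "embedded_submanifold (cotangent_atlas A) S"
    and pts: "points S = {(x, \<mu>). x = \<one>\<^bsub>G\<^esub> \<and> \<mu> \<in> cotangent_space A x \<and> fiber_deriv A H (x, \<mu>) \<in> D x}"
    and ctrl: "controlled_vector_fields S U X"
    and motion: "\<forall>B\<in>U. \<forall>\<mu>. (\<one>\<^bsub>G\<^esub>, \<mu>) \<in> points S \<longrightarrow>
        (\<forall>\<eta>. annihilator_basis A k D \<one>\<^bsub>G\<^esub> \<eta> \<longrightarrow>
          (\<exists>m :: nat \<Rightarrow> real. let z = (\<one>\<^bsub>G\<^esub>, \<mu>); dh = fiber_deriv A H z in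
             incl A S z (X B z) = vertical_lift A z (\<lambda>v. ad_star G A dh \<mu> v +
               covector_restrict A \<one>\<^bsub>G\<^esub> (\<beta> B \<one>\<^bsub>G\<^esub> dh) v + (\<Sum>i<k. m i * \<eta> i v))))"
    using sys unfolding magnetic_nonholonomic_reduced_def by - (elim conjE, assumption)+
  obtain g V where "natural_system A H g V"
    using nh by (rule natural_systemE)
  then interpret constrained_hamiltonian A H g V k D
    using nh by (rule natural_system.constrained_hamiltonianI)
  interpret L: lie_group_atlas G A
    using lie by unfold_locales
  let ?e = "\<one>\<^bsub>G\<^esub>"
  note e = L.one_point
  have S_iff: "(x, flat A g x v) \<in> points S \<longleftrightarrow> x = ?e \<and> v \<in> D ?e"
    if "v \<in> tangent_space A x" for x v
    using that flat_in[OF e] fiber_deriv_flat[OF e] by (auto simp: pts)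
  interpret constrained_system A H g V k D S
  proof
    fix x v r
    assume xv: "(x, flat A g x v) \<in> points S" and v: "v \<in> tangent_space A x"
    show "(x, flat A g x (\<lambda>c. r *\<^sub>R v c)) \<in> points S"
      using S_iff[OF v] S_iff[OF tangent_scale[OF v]] xv distribution_scale[OF e] by blast
  qed (use e in \<open>auto simp: pts emb points_cotangent_atlas\<close>)
  obtain \<eta> where \<eta>: "annihilator_basis A k D ?e \<eta>"
    using basis_at[OF e] by blast
  obtain c where c: "c \<in> A" "?e \<in> fst c"
    using chart_at_props e by metis
  let ?C = "cotangent_chart A c"
  have X_in: "X B z \<in> tangent_space S z" if "B \<in> U" "z \<in> points S" for B z
    using ctrl that unfolding controlled_vector_fields_def vector_field_def by blast
  have \<beta>: "closed_two_form A (\<beta> B)" if "B \<in> U" for B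
    using forms that unfolding control_forms_def by blast
  have velocity: "\<exists>\<nu>\<in>cotangent_space A ?e. incl A S z (X B z) ?C = (0, momentum A c ?e \<nu>) \<and>
      \<nu> (fiber_deriv A H z) = 0 \<and>
      (fiber_deriv A H z = (\<lambda>_. 0) \<longrightarrow> (\<forall>d\<in>D ?e. \<nu> d = 0))"
    if B: "B \<in> U" and z: "z \<in> points S" for B z
  proof -
    obtain \<mu> where z\<mu>: "z = (?e, \<mu>)" and \<mu>: "\<mu> \<in> cotangent_space A ?e"
      using z pts by auto
    let ?v = "fiber_deriv A H z"
    have vD: "?v \<in> D ?e"
      using state_velocity[OF z] z\<mu> by simp
    have v: "?v \<in> tangent_space A ?e"
      by (rule distribution_tangent[OF e vD])
    note forms = closed_two_form_props[OF \<beta>[OF B] e]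
    obtain m :: "nat \<Rightarrow> real" where m: "incl A S z (X B z) = vertical_lift A z (\<lambda>v. ad_star G A ?v \<mu> v +
        covector_restrict A ?e (\<beta> B ?e ?v) v + (\<Sum>i<k. m i * \<eta> i v))"
      using motion[rule_format, OF B, of \<mu>, OF z[unfolded z\<mu>] \<eta>] unfolding Let_def z\<mu> by blast
    let ?\<nu> = "\<lambda>v. ad_star G A ?v \<mu> v + covector_restrict A ?e (\<beta> B ?e ?v) v + (\<Sum>i<k. m i * \<eta> i v)"
    have \<eta>D: "(\<Sum>i<k. m i * \<eta> i d) = 0" if "d \<in> D ?e" for d
      using \<eta> that unfolding annihilator_basis_def by (intro sum.neutral) auto
    have "?\<nu> \<in> cotangent_space A ?e"
      using L.ad_star_in[OF v \<mu>] forms(1)[OF v] \<eta> unfolding annihilator_basis_def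
      by (intro cotangent_add cotangent_sum) auto
    moreover have "incl A S z (X B z) ?C = (0, momentum A c ?e ?\<nu>)"
      unfolding m unfolding z\<mu> by (rule vertical_lift_chart[OF c \<mu>])
    moreover have "?\<nu> ?v = 0"
      using L.ad_star_self[OF \<mu>] forms(4)[OF v] \<eta>D[OF vD] by (simp add: covector_restrict_def)
    moreover have "?\<nu> d = 0" if rest: "?v = (\<lambda>_. 0)" and d: "d \<in> D ?e" for d
    proof -
      have "\<mu> = (\<lambda>_. 0)"
        using state_flat[OF z] rest flat_zero[OF e] z\<mu> by simp
      then show ?thesis
        using rest L.ad_star_zero forms(3)[OF distribution_tangent[OF e d]] \<eta>D[OF d]
        by (simp add: covector_restrict_def)
    qed
    ultimately show ?thesis
      by blast
  qed
  have base: "fst z = ?e" if "z \<in> points S" for z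
    using that pts by auto
  obtain v where v: "v \<in> D ?e" "v \<noteq> (\<lambda>_. 0)"
    using distribution_nonzero[OF e] by blast
  note vT = distribution_tangent[OF e v(1)]
  have moving: "(?e, flat A g ?e v) \<in> points S"
    using S_iff[OF vT] v by blast
  show ?thesis
  proof (rule two_constants_of_motion[OF _ _ _ moving vT v(2)])
    show "optimal_system S U l X Bopt Y"
      by (rule optimal_systemI[OF state.S.smooth_atlas_axioms ctrl opt smooth Y])
    fix B z
    assume B: "B \<in> U" and z: "z \<in> points S"
    have cz: "fst z \<in> fst c"
      using c(2) base[OF z] by simp
    note C = cotangent_chart_in[OF c(1)] in_cotangent_chart[OF state_point[OF z] cz]
    obtain \<nu> where \<nu>: "\<nu> \<in> cotangent_space A ?e" "incl A S z (X B z) ?C = (0, momentum A c ?e \<nu>)"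
      "\<nu> (fiber_deriv A H z) = 0" "fiber_deriv A H z = (\<lambda>_. 0) \<Longrightarrow> d \<in> D ?e \<Longrightarrow> \<nu> d = 0" for d
      using velocity[OF B z] by blast
    have "fiber_deriv A H z \<in> tangent_space A ?e"
      using fiber_deriv_in[OF state_point[OF z]] base[OF z] by simp
    then have "fiber_deriv A H z c \<bullet> momentum A c ?e \<nu> = 0"
      using covector_apply[OF \<nu>(1) c] \<nu>(3) by simp
    then show "differential S H z (X B z) = 0"
      using differential_state[OF z X_in[OF B z]] \<nu>(2)
        state.M.differential_chart[OF state.M.smooth_fun_differentiable[OF H_smooth C] C
          state.incl.tangent_map_in[OF z X_in[OF B z]]]
        fiber_derivative_apply[OF c(1) cz state_point[OF z]] by simp
    assume rest: "fiber_deriv A H z = (\<lambda>_. 0)"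
    show "X B z = (\<lambda>_. 0)"
    proof (rule vertical_reaction_vanishes[OF z X_in[OF B z] c(1) cz rest \<nu>(2)])
      fix d
      assume "d \<in> D (fst z)"
      then have d: "d \<in> D ?e"
        using base[OF z] by simp
      show "momentum A c ?e \<nu> \<bullet> d c = 0"
        using \<nu>(4)[OF rest d] covector_apply[OF \<nu>(1) c distribution_tangent[OF e d]]
        by (simp add: inner_commute)
    qed
  qed
qed

theorem proposition2:
  fixes A :: "('q, 'e::euclidean_space) atlas"
    and H :: "('q, 'e) cotangent \<Rightarrow> real"
    and k :: nat
    and D :: "'q \<Rightarrow> ('q, 'e) tvec set"
    and U :: "'b::euclidean_space set"
    and \<beta> :: "'b \<Rightarrow> ('q, 'e) tensor2"
    and S :: "(('q, 'e) cotangent, 'd::euclidean_space) atlas"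
    and X :: "'b \<Rightarrow> ('q, 'e) cotangent \<Rightarrow> (('q, 'e) cotangent, 'd) tvec"
    and \<l> :: "('q, 'e) cotangent \<Rightarrow> 'b \<Rightarrow> real"
    and Bopt :: "(('q, 'e) cotangent, 'd) cotangent \<Rightarrow> 'b"
    and Hopt :: "(('q, 'e) cotangent, 'd) cotangent \<Rightarrow> real"
    and Y :: "(('q, 'e) cotangent, 'd) cotangent \<Rightarrow> ((('q, 'e) cotangent, 'd) cotangent, 'd \<times> 'd) tvec"
  assumes system: "magnetic_nonholonomic_general A H k D U \<beta> S X \<or>
                   (\<exists>G. magnetic_nonholonomic_reduced G A H k D U \<beta> S X)"
    and cost: "smooth_cost S U \<l>"
    and opt: "optimal_control S U \<l> X Bopt"
    and Hopt: "Hopt = optimal_hamiltonian U \<l> X"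
    and Hopt_smooth: "smooth_fun (cotangent_atlas S) Hopt"
    and Y: "hamiltonian_vector_field S Hopt Y"
  shows "\<exists>E\<^sub>1 E\<^sub>2. constant_of_motion (cotangent_atlas S) Y E\<^sub>1 \<and>
                 constant_of_motion (cotangent_atlas S) Y E\<^sub>2 \<and>
                 independent_modulo_constants (cotangent_atlas S) E\<^sub>1 E\<^sub>2 \<and>
                 (\<forall>z\<in>points (cotangent_atlas S). X (Bopt z) (fst z) \<noteq> (\<lambda>_. 0) \<longrightarrow>
                    functionally_independent_at (cotangent_atlas S) E\<^sub>1 E\<^sub>2 z)"
  using system
proof
  assume "magnetic_nonholonomic_general A H k D U \<beta> S X"
  from general_constants_of_motion[OF this opt] show ?thesis
    using Hopt_smooth Y unfolding Hopt by blast
next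
  assume "\<exists>G. magnetic_nonholonomic_reduced G A H k D U \<beta> S X"
  then obtain G where "magnetic_nonholonomic_reduced G A H k D U \<beta> S X"
    by blast
  from reduced_constants_of_motion[OF this opt] show ?thesis
    using Hopt_smooth Y unfolding Hopt by blast
qed

end
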